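(* Let $I$ be a totally ordered set with at least two elements and $\{(\mathcal A_i,\varphi_i,\psi_i,\theta_i)\}_{i\in I}$ a family of unital 3-$\ast$-algebraic probability spaces. For each $i\in I$ let $\pi_i,\sigma_i,\rho_i:\mathcal A_i\to\mathcal L^\ast(H_i)$ be unital $\ast$-representations on a pointed pre-Hilbert space $(H_i,\xi_i)$ with $\varphi_i(a)=\langle\xi_i,\pi_i(a)\xi_i\rangle$, $\psi_i(a)=\langle\xi_i,\sigma_i(a)\xi_i\rangle$ and $\theta_i(a)=\langle\xi_i,\rho_i(a)\xi_i\rangle$ for all $a\in\mathcal A_i$. Let $(H,\xi)$ be the free product of $\{(H_i,\xi_i)\}_{i\in I}$ and let $J^\alpha,J^\beta,J^\gamma:\ast_{i\in I}\mathcal A_i\to\mathcal L^\ast(H)$ be the unital $\ast$-homomorphisms, constructed from these data as described in the context. Then the triplet of states $(\varphi,\psi,\theta)$ on $\ast_{i\in I}\mathcal A_i$ defined by $$\varphi(a):=\langle\xi,J^\alpha(a)\xi\rangle,\quad\psi(a):=\langle\xi,J^\beta(a)\xi\rangle,\quad\theta(a):=\langle\xi,J^\gamma(a)\xi\rangle\qquad(a\in\ast_{i\in I}\mathcal A_i)$$ is the $\alpha$-free product, i.e. $(\ast_{i\in I}\mathcal A_i,\varphi,\psi,\theta)=\leftthreetimes_{i\in I}(\mathcal A_i,\varphi_i,\psi_i,\theta_i)$.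
   Context: Algebras are over $\mathbb C$. A unital 3-$\ast$-algebraic probability space $(\mathcal A,\varphi,\psi,\theta)$ is a unital $\ast$-algebra with three states (unital linear functionals with $\varphi(a^\ast a)\ge0$). $\ast_{i\in I}\mathcal A_i$ is the unital free product (coproduct of unital algebras), a $\ast$-algebra with the canonical involution; each $\mathcal A_i$ is a subalgebra of it. **Free product of pre-Hilbert spaces.** A pointed pre-Hilbert space $(H_i,\xi_i)$ is a pre-Hilbert space with a unit vector; inner products are linear in the right variable. $\mathcal L^\ast(H)$ is the set of adjointable linear operators on $H$. Put $H_i^0=H_i\ominus\mathbb C\xi_i$ and $$H=\mathbb C\xi\oplus\bigoplus_{n\ge1}\bigoplus_{i_1\ne i_2\neq\cdots\ne i_n}H_{i_1}^0\otimes\cdots\otimes H_{i_n}^0$$ (orthogonal algebraic direct sum, $\xi$ a unit vector). Let $H(i)$ be the subspace given by $\mathbb C\xi$ and the summands with $i_1\ne i$, and let $U_i:H\to H_i\otimes H(i)$ be the canonical isomorphism: $U_i\xi=\xi_i\otimes\xi$; $U_if=f\otimes\xi$ for $f\in H_i^0$; for $f_1\otimes\cdots\otimes f_n\in H_{i_1}^0\otimes\cdots\otimes H_{i_n}^0$, $U_i(f_1\otimes\cdots\otimes f_n)=f_1\otimes(f_2\otimes\cdots\otimes f_n)$ if $i_1=i$, $n\ge2$, and $=\xi_i\otimes(f_1\otimes\cdots\otimes f_n)$ if $i_1\ne i$. Let $\lambda_i:\mathcal L^\ast(H_i)\to\mathcal L^\ast(H)$, $\lambda_i(A)=U_i^\ast(A\otimes\mathrm{id}_{H(i)})U_i$.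 Let $B(i)$ be the direct sum of all summands $H_{i_1}^0\otimes\cdots\otimes H_{i_n}^0$ ($i_1\ne\cdots\ne i_n$) with $n\ge1$, $i_1<i$, or with $n\ge2$, $i_1=i$, $i_2<i$. Let $C(i)$ be the direct sum of those with $n\ge1$, $i_1>i$, or with $n\ge2$, $i_1=i$, $i_2>i$. Identifying $\mathbb C\xi\oplus H_i^0$ with $H_i$, one has $H=H_i\oplus B(i)\oplus C(i)$, and each of the three subspaces is invariant under $\lambda_i(\mathcal L^\ast(H_i))$. $P_K$ denotes the orthogonal projection onto $K$. Define unital $\ast$-homomorphisms $\mathcal A_i\to\mathcal L^\ast(H)$ by $$J_i^\alpha(a)=\lambda_i(\pi_i(a))P_{H_i}\oplus\lambda_i(\sigma_i(a))P_{B(i)}\oplus\lambda_i(\rho_i(a))P_{C(i)},$$ $$J_i^\beta(a)=\lambda_i(\sigma_i(a))P_{H_i\oplus B(i)}\oplus\lambda_i(\rho_i(a))P_{C(i)},\qquad J_i^\gamma(a)=\lambda_i(\sigma_i(a))P_{B(i)}\oplus\lambda_i(\rho_i(a))P_{H_i\oplus C(i)}.$$ $J^\alpha,J^\beta,J^\gamma$ are the unique unital $\ast$-homomorphisms $\ast_{i\in I}\mathcal A_i\to\mathcal L^\ast(H)$ restricting on each $\mathcal A_i$ to $J_i^\alpha,J_i^\beta,J_i^\gamma$, respectively. **$\alpha$-free product.** $I^\ast$ is the set of finite sequences $\mathbf i=(i_1,\dots,i_n)$, $n\ge1$, in $I$ with $i_k\ne i_{k+1}$. $\mathrm{Peak}(\mathbf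 i)=\{k\in\{2,\dots,n-1\}: i_{k-1}<i_k>i_{k+1}\}$, $\mathrm{Bot}(\mathbf i)=\{k\in\{2,\dots,n-1\}: i_{k-1}>i_k<i_{k+1}\}$. Define linear functionals on $\mathcal A_{i_k}$: $\alpha_{\mathbf i,1}=\varphi_{i_1}$, $\alpha_{\mathbf i,k}=\psi_{i_k}$ if $k\in\mathrm{Peak}(\mathbf i)$, $\theta_{i_k}$ if $k\in\mathrm{Bot}(\mathbf i)$, $0$ otherwise; $\beta_{\mathbf i,k}$ (resp. $\gamma_{\mathbf i,k}$) is defined in the same way with $\varphi_{i_1}$ replaced by $\psi_{i_1}$ (resp. $\theta_{i_1}$). The $\alpha$-free product $\leftthreetimes_{i\in I}(\mathcal A_i,\varphi_i,\psi_i,\theta_i)$ is the unique tuple $(\mathcal A,\varphi,\psi,\theta)$ with $\mathcal A=\ast_{i\in I}\mathcal A_i$ and unital linear functionals such that for every $\mathbf i\in I^\ast$ and $a_k\in\mathcal A_{i_k}$: $\varphi(a_1\cdots a_n)=0$ if all $a_k\in\ker\alpha_{\mathbf i,k}$; $\psi(a_1\cdots a_n)=0$ if all $a_k\in\ker\beta_{\mathbf i,k}$; $\theta(a_1\cdots a_n)=0$ if all $a_k\in\ker\gamma_{\mathbf i,k}$. *)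

theory Defs
  imports
    Complex_Main
    "HOL-Library.FuncSet"
    "HOL-Library.Nonpos_Ints"
    "HOL-Algebra.Module"
    "HOL-Algebra.QuotRing"
begin

definition complex_field :: "complex ring" where
  "complex_field = \<lparr>carrier = UNIV, mult = (*), one = 1, zero = 0, add = (+)\<rparr>"


section \<open>Unital star-algebras and states\<close>

record 'a star_algebra = "(complex, 'a) module" +
  star :: "'a \<Rightarrow> 'a"

locale unital_star_algebra = module complex_field A + ring A
  for A :: "('a, 'm) star_algebra_scheme" (structure) +
  assumes smult_mult_left:
      "\<lbrakk>x \<in> carrier A; y \<in> carrier A\<rbrakk> \<Longrightarrow> (c \<odot>\<^bsub>A\<^esub> x) \<otimes>\<^bsub>A\<^esub> y = c \<odot>\<^bsub>A\<^esub> (x \<otimes>\<^bsub>A\<^esub> y)"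
    and smult_mult_right:
      "\<lbrakk>x \<in> carrier A; y \<in> carrier A\<rbrakk> \<Longrightarrow> x \<otimes>\<^bsub>A\<^esub> (c \<odot>\<^bsub>A\<^esub> y) = c \<odot>\<^bsub>A\<^esub> (x \<otimes>\<^bsub>A\<^esub> y)"
    and star_closed: "x \<in> carrier A \<Longrightarrow> star A x \<in> carrier A"
    and star_add:
      "\<lbrakk>x \<in> carrier A; y \<in> carrier A\<rbrakk> \<Longrightarrow> star A (x \<oplus>\<^bsub>A\<^esub> y) = star A x \<oplus>\<^bsub>A\<^esub> star A y"
    and star_smult: "x \<in> carrier A \<Longrightarrow> star A (c \<odot>\<^bsub>A\<^esub> x) = cnj c \<odot>\<^bsub>A\<^esub> star A x"
    and star_mult:
      "\<lbrakk>x \<in> carrier A; y \<in> carrier A\<rbrakk> \<Longrightarrow> star A (x \<otimes>\<^bsub>A\<^esub> y) = star A y \<otimes>\<^bsub>A\<^esub> star A x"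
    and star_star: "x \<in> carrier A \<Longrightarrow> star A (star A x) = x"

definition unital_star_hom ::
  "('a, 'm) star_algebra_scheme \<Rightarrow> ('b, 'n) star_algebra_scheme \<Rightarrow> ('a \<Rightarrow> 'b) \<Rightarrow> bool" where
  "unital_star_hom A B h \<longleftrightarrow>
     h \<in> ring_hom A B \<and>
     (\<forall>c. \<forall>x\<in>carrier A. h (c \<odot>\<^bsub>A\<^esub> x) = c \<odot>\<^bsub>B\<^esub> h x) \<and>
     (\<forall>x\<in>carrier A. h (star A x) = star B (h x))"

definition unital_linear_functional ::
  "('a, 'm) star_algebra_scheme \<Rightarrow> ('a \<Rightarrow> complex) \<Rightarrow> bool" where
  "unital_linear_functional A f \<longleftrightarrow>
     (\<forall>x\<in>carrier A. \<forall>y\<in>carrier A. f (x \<oplus>\<^bsub>A\<^esub> y) = f x + f y) \<and>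
     (\<forall>c. \<forall>x\<in>carrier A. f (c \<odot>\<^bsub>A\<^esub> x) = c * f x) \<and>
     f \<one>\<^bsub>A\<^esub> = 1"

definition state :: "('a, 'm) star_algebra_scheme \<Rightarrow> ('a \<Rightarrow> complex) \<Rightarrow> bool" where
  "state A f \<longleftrightarrow>
     unital_linear_functional A f \<and> (\<forall>a\<in>carrier A. f (star A a \<otimes>\<^bsub>A\<^esub> a) \<in> \<real>\<^sub>\<ge>\<^sub>0)"

definition star_probability_space3 ::
  "('a, 'm) star_algebra_scheme \<Rightarrow> ('a \<Rightarrow> complex) \<Rightarrow> ('a \<Rightarrow> complex) \<Rightarrow> ('a \<Rightarrow> complex) \<Rightarrow> bool"
where
  "star_probability_space3 A \<phi> \<psi> \<theta> \<longleftrightarrow>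
     unital_star_algebra A \<and> state A \<phi> \<and> state A \<psi> \<and> state A \<theta>"


section \<open>The unital free product of star-algebras\<close>

text \<open>
  The coproduct of a family of unital algebras is constructed as the free unital algebra on the
  disjoint union of the carriers, modulo the two-sided ideal that makes every embedding of letters
  a unital algebra homomorphism.  Elements of the free algebra are finitely supported functions
  from words of letters to the complex numbers, multiplied by convolution.
\<close>

definition letters :: "('i \<Rightarrow> ('a, 'm) star_algebra_scheme) \<Rightarrow> ('i \<times> 'a) set" where
  "letters A = (SIGMA i : UNIV. carrier (A i))"

definition star_word ::
  "('i \<Rightarrow> ('a, 'm) star_algebra_scheme) \<Rightarrow> ('i \<times> 'a) list \<Rightarrow> ('i \<times> 'a) list" where
  "star_word A w = rev (map (\<lambda>(i, a). (i, star (A i) a)) w)"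

definition free_algebra ::
  "('i \<Rightarrow> ('a, 'm) star_algebra_scheme) \<Rightarrow> (('i \<times> 'a) list \<Rightarrow> complex) star_algebra" where
  "free_algebra A =
    \<lparr>carrier = {f. finite {w. f w \<noteq> 0} \<and> {w. f w \<noteq> 0} \<subseteq> lists (letters A)},
     mult = (\<lambda>f g w. \<Sum>k\<le>length w. f (take k w) * g (drop k w)),
     one = (\<lambda>w. if w = [] then 1 else 0),
     zero = (\<lambda>w. 0),
     add = (\<lambda>f g w. f w + g w),
     smult = (\<lambda>c f w. c * f w),
     star = (\<lambda>f w. if w \<in> lists (letters A) then cnj (f (star_word A w)) else 0)\<rparr>"

definition letter :: "'i \<Rightarrow> 'a \<Rightarrow> ('i \<times> 'a) list \<Rightarrow> complex" where
  "letter i a = (\<lambda>w. if w = [(i, a)] then 1 else 0)"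

definition coproduct_relations ::
  "('i \<Rightarrow> ('a, 'm) star_algebra_scheme) \<Rightarrow> (('i \<times> 'a) list \<Rightarrow> complex) set" where
  "coproduct_relations A =
     (let F = free_algebra A in
      {letter i (a \<oplus>\<^bsub>A i\<^esub> b) \<ominus>\<^bsub>F\<^esub> (letter i a \<oplus>\<^bsub>F\<^esub> letter i b) | i a b.
         a \<in> carrier (A i) \<and> b \<in> carrier (A i)} \<union>
      {letter i (c \<odot>\<^bsub>A i\<^esub> a) \<ominus>\<^bsub>F\<^esub> (c \<odot>\<^bsub>F\<^esub> letter i a) | i c a. a \<in> carrier (A i)} \<union>
      {letter i (a \<otimes>\<^bsub>A i\<^esub> b) \<ominus>\<^bsub>F\<^esub> (letter i a \<otimes>\<^bsub>F\<^esub> letter i b) | i a b.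
         a \<in> carrier (A i) \<and> b \<in> carrier (A i)} \<union>
      {letter i \<one>\<^bsub>A i\<^esub> \<ominus>\<^bsub>F\<^esub> \<one>\<^bsub>F\<^esub> | i. True})"

definition coproduct_ideal ::
  "('i \<Rightarrow> ('a, 'm) star_algebra_scheme) \<Rightarrow> (('i \<times> 'a) list \<Rightarrow> complex) set" where
  "coproduct_ideal A = Idl\<^bsub>free_algebra A\<^esub> (coproduct_relations A)"

text \<open>
  The ring part is the library's quotient ring; scalar multiplication and involution are defined
  on cosets in the same style as \<^const>\<open>rcoset_mult\<close>.
\<close>

definition free_product ::
  "('i \<Rightarrow> ('a, 'm) star_algebra_scheme) \<Rightarrow> (('i \<times> 'a) list \<Rightarrow> complex) set star_algebra" where
  "free_product A =
     (let F = free_algebra A; N = coproduct_ideal A; Q = F Quot N in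
      \<lparr>carrier = carrier Q, mult = mult Q, one = one Q, zero = zero Q, add = add Q,
       smult = (\<lambda>c X. \<Union>f\<in>X. N +>\<^bsub>F\<^esub> (c \<odot>\<^bsub>F\<^esub> f)),
       star = (\<lambda>X. \<Union>f\<in>X. N +>\<^bsub>F\<^esub> star F f)\<rparr>)"

definition letter_embed ::
  "('i \<Rightarrow> ('a, 'm) star_algebra_scheme) \<Rightarrow> 'i \<Rightarrow> 'a \<Rightarrow> (('i \<times> 'a) list \<Rightarrow> complex) set" where
  "letter_embed A i a = coproduct_ideal A +>\<^bsub>free_algebra A\<^esub> letter i a"

definition word_product ::
  "('i \<Rightarrow> ('a, 'm) star_algebra_scheme) \<Rightarrow> ('i \<times> 'a) list \<Rightarrow> (('i \<times> 'a) list \<Rightarrow> complex) set" where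
  "word_product A w =
     foldr (\<lambda>(i, a) x. letter_embed A i a \<otimes>\<^bsub>free_product A\<^esub> x) w \<one>\<^bsub>free_product A\<^esub>"


section \<open>Pre-Hilbert spaces and adjointable operators\<close>

text \<open>
  As for modules in \<^theory>\<open>HOL-Algebra.Module\<close>, the ring multiplication and unit of the
  underlying record carry no meaning for a pre-Hilbert space.
\<close>

record 'h pre_hilbert = "(complex, 'h) module" +
  ip :: "'h \<Rightarrow> 'h \<Rightarrow> complex"

locale pre_hilbert_space = module complex_field H
  for H :: "('h, 'm) pre_hilbert_scheme" (structure) +
  assumes ip_add_right:
      "\<lbrakk>x \<in> carrier H; y \<in> carrier H; z \<in> carrier H\<rbrakk> \<Longrightarrow> ip H x (y \<oplus>\<^bsub>H\<^esub> z) = ip H x y + ip H x z"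
    and ip_smult_right:
      "\<lbrakk>x \<in> carrier H; y \<in> carrier H\<rbrakk> \<Longrightarrow> ip H x (c \<odot>\<^bsub>H\<^esub> y) = c * ip H x y"
    and ip_commute: "\<lbrakk>x \<in> carrier H; y \<in> carrier H\<rbrakk> \<Longrightarrow> ip H y x = cnj (ip H x y)"
    and ip_nonneg: "x \<in> carrier H \<Longrightarrow> ip H x x \<in> \<real>\<^sub>\<ge>\<^sub>0"
    and ip_definite: "\<lbrakk>x \<in> carrier H; ip H x x = 0\<rbrakk> \<Longrightarrow> x = \<zero>\<^bsub>H\<^esub>"

definition pointed_pre_hilbert_space :: "('h, 'm) pre_hilbert_scheme \<Rightarrow> 'h \<Rightarrow> bool" where
  "pointed_pre_hilbert_space H \<xi> \<longleftrightarrow>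
     pre_hilbert_space H \<and> \<xi> \<in> carrier H \<and> ip H \<xi> \<xi> = 1"

text \<open>
  Linear maps are extensional (\<^const>\<open>undefined\<close> outside the carrier), so that maps agreeing on
  the carrier are equal.
\<close>

definition linear_maps ::
  "('h, 'm) pre_hilbert_scheme \<Rightarrow> ('k, 'n) pre_hilbert_scheme \<Rightarrow> ('h \<Rightarrow> 'k) set" where
  "linear_maps H K =
     {T \<in> carrier H \<rightarrow>\<^sub>E carrier K.
        (\<forall>x\<in>carrier H. \<forall>y\<in>carrier H. T (x \<oplus>\<^bsub>H\<^esub> y) = T x \<oplus>\<^bsub>K\<^esub> T y) \<and>
        (\<forall>c. \<forall>x\<in>carrier H. T (c \<odot>\<^bsub>H\<^esub> x) = c \<odot>\<^bsub>K\<^esub> T x)}"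

definition is_adjoint ::
  "('h, 'm) pre_hilbert_scheme \<Rightarrow> ('k, 'n) pre_hilbert_scheme \<Rightarrow> ('h \<Rightarrow> 'k) \<Rightarrow> ('k \<Rightarrow> 'h) \<Rightarrow> bool"
where
  "is_adjoint H K T S \<longleftrightarrow>
     S \<in> linear_maps K H \<and> (\<forall>x\<in>carrier H. \<forall>y\<in>carrier K. ip H (S y) x = ip K y (T x))"

definition adjoint ::
  "('h, 'm) pre_hilbert_scheme \<Rightarrow> ('k, 'n) pre_hilbert_scheme \<Rightarrow> ('h \<Rightarrow> 'k) \<Rightarrow> 'k \<Rightarrow> 'h" where
  "adjoint H K T = (THE S. is_adjoint H K T S)"

definition adjointable_operators ::
  "('h, 'm) pre_hilbert_scheme \<Rightarrow> ('h \<Rightarrow> 'h) star_algebra" where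
  "adjointable_operators H =
    \<lparr>carrier = {T \<in> linear_maps H H. \<exists>S. is_adjoint H H T S},
     mult = compose (carrier H),
     one = (\<lambda>x\<in>carrier H. x),
     zero = (\<lambda>x\<in>carrier H. \<zero>\<^bsub>H\<^esub>),
     add = (\<lambda>S T. \<lambda>x\<in>carrier H. S x \<oplus>\<^bsub>H\<^esub> T x),
     smult = (\<lambda>c T. \<lambda>x\<in>carrier H. c \<odot>\<^bsub>H\<^esub> T x),
     star = adjoint H H\<rparr>"

definition orth_proj :: "('h, 'm) pre_hilbert_scheme \<Rightarrow> 'h set \<Rightarrow> 'h \<Rightarrow> 'h" where
  "orth_proj H K =
     (\<lambda>x\<in>carrier H. THE y. y \<in> K \<and> (\<forall>z\<in>K. ip H z (x \<ominus>\<^bsub>H\<^esub> y) = 0))"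


section \<open>Algebraic tensor products\<close>

text \<open>
  The algebraic tensor product of pre-Hilbert spaces is realized as in Reed and Simon, Section II.4:
  the simple tensor of \<open>f\<close> and \<open>g\<close> is the conjugate-bilinear form sending \<open>(u, v)\<close> to
  \<open>\<langle>u, f\<rangle> \<langle>v, g\<rangle>\<close>, the tensor product is the linear span of the simple tensors, and
  \<open>\<langle>f \<otimes> g, f' \<otimes> g'\<rangle> = \<langle>f, f'\<rangle> \<langle>g, g'\<rangle>\<close>.

  Binary tensor products and the direct sum of tensor products in the free product of spaces are
  both instances of one construction.  Given a set \<open>X\<close> of generators and their prescribed mutual
  inner products \<open>k\<close>, the generator \<open>w\<close> becomes the function \<open>v \<mapsto> k v w\<close> on \<open>X\<close>.
\<close>

definition generator :: "'x set \<Rightarrow> ('x \<Rightarrow> 'x \<Rightarrow> complex) \<Rightarrow> 'x \<Rightarrow> 'x \<Rightarrow> complex" where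
  "generator X k w = (\<lambda>v. if v \<in> X then k v w else 0)"

definition combination ::
  "'x set \<Rightarrow> ('x \<Rightarrow> 'x \<Rightarrow> complex) \<Rightarrow> 'x set \<Rightarrow> ('x \<Rightarrow> complex) \<Rightarrow> 'x \<Rightarrow> complex" where
  "combination X k F c = (\<lambda>v. \<Sum>w\<in>F. c w * generator X k w v)"

definition span_of :: "'x set \<Rightarrow> ('x \<Rightarrow> 'x \<Rightarrow> complex) \<Rightarrow> 'x set \<Rightarrow> ('x \<Rightarrow> complex) set" where
  "span_of X k S = {combination X k F c | F c. finite F \<and> F \<subseteq> S}"

definition generated_space ::
  "'x set \<Rightarrow> ('x \<Rightarrow> 'x \<Rightarrow> complex) \<Rightarrow> ('x \<Rightarrow> complex) pre_hilbert" where
  "generated_space X k =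
    \<lparr>carrier = span_of X k X,
     mult = undefined,
     one = undefined,
     zero = (\<lambda>v. 0),
     add = (\<lambda>x y v. x v + y v),
     smult = (\<lambda>c x v. c * x v),
     ip = (\<lambda>x y. THE z. \<exists>F c G d.
       finite F \<and> F \<subseteq> X \<and> x = combination X k F c \<and>
       finite G \<and> G \<subseteq> X \<and> y = combination X k G d \<and>
       z = (\<Sum>v\<in>F. \<Sum>w\<in>G. cnj (c v) * d w * k v w))\<rparr>"

definition tensor_kernel ::
  "('h, 'm) pre_hilbert_scheme \<Rightarrow> ('k, 'n) pre_hilbert_scheme \<Rightarrow> 'h \<times> 'k \<Rightarrow> 'h \<times> 'k \<Rightarrow> complex" where
  "tensor_kernel H K = (\<lambda>(f, g) (f', g'). ip H f f' * ip K g g')"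

definition tensor_space ::
  "('h, 'm) pre_hilbert_scheme \<Rightarrow> ('k, 'n) pre_hilbert_scheme \<Rightarrow> ('h \<times> 'k \<Rightarrow> complex) pre_hilbert"
where
  "tensor_space H K = generated_space (carrier H \<times> carrier K) (tensor_kernel H K)"

definition tensor ::
  "('h, 'm) pre_hilbert_scheme \<Rightarrow> ('k, 'n) pre_hilbert_scheme \<Rightarrow> 'h \<Rightarrow> 'k \<Rightarrow> 'h \<times> 'k \<Rightarrow> complex" where
  "tensor H K f g = generator (carrier H \<times> carrier K) (tensor_kernel H K) (f, g)"

definition tensor_operator ::
  "('h, 'm) pre_hilbert_scheme \<Rightarrow> ('k, 'n) pre_hilbert_scheme \<Rightarrow> ('h \<Rightarrow> 'h) \<Rightarrow> ('k \<Rightarrow> 'k)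
     \<Rightarrow> ('h \<times> 'k \<Rightarrow> complex) \<Rightarrow> ('h \<times> 'k \<Rightarrow> complex)" where
  "tensor_operator H K S T =
     (THE R. R \<in> linear_maps (tensor_space H K) (tensor_space H K) \<and>
        (\<forall>f\<in>carrier H. \<forall>g\<in>carrier K. R (tensor H K f g) = tensor H K (S f) (T g)))"


section \<open>The free product of pointed pre-Hilbert spaces\<close>

text \<open>
  The word \<open>[(i\<^sub>1, f\<^sub>1), \<dots>, (i\<^sub>n, f\<^sub>n)]\<close> stands for \<open>f\<^sub>1 \<otimes> \<cdots> \<otimes> f\<^sub>n\<close> in the summand with index
  sequence \<open>[i\<^sub>1, \<dots>, i\<^sub>n]\<close>, and the empty word for the vacuum vector.  Words with different index
  sequences are orthogonal, so the generated space is the orthogonal algebraic direct sum of the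
  summands.
\<close>

definition centered :: "('h, 'm) pre_hilbert_scheme \<Rightarrow> 'h \<Rightarrow> 'h set" where
  "centered H \<xi> = {f \<in> carrier H. ip H \<xi> f = 0}"

definition tensor_words ::
  "('i \<Rightarrow> ('h, 'm) pre_hilbert_scheme) \<Rightarrow> ('i \<Rightarrow> 'h) \<Rightarrow> ('i \<times> 'h) list set" where
  "tensor_words Hs \<xi>s =
     {w. distinct_adj (map fst w) \<and> (\<forall>(i, f)\<in>set w. f \<in> centered (Hs i) (\<xi>s i))}"

definition word_kernel ::
  "('i \<Rightarrow> ('h, 'm) pre_hilbert_scheme) \<Rightarrow> ('i \<times> 'h) list \<Rightarrow> ('i \<times> 'h) list \<Rightarrow> complex" where
  "word_kernel Hs v w =
     (if map fst v = map fst w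
      then \<Prod>k<length w. ip (Hs (fst (w ! k))) (snd (v ! k)) (snd (w ! k))
      else 0)"

type_synonym ('i, 'h) fock_vector = "('i \<times> 'h) list \<Rightarrow> complex"

definition free_space ::
  "('i \<Rightarrow> ('h, 'm) pre_hilbert_scheme) \<Rightarrow> ('i \<Rightarrow> 'h) \<Rightarrow> ('i, 'h) fock_vector pre_hilbert" where
  "free_space Hs \<xi>s = generated_space (tensor_words Hs \<xi>s) (word_kernel Hs)"

definition word_vector ::
  "('i \<Rightarrow> ('h, 'm) pre_hilbert_scheme) \<Rightarrow> ('i \<Rightarrow> 'h) \<Rightarrow> ('i \<times> 'h) list \<Rightarrow> ('i, 'h) fock_vector" where
  "word_vector Hs \<xi>s w = generator (tensor_words Hs \<xi>s) (word_kernel Hs) w"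

definition vacuum ::
  "('i \<Rightarrow> ('h, 'm) pre_hilbert_scheme) \<Rightarrow> ('i \<Rightarrow> 'h) \<Rightarrow> ('i, 'h) fock_vector" where
  "vacuum Hs \<xi>s = word_vector Hs \<xi>s []"

text \<open>The direct sum of the summands whose index sequence lies in \<open>S\<close>.\<close>

definition summands ::
  "('i \<Rightarrow> ('h, 'm) pre_hilbert_scheme) \<Rightarrow> ('i \<Rightarrow> 'h) \<Rightarrow> 'i list set \<Rightarrow> ('i, 'h) fock_vector set" where
  "summands Hs \<xi>s S =
     span_of (tensor_words Hs \<xi>s) (word_kernel Hs) {w \<in> tensor_words Hs \<xi>s. map fst w \<in> S}"

text \<open>
  Index sequences of the subspaces \<open>H(i)\<close>, \<open>H\<^sub>i = \<complex>\<xi> \<oplus> H\<^sub>i\<^sup>0\<close>, \<open>B(i)\<close> and \<open>C(i)\<close>.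
\<close>

definition seqs_rest :: "'i \<Rightarrow> 'i list set" where
  "seqs_rest i = {js. js = [] \<or> hd js \<noteq> i}"

definition seqs_H :: "'i \<Rightarrow> 'i list set" where
  "seqs_H i = {[], [i]}"

definition seqs_B :: "'i::linorder \<Rightarrow> 'i list set" where
  "seqs_B i = {js. (length js \<ge> 1 \<and> js ! 0 < i) \<or> (length js \<ge> 2 \<and> js ! 0 = i \<and> js ! 1 < i)}"

definition seqs_C :: "'i::linorder \<Rightarrow> 'i list set" where
  "seqs_C i = {js. (length js \<ge> 1 \<and> js ! 0 > i) \<or> (length js \<ge> 2 \<and> js ! 0 = i \<and> js ! 1 > i)}"

definition rest_space ::
  "('i \<Rightarrow> ('h, 'm) pre_hilbert_scheme) \<Rightarrow> ('i \<Rightarrow> 'h) \<Rightarrow> 'i \<Rightarrow> ('i, 'h) fock_vector pre_hilbert" where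
  "rest_space Hs \<xi>s i = (free_space Hs \<xi>s)\<lparr>carrier := summands Hs \<xi>s (seqs_rest i)\<rparr>"

text \<open>
  The canonical isomorphism \<open>U\<^sub>i\<close> from \<open>H\<close> to \<open>H\<^sub>i \<otimes> H(i)\<close>, given by its values on simple tensors.
  The case \<open>v = []\<close> of the second clause is \<open>U\<^sub>i f = f \<otimes> \<xi>\<close>.
\<close>

definition U_on_word ::
  "('i \<Rightarrow> ('h, 'm) pre_hilbert_scheme) \<Rightarrow> ('i \<Rightarrow> 'h) \<Rightarrow> 'i \<Rightarrow> ('i \<times> 'h) list
     \<Rightarrow> 'h \<times> ('i, 'h) fock_vector \<Rightarrow> complex" where
  "U_on_word Hs \<xi>s i w =
     (case w of
        [] \<Rightarrow> tensor (Hs i) (rest_space Hs \<xi>s i) (\<xi>s i) (vacuum Hs \<xi>s)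
      | (j, f) # v \<Rightarrow>
          if j = i
          then tensor (Hs i) (rest_space Hs \<xi>s i) f (word_vector Hs \<xi>s v)
          else tensor (Hs i) (rest_space Hs \<xi>s i) (\<xi>s i) (word_vector Hs \<xi>s w))"

definition canonical_U ::
  "('i \<Rightarrow> ('h, 'm) pre_hilbert_scheme) \<Rightarrow> ('i \<Rightarrow> 'h) \<Rightarrow> 'i \<Rightarrow> ('i, 'h) fock_vector
     \<Rightarrow> 'h \<times> ('i, 'h) fock_vector \<Rightarrow> complex" where
  "canonical_U Hs \<xi>s i =
     (THE U. U \<in> linear_maps (free_space Hs \<xi>s) (tensor_space (Hs i) (rest_space Hs \<xi>s i)) \<and>
        (\<forall>w\<in>tensor_words Hs \<xi>s. U (word_vector Hs \<xi>s w) = U_on_word Hs \<xi>s i w))"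

definition lambda_op ::
  "('i \<Rightarrow> ('h, 'm) pre_hilbert_scheme) \<Rightarrow> ('i \<Rightarrow> 'h) \<Rightarrow> 'i \<Rightarrow> ('h \<Rightarrow> 'h)
     \<Rightarrow> ('i, 'h) fock_vector \<Rightarrow> ('i, 'h) fock_vector" where
  "lambda_op Hs \<xi>s i T =
     (let H = free_space Hs \<xi>s; K = rest_space Hs \<xi>s i; U = canonical_U Hs \<xi>s i in
      compose (carrier H) (adjoint H (tensor_space (Hs i) K) U)
        (compose (carrier H) (tensor_operator (Hs i) K T (\<lambda>x\<in>carrier K. x)) U))"

abbreviation proj ::
  "('i \<Rightarrow> ('h, 'm) pre_hilbert_scheme) \<Rightarrow> ('i \<Rightarrow> 'h) \<Rightarrow> 'i list set
     \<Rightarrow> ('i, 'h) fock_vector \<Rightarrow> ('i, 'h) fock_vector" where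
  "proj Hs \<xi>s S \<equiv> orth_proj (free_space Hs \<xi>s) (summands Hs \<xi>s S)"

definition J_alpha ::
  "('i::linorder \<Rightarrow> ('h, 'm) pre_hilbert_scheme) \<Rightarrow> ('i \<Rightarrow> 'h)
     \<Rightarrow> ('i \<Rightarrow> 'a \<Rightarrow> 'h \<Rightarrow> 'h) \<Rightarrow> ('i \<Rightarrow> 'a \<Rightarrow> 'h \<Rightarrow> 'h) \<Rightarrow> ('i \<Rightarrow> 'a \<Rightarrow> 'h \<Rightarrow> 'h)
     \<Rightarrow> 'i \<Rightarrow> 'a \<Rightarrow> ('i, 'h) fock_vector \<Rightarrow> ('i, 'h) fock_vector" where
  "J_alpha Hs \<xi>s \<pi> \<sigma> \<rho> i a =
     (let L = adjointable_operators (free_space Hs \<xi>s) in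
      (lambda_op Hs \<xi>s i (\<pi> i a) \<otimes>\<^bsub>L\<^esub> proj Hs \<xi>s (seqs_H i))
      \<oplus>\<^bsub>L\<^esub> (lambda_op Hs \<xi>s i (\<sigma> i a) \<otimes>\<^bsub>L\<^esub> proj Hs \<xi>s (seqs_B i))
      \<oplus>\<^bsub>L\<^esub> (lambda_op Hs \<xi>s i (\<rho> i a) \<otimes>\<^bsub>L\<^esub> proj Hs \<xi>s (seqs_C i)))"

definition J_beta ::
  "('i::linorder \<Rightarrow> ('h, 'm) pre_hilbert_scheme) \<Rightarrow> ('i \<Rightarrow> 'h)
     \<Rightarrow> ('i \<Rightarrow> 'a \<Rightarrow> 'h \<Rightarrow> 'h) \<Rightarrow> ('i \<Rightarrow> 'a \<Rightarrow> 'h \<Rightarrow> 'h)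
     \<Rightarrow> 'i \<Rightarrow> 'a \<Rightarrow> ('i, 'h) fock_vector \<Rightarrow> ('i, 'h) fock_vector" where
  "J_beta Hs \<xi>s \<sigma> \<rho> i a =
     (let L = adjointable_operators (free_space Hs \<xi>s) in
      (lambda_op Hs \<xi>s i (\<sigma> i a) \<otimes>\<^bsub>L\<^esub> proj Hs \<xi>s (seqs_H i \<union> seqs_B i))
      \<oplus>\<^bsub>L\<^esub> (lambda_op Hs \<xi>s i (\<rho> i a) \<otimes>\<^bsub>L\<^esub> proj Hs \<xi>s (seqs_C i)))"

definition J_gamma ::
  "('i::linorder \<Rightarrow> ('h, 'm) pre_hilbert_scheme) \<Rightarrow> ('i \<Rightarrow> 'h)
     \<Rightarrow> ('i \<Rightarrow> 'a \<Rightarrow> 'h \<Rightarrow> 'h) \<Rightarrow> ('i \<Rightarrow> 'a \<Rightarrow> 'h \<Rightarrow> 'h)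
     \<Rightarrow> 'i \<Rightarrow> 'a \<Rightarrow> ('i, 'h) fock_vector \<Rightarrow> ('i, 'h) fock_vector" where
  "J_gamma Hs \<xi>s \<sigma> \<rho> i a =
     (let L = adjointable_operators (free_space Hs \<xi>s) in
      (lambda_op Hs \<xi>s i (\<sigma> i a) \<otimes>\<^bsub>L\<^esub> proj Hs \<xi>s (seqs_B i))
      \<oplus>\<^bsub>L\<^esub> (lambda_op Hs \<xi>s i (\<rho> i a) \<otimes>\<^bsub>L\<^esub> proj Hs \<xi>s (seqs_H i \<union> seqs_C i)))"


section \<open>The alpha-free product\<close>

text \<open>Positions in index sequences are counted from \<open>0\<close>.\<close>

definition Peak :: "'i::linorder list \<Rightarrow> nat set" where
  "Peak js = {k. 1 \<le> k \<and> k + 1 < length js \<and> js ! (k - 1) < js ! k \<and> js ! k > js ! (k + 1)}"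

definition Bot :: "'i::linorder list \<Rightarrow> nat set" where
  "Bot js = {k. 1 \<le> k \<and> k + 1 < length js \<and> js ! (k - 1) > js ! k \<and> js ! k < js ! (k + 1)}"

text \<open>
  With \<open>\<chi>\<close> one of the families \<open>\<phi>\<close>, \<open>\<psi>\<close>, \<open>\<theta>\<close> this is
  \<open>\<alpha>\<^sub>i\<^sub>,\<^sub>k\<close>, \<open>\<beta>\<^sub>i\<^sub>,\<^sub>k\<close>, \<open>\<gamma>\<^sub>i\<^sub>,\<^sub>k\<close>, respectively.
\<close>

definition position_functional ::
  "('i::linorder \<Rightarrow> 'a \<Rightarrow> complex) \<Rightarrow> ('i \<Rightarrow> 'a \<Rightarrow> complex) \<Rightarrow> ('i \<Rightarrow> 'a \<Rightarrow> complex)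
     \<Rightarrow> 'i list \<Rightarrow> nat \<Rightarrow> 'a \<Rightarrow> complex" where
  "position_functional \<chi> \<psi> \<theta> js k =
     (if k = 0 then \<chi> (js ! 0)
      else if k \<in> Peak js then \<psi> (js ! k)
      else if k \<in> Bot js then \<theta> (js ! k)
      else (\<lambda>_. 0))"

definition vanishes_on_centered_words ::
  "('i::linorder \<Rightarrow> ('a, 'm) star_algebra_scheme) \<Rightarrow> ('i \<Rightarrow> 'a \<Rightarrow> complex)
     \<Rightarrow> ('i \<Rightarrow> 'a \<Rightarrow> complex) \<Rightarrow> ('i \<Rightarrow> 'a \<Rightarrow> complex)
     \<Rightarrow> ((('i \<times> 'a) list \<Rightarrow> complex) set \<Rightarrow> complex) \<Rightarrow> bool" where
  "vanishes_on_centered_words A \<chi> \<psi> \<theta> f \<longleftrightarrow>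
     (\<forall>w \<in> lists (letters A).
        w \<noteq> [] \<and> distinct_adj (map fst w) \<and>
        (\<forall>k<length w. position_functional \<chi> \<psi> \<theta> (map fst w) k (snd (w ! k)) = 0)
        \<longrightarrow> f (word_product A w) = 0)"

definition alpha_free_conditions ::
  "('i::linorder \<Rightarrow> ('a, 'm) star_algebra_scheme)
     \<Rightarrow> ('i \<Rightarrow> 'a \<Rightarrow> complex) \<Rightarrow> ('i \<Rightarrow> 'a \<Rightarrow> complex) \<Rightarrow> ('i \<Rightarrow> 'a \<Rightarrow> complex)
     \<Rightarrow> ((('i \<times> 'a) list \<Rightarrow> complex) set \<Rightarrow> complex)
     \<Rightarrow> ((('i \<times> 'a) list \<Rightarrow> complex) set \<Rightarrow> complex)
     \<Rightarrow> ((('i \<times> 'a) list \<Rightarrow> complex) set \<Rightarrow> complex) \<Rightarrow> bool" where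
  "alpha_free_conditions A \<phi>s \<psi>s \<theta>s \<phi> \<psi> \<theta> \<longleftrightarrow>
     unital_linear_functional (free_product A) \<phi> \<and>
     unital_linear_functional (free_product A) \<psi> \<and>
     unital_linear_functional (free_product A) \<theta> \<and>
     vanishes_on_centered_words A \<phi>s \<psi>s \<theta>s \<phi> \<and>
     vanishes_on_centered_words A \<psi>s \<psi>s \<theta>s \<psi> \<and>
     vanishes_on_centered_words A \<theta>s \<psi>s \<theta>s \<theta>"

text \<open>The unique triple satisfying these conditions; only values on the carrier are relevant.\<close>

definition is_alpha_free_product ::
  "('i::linorder \<Rightarrow> ('a, 'm) star_algebra_scheme)
     \<Rightarrow> ('i \<Rightarrow> 'a \<Rightarrow> complex) \<Rightarrow> ('i \<Rightarrow> 'a \<Rightarrow> complex) \<Rightarrow> ('i \<Rightarrow> 'a \<Rightarrow> complex)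
     \<Rightarrow> ((('i \<times> 'a) list \<Rightarrow> complex) set \<Rightarrow> complex)
     \<Rightarrow> ((('i \<times> 'a) list \<Rightarrow> complex) set \<Rightarrow> complex)
     \<Rightarrow> ((('i \<times> 'a) list \<Rightarrow> complex) set \<Rightarrow> complex) \<Rightarrow> bool" where
  "is_alpha_free_product A \<phi>s \<psi>s \<theta>s \<phi> \<psi> \<theta> \<longleftrightarrow>
     alpha_free_conditions A \<phi>s \<psi>s \<theta>s \<phi> \<psi> \<theta> \<and>
     (\<forall>\<phi>' \<psi>' \<theta>'. alpha_free_conditions A \<phi>s \<psi>s \<theta>s \<phi>' \<psi>' \<theta>' \<longrightarrow>
        (\<forall>x\<in>carrier (free_product A). \<phi>' x = \<phi> x \<and> \<psi>' x = \<psi> x \<and> \<theta>' x = \<theta> x))"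

end

theory Submission
  imports Defs
begin

text \<open>
  Positivity of the three functionals is automatic for vector states, once the spaces are known to
  be pre-Hilbert spaces, which rests on the Schur product theorem.  Uniqueness holds because
  subtracting a multiple of the unit from a letter expresses any word as a centered word plus shorter
  words.  For the vanishing on centered words, the factors \<open>a\<^sub>1, a\<^sub>2, \<dots>\<close> are moved to the left
  argument of the inner product.  On a word of \<open>H\<close> whose first index differs from \<open>i\<close>, the operator
  \<open>\<lambda>\<^sub>i(T)\<close> is multiplication by \<open>\<langle>\<xi>\<^sub>i, T \<xi>\<^sub>i\<rangle>\<close> plus
  prepending the centered part of \<open>T \<xi>\<^sub>i\<close>, and the order of the indices decides whether
  \<open>\<sigma>\<close> or \<open>\<rho>\<close> occurs.  The resulting vector never reaches the vacuum component.
\<close>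

section \<open>Positive semidefinite kernels\<close>

text \<open>In a word of length at least two the last factor carries the zero functional, so nothing
  is known about it: applying the product to the vacuum in the usual order starts with an
  uncontrolled vacuum component. Read from the left, the first factor is centered for exactly the
  representation that acts on the vacuum, and all further conditions sit at turning points of the
  index sequence. This is why the factors are moved across the inner product. A second obstacle is
  that the generators of the spaces are linearly dependent; for instance the pairs
  \<open>(c f, g)\<close> and \<open>(f, c g)\<close> give the same simple tensor. The kernels are
  therefore only semidefinite, and values on generators need not extend linearly. Both problems
  disappear because a vector is the function of its inner products with the generators: a null
  vector is the zero function by Cauchy-Schwarz, and a linear map can be written down pointwise as
  soon as a candidate for its adjoint is known on generators.\<close>

locale psd_kernel =
  fixes X :: "'x set" and k :: "'x \<Rightarrow> 'x \<Rightarrow> complex"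
  assumes hermitian: "\<lbrakk>v \<in> X; w \<in> X\<rbrakk> \<Longrightarrow> k w v = cnj (k v w)"
    and psd: "\<lbrakk>finite F; F \<subseteq> X\<rbrakk> \<Longrightarrow> (\<Sum>v\<in>F. \<Sum>w\<in>F. cnj (c v) * c w * k v w) \<in> \<real>\<^sub>\<ge>\<^sub>0"

lemma nonneg_Reals_cnj_mult: "cnj z * z \<in> (\<real>\<^sub>\<ge>\<^sub>0 :: complex set)"
  by (simp add: complex_nonneg_Reals_iff)

lemma sum_in_nonneg_Reals:
  "(\<And>x. x \<in> F \<Longrightarrow> f x \<in> \<real>\<^sub>\<ge>\<^sub>0) \<Longrightarrow> sum f F \<in> (\<real>\<^sub>\<ge>\<^sub>0 :: complex set)"
  by (induction F rule: infinite_finite_induct) (auto intro: nonneg_Reals_add_I)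

lemma psd_kernel_subset: "psd_kernel Y k \<Longrightarrow> X \<subseteq> Y \<Longrightarrow> psd_kernel X k"
  unfolding psd_kernel_def by (blast intro: subset_trans)

lemma psd_kernel_cong:
  assumes "psd_kernel X k" "\<And>v w. \<lbrakk>v \<in> X; w \<in> X\<rbrakk> \<Longrightarrow> k' v w = k v w"
  shows "psd_kernel X k'"
proof
  show "k' w v = cnj (k' v w)" if "v \<in> X" "w \<in> X" for v w
    unfolding assms(2)[OF that] assms(2)[OF that(2,1)]
    using assms(1) that by (rule psd_kernel.hermitian)
  show "(\<Sum>v\<in>F. \<Sum>w\<in>F. cnj (c v) * c w * k' v w) \<in> \<real>\<^sub>\<ge>\<^sub>0" if "finite F" "F \<subseteq> X" for F c
  proof -
    have "(\<Sum>v\<in>F. \<Sum>w\<in>F. cnj (c v) * c w * k' v w) = (\<Sum>v\<in>F. \<Sum>w\<in>F. cnj (c v) * c w * k v w)"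
      using that by (intro sum.cong refl arg_cong2[of _ _ _ _ "(*)"] assms(2)) auto
    then show ?thesis using psd_kernel.psd[OF assms(1) that] by simp
  qed
qed

text \<open>The map \<open>f\<close> may identify points. The form on \<open>X\<close> with weights
  \<open>c\<close> is the form on \<open>Y\<close> whose weight at \<open>y\<close> is the sum of
  \<open>c\<close> over the fibre of \<open>y\<close>.\<close>

lemma psd_kernel_pullback:
  assumes "psd_kernel Y k" "f ` X \<subseteq> Y"
  shows "psd_kernel X (\<lambda>v w. k (f v) (f w))"
proof
  interpret psd_kernel Y k by fact
  show "k (f w) (f v) = cnj (k (f v) (f w))" if "v \<in> X" "w \<in> X" for v w
    using that assms(2) by (intro hermitian) auto
  show "(\<Sum>v\<in>F. \<Sum>w\<in>F. cnj (c v) * c w * k (f v) (f w)) \<in> \<real>\<^sub>\<ge>\<^sub>0"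
    if F: "finite F" "F \<subseteq> X" for F c
  proof -
    define C where "C y = (\<Sum>v\<in>{v\<in>F. f v = y}. c v)" for y
    have group: "(\<Sum>v\<in>F. g v) = (\<Sum>y\<in>f ` F. \<Sum>v\<in>{v\<in>F. f v = y}. g v)" for g :: "_ \<Rightarrow> complex"
      using F(1) by (rule sum.image_gen)
    have "(\<Sum>w\<in>F. cnj (c v) * c w * k (f v) (f w))
        = cnj (c v) * (\<Sum>z\<in>f ` F. C z * k (f v) z)" for v
      by (subst group) (simp add: C_def sum_distrib_left sum_distrib_right mult.assoc)
    then have "(\<Sum>v\<in>F. \<Sum>w\<in>F. cnj (c v) * c w * k (f v) (f w))
        = (\<Sum>v\<in>F. cnj (c v) * (\<Sum>z\<in>f ` F. C z * k (f v) z))" by simp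
    also have "\<dots> = (\<Sum>y\<in>f ` F. cnj (C y) * (\<Sum>z\<in>f ` F. C z * k y z))"
      by (subst group) (simp add: C_def sum_distrib_right)
    also have "\<dots> = (\<Sum>y\<in>f ` F. \<Sum>z\<in>f ` F. cnj (C y) * C z * k y z)"
      by (simp add: sum_distrib_left mult.assoc)
    also have "\<dots> \<in> \<real>\<^sub>\<ge>\<^sub>0" using F assms(2) by (intro psd) auto
    finally show ?thesis .
  qed
qed

text \<open>Sorting a finite set by the label \<open>g\<close> makes the matrix of \<open>k\<close>
  block diagonal, and the quadratic form is the sum over the blocks.\<close>

lemma psd_kernel_orthogonal_sum:
  assumes parts: "\<And>i. psd_kernel {x \<in> X. g x = i} k"
    and orth: "\<And>v w. \<lbrakk>v \<in> X; w \<in> X; g v \<noteq> g w\<rbrakk> \<Longrightarrow> k v w = 0"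
  shows "psd_kernel X k"
proof
  show "k w v = cnj (k v w)" if "v \<in> X" "w \<in> X" for v w
    using that orth[of v w] orth[of w v] psd_kernel.hermitian[OF parts[of "g v"], of v w]
    by (cases "g v = g w") auto
  show "(\<Sum>v\<in>F. \<Sum>w\<in>F. cnj (c v) * c w * k v w) \<in> \<real>\<^sub>\<ge>\<^sub>0"
    if F: "finite F" "F \<subseteq> X" for F c
  proof -
    have "(\<Sum>v\<in>F. \<Sum>w\<in>F. cnj (c v) * c w * k v w)
        = (\<Sum>v\<in>F. \<Sum>w\<in>{w\<in>F. g w = g v}. cnj (c v) * c w * k v w)"
      using F by (intro sum.cong refl sum.mono_neutral_right) (auto simp: subset_iff intro!: orth)
    also have "\<dots> = (\<Sum>i\<in>g ` F. \<Sum>v\<in>{v\<in>F. g v = i}. \<Sum>w\<in>{w\<in>F. g w = i}. cnj (c v) * c w * k v w)"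
      using F(1) by (subst sum.image_gen[of F _ g]) auto
    also have "\<dots> \<in> \<real>\<^sub>\<ge>\<^sub>0"
      using F by (intro sum_in_nonneg_Reals psd_kernel.psd[OF parts]) auto
    finally show ?thesis .
  qed
qed

text \<open>This replaces Cauchy-Schwarz when one of the two vectors is null: the quadratic
  polynomial in \<open>t\<close> loses its leading term, and an affine function bounded below on the
  real line is constant.\<close>

lemma affine_bounded_below_imp_zero:
  fixes p q :: real
  assumes "\<And>t. 0 \<le> p - 2 * t * q" "q \<ge> 0"
  shows "q = 0"
proof (rule ccontr)
  assume "q \<noteq> 0"
  \<comment> \<open>This \<open>t\<close> makes the right-hand side equal to -1.\<close>
  with assms(1)[of "(p + 1) / (2 * q)"] show False by simp
qed

context psd_kernel begin

lemma diagonal_nonneg: "v \<in> X \<Longrightarrow> k v v \<in> \<real>\<^sub>\<ge>\<^sub>0"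
  using psd[of "{v}" "\<lambda>_. 1"] by simp

lemma vanishes_if_diagonal_zero:
  assumes a: "a \<in> X" "k a a = 0" and w: "w \<in> X"
  shows "k a w = 0"
proof (cases "a = w")
  case False
  have "0 \<le> Re (k w w) - 2 * t * (cmod (k a w))\<^sup>2" for t
  proof -
    \<comment> \<open>With this weight at \<open>a\<close> both cross terms equal \<open>- t\<close>
      times the squared modulus of \<open>k a w\<close>, and the term in \<open>t * t\<close> is
      multiplied by \<open>k a a = 0\<close>.\<close>
    define c where "c = (\<lambda>v. if v = a then - of_real t * k a w else 1)"
    have "(\<Sum>v\<in>{a,w}. \<Sum>u\<in>{a,w}. cnj (c v) * c u * k v u) \<in> \<real>\<^sub>\<ge>\<^sub>0"
      using a w by (intro psd) auto
    moreover have "(\<Sum>v\<in>{a,w}. \<Sum>u\<in>{a,w}. cnj (c v) * c u * k v u)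
        = k w w - 2 * of_real t * (k a w * cnj (k a w))"
      using False a hermitian[OF a(1) w] by (simp add: c_def algebra_simps)
    ultimately have "k w w - 2 * of_real t * of_real ((cmod (k a w))\<^sup>2) \<in> \<real>\<^sub>\<ge>\<^sub>0"
      by (simp only: complex_norm_square)
    then have "0 \<le> Re (k w w - 2 * of_real t * of_real ((cmod (k a w))\<^sup>2))"
      unfolding complex_nonneg_Reals_iff by blast
    then show ?thesis by (simp flip: of_real_power)
  qed
  from affine_bounded_below_imp_zero[OF this] show ?thesis by simp
qed (use a in simp)

end

text \<open>The Schur complement of the pivot \<open>a\<close>: the kernel of the vectors left over
  after projecting away the direction of \<open>a\<close>. Its form at \<open>c\<close> is the form
  of \<open>k\<close> at the extension of \<open>c\<close> to \<open>a\<close> that minimizes the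
  value.\<close>

lemma psd_kernel_complement:
  assumes "psd_kernel (insert a X) k" "a \<notin> X" "k a a \<noteq> 0"
  shows "psd_kernel X (\<lambda>v w. k v w - k v a * k a w / k a a)"
proof
  interpret psd_kernel "insert a X" k by fact
  have real: "cnj (k a a) = k a a" using hermitian[of a a] by simp
  show "k w v - k w a * k a v / k a a = cnj (k v w - k v a * k a w / k a a)"
    if "v \<in> X" "w \<in> X" for v w
    using that real hermitian[of v w] hermitian[of a v] hermitian[of a w]
    by (simp add: mult.commute)
  show "(\<Sum>v\<in>F. \<Sum>w\<in>F. cnj (c v) * c w * (k v w - k v a * k a w / k a a)) \<in> \<real>\<^sub>\<ge>\<^sub>0"
    if F: "finite F" "F \<subseteq> X" for F c
  proof -
    define s where "s = (\<Sum>w\<in>F. c w * k a w)"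
    \<comment> \<open>Completing the square gives this weight for \<open>a\<close>; it makes
      \<open>t * k a a + s\<close> vanish, so the row of \<open>a\<close> contributes
      nothing.\<close>
    define t where "t = - s / k a a"
    define d where "d = c(a := t)"
    have aF: "a \<notin> F" using F assms by auto
    have cs: "cnj s = (\<Sum>v\<in>F. cnj (c v) * k v a)"
      unfolding s_def cnj_sum using F hermitian[of a] by (intro sum.cong) auto
    have dF: "(\<Sum>w\<in>F. f (d w) w) = (\<Sum>w\<in>F. f (c w) w)" for f :: "complex \<Rightarrow> 'a \<Rightarrow> complex"
      using aF by (intro sum.cong) (auto simp: d_def)
    have row: "(\<Sum>w\<in>insert a F. cnj (d v) * d w * k v w)
        = cnj (d v) * (t * k v a + (\<Sum>w\<in>F. c w * k v w))" for v
      using F(1) aF dF[of "\<lambda>z w. z * k v w"]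
      by (simp add: d_def[THEN fun_cong, of a] sum_distrib_left[symmetric] mult.assoc distrib_left)
    have "(\<Sum>v\<in>insert a F. \<Sum>w\<in>insert a F. cnj (d v) * d w * k v w)
        = cnj t * (t * k a a + s) + (\<Sum>v\<in>F. cnj (c v) * (t * k v a + (\<Sum>w\<in>F. c w * k v w)))"
      unfolding row using F(1) aF dF[of "\<lambda>z v. cnj z * (t * k v a + (\<Sum>w\<in>F. c w * k v w))"]
      by (simp add: d_def[THEN fun_cong, of a] s_def)
    also have "\<dots> = t * cnj s + (\<Sum>v\<in>F. \<Sum>w\<in>F. cnj (c v) * c w * k v w)"
      using assms(3)
      by (simp add: t_def) (simp add: cs sum_distrib_left sum_divide_distrib right_diff_distrib
          sum_subtractf sum_negf mult_ac)
    also have "\<dots> = (\<Sum>v\<in>F. \<Sum>w\<in>F. cnj (c v) * c w * k v w) - cnj s * s / k a a"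
      by (simp add: t_def)
    also have "cnj s * s / k a a = (\<Sum>v\<in>F. \<Sum>w\<in>F. cnj (c v) * c w * (k v a * k a w / k a a))"
      unfolding cs unfolding s_def sum_product by (simp add: sum_divide_distrib mult_ac)
    finally show ?thesis
      using psd[of "insert a F" d] F by (simp add: right_diff_distrib sum_subtractf subset_insertI2)
  qed
qed

text \<open>Cholesky factorization by induction on the size of the matrix: a nonzero pivot
  \<open>a\<close> is split off as a matrix of rank one, and the induction hypothesis factors the
  Schur complement. The rows of the factor are labelled by the points of \<open>F\<close>
  themselves, so each step adds one row.\<close>

lemma psd_kernel_finite_gram:
  assumes "finite F" "psd_kernel F k"
  shows "\<exists>g. \<forall>v\<in>F. \<forall>w\<in>F. k v w = (\<Sum>l\<in>F. cnj (g l v) * g l w)"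
  using assms
proof (induction F arbitrary: k rule: finite_induct)
  case (insert a F)
  interpret psd_kernel "insert a F" k by (fact insert.prems)
  show ?case
  proof (cases "k a a = 0")
    case True
    \<comment> \<open>A vanishing pivot forces its whole row and column to vanish, so the new row of
      the factor can be zero.\<close>
    have zero: "k a w = 0 \<and> k w a = 0" if "w \<in> insert a F" for w
      using vanishes_if_diagonal_zero[of a w] hermitian[of a w] True that by simp
    have "psd_kernel F k" using insert.prems by (rule psd_kernel_subset) auto
    then obtain g where g: "\<forall>v\<in>F. \<forall>w\<in>F. k v w = (\<Sum>l\<in>F. cnj (g l v) * g l w)"
      using insert.IH by blast
    define h where "h l v = (if l = a \<or> v = a then 0 else g l v)" for l v
    have "k v w = (\<Sum>l\<in>insert a F. cnj (h l v) * h l w)" if "v \<in> insert a F" "w \<in> insert a F" for v w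
    proof (cases "v = a \<or> w = a")
      case False
      then have "(\<Sum>l\<in>F. cnj (h l v) * h l w) = (\<Sum>l\<in>F. cnj (g l v) * g l w)"
        using insert.hyps by (intro sum.cong) (auto simp: h_def)
      then show ?thesis using False that g insert.hyps by (simp add: h_def[of a])
    qed (use zero that in \<open>auto simp: h_def\<close>)
    then show ?thesis by blast
  next
    case False
    obtain g where g: "\<forall>v\<in>F. \<forall>w\<in>F. k v w - k v a * k a w / k a a = (\<Sum>l\<in>F. cnj (g l v) * g l w)"
      using insert.IH[OF psd_kernel_complement[OF insert.prems insert.hyps(2) False]] by blast
    obtain r where r: "k a a = of_real r" "r \<ge> 0"
      using diagonal_nonneg[of a] by (auto simp: nonneg_Reals_def)
    \<comment> \<open>The new row is the pivot row divided by the square root of the pivot; it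
      reproduces precisely the term subtracted in the Schur complement.\<close>
    define h where "h l v = (if l = a then k a v / of_real (sqrt r) else if v = a then 0 else g l v)" for l v
    have ha: "cnj (h a v) * h a w = k v a * k a w / k a a" if "v \<in> insert a F" for v w
      using that r hermitian[of a v] False by (simp add: h_def flip: of_real_mult)
    have "k v w = (\<Sum>l\<in>insert a F. cnj (h l v) * h l w)" if vw: "v \<in> insert a F" "w \<in> insert a F" for v w
    proof (cases "v = a \<or> w = a")
      case True
      then have "(\<Sum>l\<in>F. cnj (h l v) * h l w) = 0"
        using insert.hyps by (intro sum.neutral) (auto simp: h_def)
      then show ?thesis using True ha[OF vw(1), of w] insert.hyps False by auto
    next
      case vwa: False
      then have "(\<Sum>l\<in>F. cnj (h l v) * h l w) = (\<Sum>l\<in>F. cnj (g l v) * g l w)"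
        using insert.hyps by (intro sum.cong) (auto simp: h_def)
      then show ?thesis using vwa ha[OF vw(1), of w] vw g insert.hyps by (auto simp: diff_eq_eq add.commute)
    qed
    then show ?thesis by blast
  qed
qed simp

text \<open>The Schur product theorem. Once \<open>l\<close> is written as a sum of rank one
  kernels, the form of the product becomes a sum over \<open>j\<close> of forms of \<open>k\<close>
  with the rescaled weights \<open>c v * g j v\<close>.\<close>

lemma psd_kernel_mult:
  assumes "psd_kernel X k" "psd_kernel X l"
  shows "psd_kernel X (\<lambda>v w. k v w * l v w)"
proof
  interpret k: psd_kernel X k by fact
  interpret l: psd_kernel X l by fact
  show "k w v * l w v = cnj (k v w * l v w)" if "v \<in> X" "w \<in> X" for v w
    using k.hermitian[OF that] l.hermitian[OF that] by simp
  show "(\<Sum>v\<in>F. \<Sum>w\<in>F. cnj (c v) * c w * (k v w * l v w)) \<in> \<real>\<^sub>\<ge>\<^sub>0"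
    if F: "finite F" "F \<subseteq> X" for F c
  proof -
    obtain g where g: "\<And>v w. v \<in> F \<Longrightarrow> w \<in> F \<Longrightarrow> l v w = (\<Sum>j\<in>F. cnj (g j v) * g j w)"
      using psd_kernel_finite_gram[OF F(1) psd_kernel_subset[OF assms(2) F(2)]] by blast
    have "(\<Sum>v\<in>F. \<Sum>w\<in>F. cnj (c v) * c w * (k v w * l v w))
        = (\<Sum>v\<in>F. \<Sum>w\<in>F. \<Sum>j\<in>F. cnj (c v * g j v) * (c w * g j w) * k v w)"
      by (intro sum.cong) (simp_all add: g sum_distrib_left mult_ac)
    also have "\<dots> = (\<Sum>j\<in>F. \<Sum>v\<in>F. \<Sum>w\<in>F. cnj (c v * g j v) * (c w * g j w) * k v w)"
      by (subst sum.swap[of _ F F], subst (2) sum.swap) (rule refl)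
    also have "\<dots> \<in> \<real>\<^sub>\<ge>\<^sub>0"
      using F by (intro sum_in_nonneg_Reals k.psd)
    finally show ?thesis .
  qed
qed

section \<open>Inner products, tensor products and words as positive semidefinite kernels\<close>

context pre_hilbert_space begin

lemma ip_zero_right: "x \<in> carrier H \<Longrightarrow> ip H x \<zero> = 0"
  using ip_smult_right[of x \<zero> 0] by (simp add: complex_field_def)

lemma ip_finsum_right:
  assumes "finite F" "f \<in> F \<rightarrow> carrier H" "x \<in> carrier H"
  shows "ip H x (finsum H f F) = (\<Sum>v\<in>F. ip H x (f v))"
  using assms by (induction F rule: finite_induct) (auto simp: ip_zero_right ip_add_right Pi_iff)

text \<open>The quadratic form is the squared norm of the linear combination with the given
  weights.\<close>

lemma psd_kernel_ip: "psd_kernel (carrier H) (ip H)"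
proof
  show "ip H w v = cnj (ip H v w)" if "v \<in> carrier H" "w \<in> carrier H" for v w
    using that by (rule ip_commute)
  show "(\<Sum>v\<in>F. \<Sum>w\<in>F. cnj (c v) * c w * ip H v w) \<in> \<real>\<^sub>\<ge>\<^sub>0"
    if F: "finite F" "F \<subseteq> carrier H" for F c
  proof -
    have sm: "c v \<odot> v \<in> carrier H" if "v \<in> F" for v
      using that F by (intro smult_closed) (auto simp: complex_field_def)
    define x where "x = (\<Oplus>v\<in>F. c v \<odot> v)"
    have x: "x \<in> carrier H" using sm by (auto simp: x_def intro!: finsum_closed)
    have right: "ip H v x = (\<Sum>w\<in>F. c w * ip H v w)" if "v \<in> carrier H" for v
      unfolding x_def using F that sm by (subst ip_finsum_right) (auto simp: ip_smult_right subset_iff intro!: sum.cong)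
    have "ip H x x = (\<Sum>v\<in>F. c v * ip H x v)" by (rule right[OF x])
    also have "\<dots> = (\<Sum>v\<in>F. c v * cnj (ip H v x))"
      using F x by (intro sum.cong refl arg_cong2[of _ _ _ _ "(*)"] ip_commute) auto
    also have "\<dots> = cnj (\<Sum>v\<in>F. cnj (c v) * (\<Sum>w\<in>F. c w * ip H v w))"
      using F by (auto simp: right intro!: sum.cong)
    finally have "cnj (ip H x x) = (\<Sum>v\<in>F. \<Sum>w\<in>F. cnj (c v) * c w * ip H v w)"
      by (simp add: sum_distrib_left mult.assoc)
    \<comment> \<open>The expansion above uses linearity on the right only and so produces the
      conjugate of the form; it drops out because the squared norm is real.\<close>
    moreover have "cnj (ip H x x) = ip H x x" using ip_commute[OF x x] by simp
    ultimately show ?thesis using ip_nonneg[OF x] by simp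
  qed
qed

end

lemma psd_kernel_tensor:
  assumes "pre_hilbert_space H" "pre_hilbert_space K"
  shows "psd_kernel (carrier H \<times> carrier K) (tensor_kernel H K)"
proof -
  have "psd_kernel (carrier H \<times> carrier K) (\<lambda>v w. ip H (fst v) (fst w) * ip K (snd v) (snd w))"
    by (intro psd_kernel_mult psd_kernel_pullback[OF pre_hilbert_space.psd_kernel_ip] assms) auto
  then show ?thesis
    by (rule psd_kernel_cong) (auto simp: tensor_kernel_def)
qed

lemma word_kernel_Nil: "word_kernel Hs [] [] = 1"
  by (simp add: word_kernel_def)

lemma word_kernel_Cons:
  "word_kernel Hs ((i, f) # v) ((j, g) # w) = (if i = j then ip (Hs i) f g * word_kernel Hs v w else 0)"
  by (simp add: word_kernel_def prod.lessThan_Suc_shift del: prod.lessThan_Suc)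

lemma word_kernel_eq_0: "map fst v \<noteq> map fst w \<Longrightarrow> word_kernel Hs v w = 0"
  by (simp add: word_kernel_def)

text \<open>Words with different index sequences are orthogonal. For a fixed sequence the kernel is
  the kernel of the first letters times the kernel of the tails, so induction on the sequence and
  the Schur product theorem apply. Letters range over the full carriers here;
  \<open>tensor_words\<close> is reached by restriction.\<close>

lemma psd_kernel_word:
  fixes Hs :: "'i \<Rightarrow> ('h, 'm) pre_hilbert_scheme"
  assumes "\<And>i. pre_hilbert_space (Hs i)"
  shows "psd_kernel {w. \<forall>(i, f)\<in>set w. f \<in> carrier (Hs i)} (word_kernel Hs)"
proof (rule psd_kernel_orthogonal_sum[where g = "map fst"])
  define Y where "Y js = {w :: ('i \<times> 'h) list. (\<forall>(i, f)\<in>set w. f \<in> carrier (Hs i)) \<and> map fst w = js}" for js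
  have "psd_kernel (Y js) (word_kernel Hs)" for js
  proof (induction js)
    case Nil
    have "Y [] = {[]}" by (auto simp: Y_def)
    moreover have "psd_kernel {[]} (word_kernel Hs)"
    proof
      fix F :: "('i \<times> 'h) list set" and c assume "F \<subseteq> {[]}"
      then consider "F = {}" | "F = {[]}" by auto
      then show "(\<Sum>v\<in>F. \<Sum>w\<in>F. cnj (c v) * c w * word_kernel Hs v w) \<in> \<real>\<^sub>\<ge>\<^sub>0"
        by cases (simp_all add: word_kernel_Nil nonneg_Reals_cnj_mult)
    qed (simp add: word_kernel_Nil)
    ultimately show ?case by simp
  next
    case (Cons j js)
    have "psd_kernel (Y (j # js)) (\<lambda>v w. ip (Hs j) (snd (hd v)) (snd (hd w)) * word_kernel Hs (tl v) (tl w))"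
      by (intro psd_kernel_mult psd_kernel_pullback[OF Cons, of tl]
          psd_kernel_pullback[of "carrier (Hs j)" "ip (Hs j)" "\<lambda>v. snd (hd v)"] pre_hilbert_space.psd_kernel_ip assms) (auto simp: Y_def)
    then show ?case
      by (rule psd_kernel_cong) (auto simp: Y_def word_kernel_Cons)
  qed
  then show "psd_kernel {w \<in> {w. \<forall>(i, f)\<in>set w. f \<in> carrier (Hs i)}. map fst w = js} (word_kernel Hs)" for js
    unfolding Y_def mem_Collect_eq .
qed (rule word_kernel_eq_0)

section \<open>Spaces generated by kernels\<close>

lemma generator_apply: "v \<in> X \<Longrightarrow> generator X k w v = k v w"
  by (simp add: generator_def)

lemma combination_mono:
  assumes "finite G" "F \<subseteq> G"
  shows "combination X k F c = combination X k G (\<lambda>w. if w \<in> F then c w else 0)"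
  unfolding combination_def using assms
  by (intro ext sum.mono_neutral_cong_left) auto

lemma zero_in_span_of: "(\<lambda>v. 0) \<in> span_of X k S"
  unfolding span_of_def combination_def by (intro CollectI exI[of _ "{}"]) auto

lemma add_in_span_of:
  assumes "x \<in> span_of X k S" "y \<in> span_of X k S"
  shows "(\<lambda>v. x v + y v) \<in> span_of X k S"
proof -
  obtain F c where F: "finite F" "F \<subseteq> S" "x = combination X k F c"
    using assms(1) by (auto simp: span_of_def)
  obtain G d where G: "finite G" "G \<subseteq> S" "y = combination X k G d"
    using assms(2) by (auto simp: span_of_def)
  obtain c' where x: "x = combination X k (F \<union> G) c'"
    using combination_mono[of "F \<union> G" F X k c] F G by auto
  obtain d' where y: "y = combination X k (F \<union> G) d'"
    using combination_mono[of "F \<union> G" G X k d] F G by auto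
  have "(\<lambda>v. x v + y v) = combination X k (F \<union> G) (\<lambda>w. c' w + d' w)"
    unfolding x y by (simp add: combination_def sum.distrib distrib_right)
  then show ?thesis using F G by (auto simp: span_of_def)
qed

lemma smult_in_span_of:
  assumes "x \<in> span_of X k S"
  shows "(\<lambda>v. a * x v) \<in> span_of X k S"
proof -
  obtain F c where F: "finite F" "F \<subseteq> S" "x = combination X k F c"
    using assms by (auto simp: span_of_def)
  have "(\<lambda>v. a * x v) = combination X k F (\<lambda>w. a * c w)"
    unfolding F by (simp add: combination_def sum_distrib_left mult.assoc)
  then show ?thesis using F by (auto simp: span_of_def)
qed

lemma generator_in_span_of:
  assumes "w \<in> S"
  shows "generator X k w \<in> span_of X k S"
proof -
  have "generator X k w = combination X k {w} (\<lambda>_. 1)" by (simp add: combination_def)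
  then show ?thesis using assms by (auto simp: span_of_def)
qed

lemma span_of_mono: "S \<subseteq> S' \<Longrightarrow> span_of X k S \<subseteq> span_of X k S'"
  unfolding span_of_def by blast

lemma span_of_induct [consumes 1, case_names zero add]:
  assumes x: "x \<in> span_of X k S"
    and zero: "P (\<lambda>v. 0)"
    and add: "\<And>c w y. \<lbrakk>w \<in> S; y \<in> span_of X k S; P y\<rbrakk> \<Longrightarrow> P (\<lambda>v. c * generator X k w v + y v)"
  shows "P x"
proof -
  obtain F c where F: "finite F" "F \<subseteq> S" "x = combination X k F c"
    using x by (auto simp: span_of_def)
  from F(1,2) have "P (combination X k F c)"
  proof (induction F rule: finite_induct)
    case empty
    then show ?case using zero by (simp add: combination_def)
  next
    case (insert w F)
    have "combination X k F c \<in> span_of X k S" using insert by (auto simp: span_of_def)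
    with insert have "P (\<lambda>v. c w * generator X k w v + combination X k F c v)"
      by (intro add) auto
    then show ?case using insert.hyps by (simp add: combination_def)
  qed
  then show ?thesis using F(3) by simp
qed

lemma span_of_outside: "x \<in> span_of X k S \<Longrightarrow> v \<notin> X \<Longrightarrow> x v = 0"
  by (auto simp: span_of_def combination_def generator_def)

text \<open>For \<open>v\<close> in \<open>X\<close> the value \<open>x v\<close> is the inner
  product of the generator of \<open>v\<close> with \<open>x\<close>. The lemma is used in this
  sense, to read off orthogonality to a word from values of functions.\<close>

lemma span_of_vanishes:
  assumes "x \<in> span_of X k S" "\<And>w. w \<in> S \<Longrightarrow> k v w = 0"
  shows "x v = 0"
  using assms by (induction rule: span_of_induct) (auto simp: generator_def)

lemma generated_space_simps [simp]:
  "carrier (generated_space X k) = span_of X k X"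
  "zero (generated_space X k) = (\<lambda>v. 0)"
  "add (generated_space X k) = (\<lambda>x y v. x v + y v)"
  "smult (generated_space X k) = (\<lambda>c x v. c * x v)"
  by (simp_all add: generated_space_def)

lemma cring_complex_field: "cring complex_field"
proof (rule cringI)
  show "abelian_group complex_field"
    by (rule abelian_groupI) (auto simp: complex_field_def intro: exI[of _ "- _"] add.left_inverse)
  show "comm_monoid complex_field"
    by (rule comm_monoidI) (auto simp: complex_field_def)
qed (simp add: complex_field_def distrib_right)

text \<open>The carrier is left open so that the spaces \<open>rest_space\<close>, which are record
  updates of the full space, are covered as well.\<close>

lemma module_span_of:
  "module complex_field ((generated_space X k)\<lparr>carrier := span_of X k S\<rparr>)"
proof (rule moduleI)
  show "cring complex_field" by (rule cring_complex_field)
  show "abelian_group ((generated_space X k)\<lparr>carrier := span_of X k S\<rparr>)"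
  proof (rule abelian_groupI)
    fix x assume "x \<in> carrier ((generated_space X k)\<lparr>carrier := span_of X k S\<rparr>)"
    then have "(\<lambda>v. - 1 * x v) \<in> span_of X k S" by (intro smult_in_span_of) simp
    then show "\<exists>y\<in>carrier ((generated_space X k)\<lparr>carrier := span_of X k S\<rparr>).
        y \<oplus>\<^bsub>(generated_space X k)\<lparr>carrier := span_of X k S\<rparr>\<^esub> x
          = \<zero>\<^bsub>(generated_space X k)\<lparr>carrier := span_of X k S\<rparr>\<^esub>"
      by (intro bexI[of _ "\<lambda>v. - 1 * x v"]) simp_all
  qed (simp_all add: add_in_span_of zero_in_span_of add.assoc add.commute add.left_commute)
qed (simp_all add: smult_in_span_of complex_field_def distrib_right distrib_left mult.assoc)

lemma module_generated_space: "module complex_field (generated_space X k)"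
proof -
  have "(generated_space X k)\<lparr>carrier := span_of X k X\<rparr> = generated_space X k"
    by (simp add: generated_space_def)
  with module_span_of[of X k X] show ?thesis by metis
qed

lemma generated_space_minus:
  assumes "x \<in> span_of X k X" "y \<in> span_of X k X"
  shows "x \<ominus>\<^bsub>generated_space X k\<^esub> y = (\<lambda>v. x v - y v)"
proof -
  interpret M: module complex_field "generated_space X k" by (rule module_generated_space)
  have "\<ominus>\<^bsub>generated_space X k\<^esub> y = (\<lambda>v. - 1 * y v)"
    using smult_in_span_of[OF assms(2), of "-1"] assms(2) by (intro M.minus_equality) simp_all
  then show ?thesis using assms by (simp add: a_minus_def)
qed

lemma linear_maps_zero:
  assumes "T \<in> linear_maps H K" "module complex_field H" "module complex_field K"
  shows "T \<zero>\<^bsub>H\<^esub> = \<zero>\<^bsub>K\<^esub>"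
proof -
  interpret H: module complex_field H by fact
  interpret K: module complex_field K by fact
  have "T (0 \<odot>\<^bsub>H\<^esub> \<zero>\<^bsub>H\<^esub>) = 0 \<odot>\<^bsub>K\<^esub> T \<zero>\<^bsub>H\<^esub>" "T \<zero>\<^bsub>H\<^esub> \<in> carrier K"
    using assms(1) by (auto simp: linear_maps_def)
  then show ?thesis
    using H.smult_l_null[of "\<zero>\<^bsub>H\<^esub>"] K.smult_l_null[of "T \<zero>\<^bsub>H\<^esub>"] by (simp add: complex_field_def)
qed

lemma linear_maps_combine:
  assumes "T \<in> linear_maps (generated_space X k) K" "w \<in> X" "y \<in> span_of X k X"
  shows "T (\<lambda>v. c * generator X k w v + y v) = c \<odot>\<^bsub>K\<^esub> T (generator X k w) \<oplus>\<^bsub>K\<^esub> T y"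
  using assms smult_in_span_of[OF generator_in_span_of[OF assms(2), of X k], of c]
    generator_in_span_of[OF assms(2), of X k]
  by (simp add: linear_maps_def)

text \<open>This is the uniqueness half of the definite descriptions of \<open>canonical_U\<close>
  and \<open>tensor_operator\<close>. Equality of functions can be concluded because members of
  \<open>linear_maps\<close> are \<open>undefined\<close> off the carrier.\<close>

lemma linear_maps_generated_eqI:
  assumes "T \<in> linear_maps (generated_space X k) K" "T' \<in> linear_maps (generated_space X k) K"
    and "module complex_field K"
    and "\<And>w. w \<in> X \<Longrightarrow> T (generator X k w) = T' (generator X k w)"
  shows "T = T'"
proof
  fix x show "T x = T' x"
  proof (cases "x \<in> span_of X k X")
    case True
    then show ?thesis
    proof (induction rule: span_of_induct)
      case zero
      then show ?case
        using linear_maps_zero[OF assms(1) module_generated_space assms(3)]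
          linear_maps_zero[OF assms(2) module_generated_space assms(3)] by simp
    next
      case (add c w y)
      then show ?case using assms by (simp add: linear_maps_combine)
    qed
  next
    case False
    then show ?thesis using assms(1,2) by (auto simp: linear_maps_def PiE_def extensional_def)
  qed
qed

context psd_kernel begin

text \<open>Together with \<open>form_right\<close> this shows that the double sum depends only on
  the two vectors as functions: here the second representation enters only through the function it
  defines, there the first.\<close>

lemma form_left:
  assumes "F \<subseteq> X"
  shows "(\<Sum>v\<in>F. \<Sum>w\<in>G. cnj (c v) * d w * k v w) = (\<Sum>v\<in>F. cnj (c v) * combination X k G d v)"
  unfolding combination_def using assms
  by (auto simp: sum_distrib_left generator_apply mult.assoc intro!: sum.cong)

lemma form_right:
  assumes "F \<subseteq> X" "G \<subseteq> X"
  shows "(\<Sum>v\<in>F. \<Sum>w\<in>G. cnj (c v) * d w * k v w) = (\<Sum>w\<in>G. d w * cnj (combination X k F c w))"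
proof -
  have "(\<Sum>v\<in>F. \<Sum>w\<in>G. cnj (c v) * d w * k v w) = (\<Sum>w\<in>G. \<Sum>v\<in>F. cnj (c v) * d w * k v w)"
    by (rule sum.swap)
  also have "\<dots> = (\<Sum>w\<in>G. d w * cnj (combination X k F c w))"
  proof (rule sum.cong[OF refl])
    fix w assume w: "w \<in> G"
    have "cnj (c v) * d w * k v w = d w * cnj (c v * generator X k v w)" if "v \<in> F" for v
      using w that assms hermitian[of w v] by (simp add: generator_apply subset_iff)
    then show "(\<Sum>v\<in>F. cnj (c v) * d w * k v w) = d w * cnj (combination X k F c w)"
      unfolding combination_def cnj_sum sum_distrib_left by (rule sum.cong[OF refl])
  qed
  finally show ?thesis .
qed

text \<open>The inner product is a definite description over all representations of both vectors, so
  its value must be independent of them. The right representation is exchanged first, via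
  \<open>form_left\<close>, then the left one, via \<open>form_right\<close>.\<close>

lemma ip_combination:
  assumes "finite F" "F \<subseteq> X" "finite G" "G \<subseteq> X"
  shows "ip (generated_space X k) (combination X k F c) (combination X k G d)
    = (\<Sum>v\<in>F. \<Sum>w\<in>G. cnj (c v) * d w * k v w)"
  unfolding generated_space_def pre_hilbert.simps
proof (rule the_equality)
  fix z assume "\<exists>F' c' G' d'. finite F' \<and> F' \<subseteq> X \<and> combination X k F c = combination X k F' c' \<and>
       finite G' \<and> G' \<subseteq> X \<and> combination X k G d = combination X k G' d' \<and>
       z = (\<Sum>v\<in>F'. \<Sum>w\<in>G'. cnj (c' v) * d' w * k v w)"
  then obtain F' c' G' d' where *: "F' \<subseteq> X" "combination X k F c = combination X k F' c'"
    "G' \<subseteq> X" "combination X k G d = combination X k G' d'"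
    and z: "z = (\<Sum>v\<in>F'. \<Sum>w\<in>G'. cnj (c' v) * d' w * k v w)" by blast
  have "z = (\<Sum>v\<in>F'. \<Sum>w\<in>G. cnj (c' v) * d w * k v w)"
    unfolding z form_left[OF *(1)] *(4) ..
  also have "\<dots> = (\<Sum>v\<in>F. \<Sum>w\<in>G. cnj (c v) * d w * k v w)"
    unfolding form_right[OF *(1) assms(4)] form_right[OF assms(2,4)] *(2) ..
  finally show "z = (\<Sum>v\<in>F. \<Sum>w\<in>G. cnj (c v) * d w * k v w)" .
qed (use assms in blast)

lemma ip_combination_left:
  assumes "finite F" "F \<subseteq> X" "y \<in> span_of X k X"
  shows "ip (generated_space X k) (combination X k F c) y = (\<Sum>v\<in>F. cnj (c v) * y v)"
  using assms by (auto simp: span_of_def ip_combination form_left)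

text \<open>The reproducing property of the kernel.\<close>

lemma ip_generator:
  assumes "w \<in> X" "y \<in> span_of X k X"
  shows "ip (generated_space X k) (generator X k w) y = y w"
  using ip_combination_left[of "{w}" y "\<lambda>_. 1"] assms by (simp add: combination_def)

lemma ip_span_commute:
  assumes "x \<in> span_of X k X" "y \<in> span_of X k X"
  shows "ip (generated_space X k) y x = cnj (ip (generated_space X k) x y)"
proof -
  obtain F c where F: "finite F" "F \<subseteq> X" "x = combination X k F c"
    using assms(1) by (auto simp: span_of_def)
  obtain G d where G: "finite G" "G \<subseteq> X" "y = combination X k G d"
    using assms(2) by (auto simp: span_of_def)
  have "ip (generated_space X k) y x = (\<Sum>v\<in>G. cnj (d v) * x v)"
    using F G assms(1) by (simp add: ip_combination_left)
  also have "\<dots> = cnj (ip (generated_space X k) x y)"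
    unfolding F(3) G(3) ip_combination[OF F(1,2) G(1,2)] form_right[OF F(2) G(2)]
    by simp
  finally show ?thesis .
qed

lemma ip_span_add:
  assumes "x \<in> span_of X k X" "y \<in> span_of X k X" "z \<in> span_of X k X"
  shows "ip (generated_space X k) x (\<lambda>v. y v + z v) = ip (generated_space X k) x y + ip (generated_space X k) x z"
proof -
  obtain F c where "finite F" "F \<subseteq> X" "x = combination X k F c"
    using assms(1) by (auto simp: span_of_def)
  then show ?thesis
    using assms add_in_span_of[OF assms(2,3)]
    by (simp add: ip_combination_left distrib_left sum.distrib)
qed

lemma ip_span_smult:
  assumes "x \<in> span_of X k X" "y \<in> span_of X k X"
  shows "ip (generated_space X k) x (\<lambda>v. a * y v) = a * ip (generated_space X k) x y"
proof -
  obtain F c where "finite F" "F \<subseteq> X" "x = combination X k F c"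
    using assms(1) by (auto simp: span_of_def)
  then show ?thesis
    using assms smult_in_span_of[OF assms(2)]
    by (simp add: ip_combination_left sum_distrib_left mult_ac)
qed

lemma ip_span_nonneg:
  assumes "x \<in> span_of X k X"
  shows "ip (generated_space X k) x x \<in> \<real>\<^sub>\<ge>\<^sub>0"
  using assms psd by (auto simp: span_of_def ip_combination)

text \<open>Vectors are functions, so no quotient by null vectors has to be taken: a null vector is
  orthogonal to every generator by the degenerate Cauchy-Schwarz argument, hence vanishes on
  \<open>X\<close> by the reproducing property, and off \<open>X\<close> every vector is
  zero.\<close>

lemma ip_span_definite:
  assumes x: "x \<in> span_of X k X" and zero: "ip (generated_space X k) x x = 0"
  shows "x = (\<lambda>v. 0)"
proof
  fix v show "x v = 0"
  proof (cases "v \<in> X")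
    case True
    let ?ip = "ip (generated_space X k)" and ?g = "generator X k v"
    have g: "?g \<in> span_of X k X" using True by (rule generator_in_span_of)
    have "0 \<le> Re (k v v) - 2 * t * (cmod (x v))\<^sup>2" for t
    proof -
      \<comment> \<open>The phase is chosen so that \<open>s * x v\<close> is \<open>- t\<close>
        times the squared modulus of \<open>x v\<close>, hence real.\<close>
      define s where "s = - of_real t * cnj (x v)"
      define y where "y = (\<lambda>u. s * x u)"
      have y: "y \<in> span_of X k X" unfolding y_def by (rule smult_in_span_of[OF x])
      have z: "(\<lambda>u. ?g u + y u) \<in> span_of X k X" by (rule add_in_span_of[OF g y])
      have gx: "?ip ?g x = x v" using True x by (rule ip_generator)
      have xg: "?ip x ?g = cnj (x v)" using ip_span_commute[OF g x] gx by simp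
      have gg: "?ip ?g ?g = k v v" using ip_generator[OF True g] True by (simp add: generator_apply)
      have gy: "?ip ?g y = s * x v"
        using ip_span_smult[OF g x, of s] gx by (simp add: y_def)
      have yy: "?ip y y = 0"
        using ip_span_smult[OF y x, of s] ip_span_commute[OF x y] ip_span_smult[OF x x, of s] zero
        by (simp add: y_def)
      have "?ip (\<lambda>u. ?g u + y u) (\<lambda>u. ?g u + y u)
          = cnj (?ip ?g (\<lambda>u. ?g u + y u)) + cnj (?ip y (\<lambda>u. ?g u + y u))"
        unfolding ip_span_add[OF z g y] ip_span_commute[OF g z] ip_span_commute[OF y z] ..
      also have "\<dots> = cnj (k v v + s * x v) + cnj (cnj (s * x v) + 0)"
        unfolding ip_span_add[OF g g y] ip_span_add[OF y g y] ip_span_commute[OF g y] gg gy yy ..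
      also have "\<dots> = k v v + s * x v + cnj (s * x v)"
        using hermitian[OF True True] by simp
      also have "\<dots> = k v v - 2 * of_real t * of_real ((cmod (x v))\<^sup>2)"
        unfolding complex_norm_square by (simp add: s_def algebra_simps)
      finally have "k v v - 2 * of_real t * of_real ((cmod (x v))\<^sup>2) \<in> \<real>\<^sub>\<ge>\<^sub>0"
        using ip_span_nonneg[OF z] by simp
      then have "0 \<le> Re (k v v - 2 * of_real t * of_real ((cmod (x v))\<^sup>2))"
        unfolding complex_nonneg_Reals_iff by blast
      then show ?thesis by (simp flip: of_real_power)
    qed
    from affine_bounded_below_imp_zero[OF this] show ?thesis by simp
  qed (rule span_of_outside[OF x])
qed

lemma pre_hilbert_space_span_of:
  assumes "S \<subseteq> X"
  shows "pre_hilbert_space ((generated_space X k)\<lparr>carrier := span_of X k S\<rparr>)"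
proof -
  have sub: "x \<in> span_of X k S \<Longrightarrow> x \<in> span_of X k X" for x
    using span_of_mono[OF assms] by blast
  show ?thesis
    by (intro pre_hilbert_space.intro module_span_of pre_hilbert_space_axioms.intro)
      (auto dest!: sub intro: ip_span_add ip_span_smult ip_span_commute ip_span_nonneg ip_span_definite)
qed

lemma pre_hilbert_space_generated: "pre_hilbert_space (generated_space X k)"
proof -
  have "(generated_space X k)\<lparr>carrier := span_of X k X\<rparr> = generated_space X k"
    by (simp add: generated_space_def)
  with pre_hilbert_space_span_of[of X] show ?thesis by (metis order_refl)
qed

end

section \<open>Adjoints and linear extension from generators\<close>

context pre_hilbert_space begin

lemma ip_minus_right:
  assumes "x \<in> carrier H" "y \<in> carrier H" "z \<in> carrier H"
  shows "ip H x (y \<ominus> z) = ip H x y - ip H x z"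
proof -
  have "ip H x y = ip H x (y \<ominus> z \<oplus> z)" using assms by (simp add: a_minus_def M.a_assoc M.l_neg)
  also have "\<dots> = ip H x (y \<ominus> z) + ip H x z" using assms by (intro ip_add_right) auto
  finally show ?thesis by simp
qed

lemma eq_if_ip_eq:
  assumes "x \<in> carrier H" "y \<in> carrier H" and eq: "\<And>z. z \<in> carrier H \<Longrightarrow> ip H z x = ip H z y"
  shows "x = y"
proof -
  have "x \<ominus> y \<in> carrier H" using assms by simp
  then have "ip H (x \<ominus> y) (x \<ominus> y) = 0" using assms by (simp add: ip_minus_right)
  then have "x \<ominus> y = \<zero>" using assms by (intro ip_definite) auto
  then have "x \<ominus> y \<oplus> y = y" using assms by simp
  then show ?thesis using assms by (simp add: a_minus_def M.a_assoc M.l_neg)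
qed

end

lemma is_adjoint_unique:
  assumes "pre_hilbert_space H" "is_adjoint H K T S" "is_adjoint H K T S'"
  shows "S = S'"
proof
  interpret pre_hilbert_space H by fact
  fix y show "S y = S' y"
  proof (cases "y \<in> carrier K")
    case True
    have mem: "S y \<in> carrier H" "S' y \<in> carrier H"
      using assms(2,3) True by (auto simp: is_adjoint_def linear_maps_def)
    have "ip H z (S y) = ip H z (S' y)" if "z \<in> carrier H" for z
      using assms(2,3) True that ip_commute[OF mem(1) that] ip_commute[OF mem(2) that]
      by (simp add: is_adjoint_def)
    then show ?thesis using mem by (intro eq_if_ip_eq)
  next
    case False
    then show ?thesis using assms(2,3) by (auto simp: is_adjoint_def linear_maps_def PiE_def extensional_def)
  qed
qed

lemma adjoint_eqI:
  assumes "pre_hilbert_space H" "is_adjoint H K T S"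
  shows "adjoint H K T = S"
  unfolding adjoint_def using assms is_adjoint_unique by (intro the_equality) blast+

text \<open>Extending \<open>m\<close> by linearity would require a check against all linear
  relations among the generators. Instead the value of \<open>T x\<close> at \<open>p\<close> is
  taken to be the inner product of \<open>V p\<close> with \<open>x\<close>, which is linear in
  \<open>x\<close> by construction. The hypothesis \<open>compat\<close> is the adjoint relation
  between \<open>m\<close> and \<open>V\<close> on generators; it shows that \<open>T\<close> takes
  the prescribed values.\<close>

lemma linear_extension:
  assumes "psd_kernel X k" "psd_kernel Y l"
    and m: "\<And>w. w \<in> X \<Longrightarrow> m w \<in> span_of Y l Y" and V: "\<And>p. p \<in> Y \<Longrightarrow> V p \<in> span_of X k X"
    and compat: "\<And>w p. \<lbrakk>w \<in> X; p \<in> Y\<rbrakk> \<Longrightarrow> V p w = cnj (m w p)"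
  shows "\<exists>T\<in>linear_maps (generated_space X k) (generated_space Y l).
    (\<forall>w\<in>X. T (generator X k w) = m w) \<and>
    (\<forall>x\<in>span_of X k X. \<forall>p\<in>Y. T x p = ip (generated_space X k) (V p) x)"
proof -
  interpret X: psd_kernel X k by fact
  define T where "T = (\<lambda>x\<in>span_of X k X. \<lambda>p. if p \<in> Y then ip (generated_space X k) (V p) x else 0)"
  have gen: "T (generator X k w) = m w" if w: "w \<in> X" for w
  proof
    fix p show "T (generator X k w) p = m w p"
    proof (cases "p \<in> Y")
      case True
      then show ?thesis
        using w generator_in_span_of[OF w, of X k] X.ip_span_commute[OF generator_in_span_of[OF w] V[OF True]]
          X.ip_span_commute[OF V[OF True] generator_in_span_of[OF w]]
        by (simp add: T_def X.ip_generator V compat)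
    qed (use w generator_in_span_of[OF w, of X k] span_of_outside[OF m[OF w]] in \<open>simp add: T_def\<close>)
  qed
  have add: "T (\<lambda>v. x v + y v) = (\<lambda>p. T x p + T y p)" if "x \<in> span_of X k X" "y \<in> span_of X k X" for x y
    using that add_in_span_of[OF that] by (auto simp: T_def X.ip_span_add V)
  have smult: "T (\<lambda>v. c * x v) = (\<lambda>p. c * T x p)" if "x \<in> span_of X k X" for x c
    using that smult_in_span_of[OF that] by (auto simp: T_def X.ip_span_smult V)
  have "T x \<in> span_of Y l Y" if "x \<in> span_of X k X" for x
    using that
  proof (induction rule: span_of_induct)
    case zero
    then show ?case using smult[OF zero_in_span_of, of 0] by (simp add: zero_in_span_of)
  next
    case (add c w y)
    then show ?case
      using \<open>\<And>y x. _ \<Longrightarrow> _ \<Longrightarrow> T (\<lambda>v. x v + y v) = _\<close>[of "\<lambda>v. c * generator X k w v" y]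
        smult[of "generator X k w" c] generator_in_span_of[of w X X k]
      by (simp add: smult_in_span_of add_in_span_of gen m)
  qed
  then have "T \<in> linear_maps (generated_space X k) (generated_space Y l)"
    using add smult by (auto simp: linear_maps_def T_def)
  then show ?thesis using gen by (intro bexI[of _ T]) (auto simp: T_def)
qed

text \<open>
  The existence of \<open>U\<^sub>i\<close>, of its adjoint and of \<open>T \<otimes> id\<close>, all defined by definite
  descriptions, is an instance of the following extension principle.
\<close>

lemma adjoint_pair_extension:
  assumes "psd_kernel X k" "psd_kernel Y l"
    and m: "\<And>w. w \<in> X \<Longrightarrow> m w \<in> span_of Y l Y" and V: "\<And>p. p \<in> Y \<Longrightarrow> V p \<in> span_of X k X"
    and compat: "\<And>w p. \<lbrakk>w \<in> X; p \<in> Y\<rbrakk> \<Longrightarrow> V p w = cnj (m w p)"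
  shows "\<exists>T\<in>linear_maps (generated_space X k) (generated_space Y l). \<exists>S.
    is_adjoint (generated_space X k) (generated_space Y l) T S \<and>
    (\<forall>w\<in>X. T (generator X k w) = m w) \<and> (\<forall>p\<in>Y. S (generator Y l p) = V p)"
proof -
  interpret X: psd_kernel X k by fact
  interpret Y: psd_kernel Y l by fact
  obtain T where T: "T \<in> linear_maps (generated_space X k) (generated_space Y l)"
    "\<And>w. w \<in> X \<Longrightarrow> T (generator X k w) = m w"
    using linear_extension[OF assms] by blast
  have compat': "m w p = cnj (V p w)" if "p \<in> Y" "w \<in> X" for w p
    unfolding compat[OF that(2,1)] by simp
  obtain S where S: "S \<in> linear_maps (generated_space Y l) (generated_space X k)"
    "\<And>p. p \<in> Y \<Longrightarrow> S (generator Y l p) = V p"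
    "\<And>y w. \<lbrakk>y \<in> span_of Y l Y; w \<in> X\<rbrakk> \<Longrightarrow> S y w = ip (generated_space Y l) (m w) y"
    using linear_extension[OF assms(2,1) V m compat'] by blast
  have mem: "S y \<in> span_of X k X" if "y \<in> span_of Y l Y" for y
    using S(1) that by (auto simp: linear_maps_def)
  have memT: "T x \<in> span_of Y l Y" if "x \<in> span_of X k X" for x
    using T(1) that by (auto simp: linear_maps_def)
  \<comment> \<open>Induction is needed in \<open>x\<close> only: the pointwise formula for
    \<open>S y w\<close> already holds for every vector \<open>y\<close>, and it is the adjoint
    relation for the generator of \<open>w\<close>.\<close>
  have "ip (generated_space X k) (S y) x = ip (generated_space Y l) y (T x)"
    if "x \<in> span_of X k X" and y: "y \<in> span_of Y l Y" for x y
    using that(1)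
  proof (induction rule: span_of_induct)
    case zero
    have "T (\<lambda>v. 0) = (\<lambda>v. 0)"
      using linear_maps_zero[OF T(1) module_generated_space module_generated_space] by simp
    then show ?case
      using X.ip_span_smult[OF mem[OF y] zero_in_span_of, of 0] Y.ip_span_smult[OF y zero_in_span_of, of 0]
      by simp
  next
    case (add c w x)
    note g = generator_in_span_of[OF add(1), of X k]
    have "ip (generated_space X k) (S y) (generator X k w) = cnj (S y w)"
      using X.ip_span_commute[OF g mem[OF y]] X.ip_generator[OF add(1) mem[OF y]] by simp
    also have "\<dots> = ip (generated_space Y l) y (m w)"
      using S(3)[OF y add(1)] Y.ip_span_commute[OF y m[OF add(1)]] by simp
    finally show ?case
      using add T m[OF add(1)] y mem[OF y] g memT[OF add(2)]
      by (simp add: linear_maps_combine X.ip_span_add X.ip_span_smult Y.ip_span_add Y.ip_span_smult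
          smult_in_span_of)
  qed
  with S(1) have "is_adjoint (generated_space X k) (generated_space Y l) T S"
    by (simp add: is_adjoint_def)
  then show ?thesis using T S(2) by blast
qed

section \<open>The coproduct of star-algebras\<close>

lemma free_algebra_simps [simp]:
  "mult (free_algebra A) = (\<lambda>f g w. \<Sum>k\<le>length w. f (take k w) * g (drop k w))"
  "one (free_algebra A) = (\<lambda>w. if w = [] then 1 else 0)"
  "zero (free_algebra A) = (\<lambda>w. 0)"
  "add (free_algebra A) = (\<lambda>f g w. f w + g w)"
  "smult (free_algebra A) = (\<lambda>c f w. c * f w)"
  "star (free_algebra A) = (\<lambda>f w. if w \<in> lists (letters A) then cnj (f (star_word A w)) else 0)"
  by (simp_all add: free_algebra_def)

lemma free_algebra_carrier:
  "f \<in> carrier (free_algebra A) \<longleftrightarrow> finite {w. f w \<noteq> 0} \<and> {w. f w \<noteq> 0} \<subseteq> lists (letters A)"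
  by (simp add: free_algebra_def)

lemma free_algebra_carrierI:
  assumes "\<And>w. w \<notin> S \<Longrightarrow> f w = 0" "finite S" "S \<subseteq> lists (letters A)"
  shows "f \<in> carrier (free_algebra A)"
proof -
  have "{w. f w \<noteq> 0} \<subseteq> S" using assms(1) by blast
  then show ?thesis using assms(2,3) finite_subset unfolding free_algebra_carrier by blast
qed

lemma free_algebra_add_closed:
  assumes "f \<in> carrier (free_algebra A)" "g \<in> carrier (free_algebra A)"
  shows "(\<lambda>w. f w + g w) \<in> carrier (free_algebra A)"
  using assms unfolding free_algebra_carrier
  by (intro free_algebra_carrierI[of "{w. f w \<noteq> 0} \<union> {w. g w \<noteq> 0}", unfolded free_algebra_carrier]) auto

lemma free_algebra_smult_closed:
  assumes "f \<in> carrier (free_algebra A)"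
  shows "c \<odot>\<^bsub>free_algebra A\<^esub> f \<in> carrier (free_algebra A)"
  using assms unfolding free_algebra_carrier free_algebra_simps
  by (intro free_algebra_carrierI[of "{w. f w \<noteq> 0}", unfolded free_algebra_carrier]) auto

lemma free_algebra_mult_closed:
  assumes "f \<in> carrier (free_algebra A)" "g \<in> carrier (free_algebra A)"
  shows "(\<lambda>w. \<Sum>k\<le>length w. f (take k w) * g (drop k w)) \<in> carrier (free_algebra A)"
proof (rule free_algebra_carrierI[of "(\<lambda>(u, v). u @ v) ` ({w. f w \<noteq> 0} \<times> {w. g w \<noteq> 0})"])
  fix w assume w: "w \<notin> (\<lambda>(u, v). u @ v) ` ({w. f w \<noteq> 0} \<times> {w. g w \<noteq> 0})"
  show "(\<Sum>k\<le>length w. f (take k w) * g (drop k w)) = 0"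
  proof (rule sum.neutral, rule ballI)
    fix k
    have "w = (\<lambda>(u, v). u @ v) (take k w, drop k w)" by simp
    with w have "(take k w, drop k w) \<notin> {w. f w \<noteq> 0} \<times> {w. g w \<noteq> 0}" by blast
    then show "f (take k w) * g (drop k w) = 0" by auto
  qed
qed (use assms in \<open>simp add: free_algebra_carrier\<close>, use assms in \<open>fastforce simp: free_algebra_carrier subset_iff lists_eq_set\<close>)

text \<open>Both sides sum over the ways of cutting \<open>w\<close> into three pieces. The left
  side chooses the second cut \<open>k\<close> before the first cut \<open>j\<close>, the right side
  chooses \<open>j\<close> and then the length \<open>m = k - j\<close> of the middle piece.\<close>

lemma convolution_assoc:
  fixes f g h :: "'x list \<Rightarrow> complex"
  shows "(\<Sum>k\<le>length w. (\<Sum>j\<le>length (take k w). f (take j (take k w)) * g (drop j (take k w))) * h (drop k w))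
    = (\<Sum>j\<le>length w. f (take j w) * (\<Sum>m\<le>length (drop j w). g (take m (drop j w)) * h (drop m (drop j w))))"
    (is "?L = ?R")
proof -
  define a where "a j m = f (take j w) * g (take m (drop j w)) * h (drop (m + j) w)" for j m
  have "?L = (\<Sum>k\<le>length w. \<Sum>j\<le>k. a j (k - j))"
    by (intro sum.cong refl) (simp add: a_def sum_distrib_right min_def drop_take)
  also have "\<dots> = (\<Sum>(j, m)\<in>{(j, m). j + m \<le> length w}. a j m)"
    by (rule sum.triangle_reindex_eq[symmetric])
  also have "{(j, m). j + m \<le> length w} = Sigma {..length w} (\<lambda>j. {..length w - j})"
    by auto
  also have "(\<Sum>(j, m)\<in>Sigma {..length w} (\<lambda>j. {..length w - j}). a j m)
      = (\<Sum>j\<le>length w. \<Sum>m\<le>length w - j. a j m)"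
    by (rule sum.Sigma[symmetric]) auto
  also have "\<dots> = ?R"
    by (intro sum.cong refl) (simp add: a_def sum_distrib_left mult.assoc)
  finally show ?thesis .
qed

lemma ring_free_algebra: "ring (free_algebra A)"
proof (rule ringI)
  show "abelian_group (free_algebra A)"
  proof (rule abelian_groupI)
    fix x assume "x \<in> carrier (free_algebra A)"
    then show "\<exists>y\<in>carrier (free_algebra A). y \<oplus>\<^bsub>free_algebra A\<^esub> x = \<zero>\<^bsub>free_algebra A\<^esub>"
      by (intro bexI[of _ "-1 \<odot>\<^bsub>free_algebra A\<^esub> x"] free_algebra_smult_closed) simp_all
  next
    show "\<zero>\<^bsub>free_algebra A\<^esub> \<in> carrier (free_algebra A)" by (simp add: free_algebra_carrier)
  qed (simp_all add: free_algebra_add_closed add.assoc add.commute add.left_commute)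
  show "Group.monoid (free_algebra A)"
  proof (rule monoidI)
    show "\<one>\<^bsub>free_algebra A\<^esub> \<in> carrier (free_algebra A)"
      by (rule free_algebra_carrierI[of "{[]}"]) auto
    fix x assume "x \<in> carrier (free_algebra A)"
    have "(\<Sum>k\<le>length w. (if take k w = [] then 1 else 0) * x (drop k w)) = (\<Sum>k\<le>length w. if k = 0 then x w else 0)" for w
      by (intro sum.cong) auto
    then show "\<one>\<^bsub>free_algebra A\<^esub> \<otimes>\<^bsub>free_algebra A\<^esub> x = x" by (simp add: sum.delta)
    have "(\<Sum>k\<le>length w. x (take k w) * (if drop k w = [] then 1 else 0)) = (\<Sum>k\<le>length w. if k = length w then x w else 0)" for w
      by (intro sum.cong) auto
    then show "x \<otimes>\<^bsub>free_algebra A\<^esub> \<one>\<^bsub>free_algebra A\<^esub> = x" by (simp add: sum.delta)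
  next
    fix x y z show "x \<otimes>\<^bsub>free_algebra A\<^esub> y \<otimes>\<^bsub>free_algebra A\<^esub> z
        = x \<otimes>\<^bsub>free_algebra A\<^esub> (y \<otimes>\<^bsub>free_algebra A\<^esub> z)"
      unfolding free_algebra_simps by (rule ext) (rule convolution_assoc)
  qed (simp_all add: free_algebra_mult_closed)
qed (simp_all add: distrib_left distrib_right sum.distrib)

lemma free_algebra_minus:
  assumes "f \<in> carrier (free_algebra A)" "g \<in> carrier (free_algebra A)"
  shows "f \<ominus>\<^bsub>free_algebra A\<^esub> g = (\<lambda>w. f w - g w)"
proof -
  interpret ring "free_algebra A" by (rule ring_free_algebra)
  have "\<ominus>\<^bsub>free_algebra A\<^esub> g = (\<lambda>w. - 1 * g w)"
    using assms(2) free_algebra_smult_closed[OF assms(2), of "-1"] by (intro minus_equality) simp_all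
  then show ?thesis using assms by (simp add: a_minus_def)
qed

lemma letter_closed: "a \<in> carrier (A i) \<Longrightarrow> letter i a \<in> carrier (free_algebra A)"
  by (rule free_algebra_carrierI[of "{[(i, a)]}"]) (auto simp: letter_def letters_def)

section \<open>The involution on the free algebra\<close>

locale star_algebra_family =
  fixes A :: "'i \<Rightarrow> ('a, 'm) star_algebra_scheme"
  assumes star_algebra: "\<And>i. unital_star_algebra (A i)"
begin

sublocale F: ring "free_algebra A" by (rule ring_free_algebra)

lemma
  shows add_closed: "\<lbrakk>a \<in> carrier (A i); b \<in> carrier (A i)\<rbrakk> \<Longrightarrow> a \<oplus>\<^bsub>A i\<^esub> b \<in> carrier (A i)"
    and mult_closed: "\<lbrakk>a \<in> carrier (A i); b \<in> carrier (A i)\<rbrakk> \<Longrightarrow> a \<otimes>\<^bsub>A i\<^esub> b \<in> carrier (A i)"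
    and one_closed: "\<one>\<^bsub>A i\<^esub> \<in> carrier (A i)"
    and smult_closed: "a \<in> carrier (A i) \<Longrightarrow> c \<odot>\<^bsub>A i\<^esub> a \<in> carrier (A i)"
    and star_closed: "a \<in> carrier (A i) \<Longrightarrow> star (A i) a \<in> carrier (A i)"
    and star_star: "a \<in> carrier (A i) \<Longrightarrow> star (A i) (star (A i) a) = a"
    and star_add: "\<lbrakk>a \<in> carrier (A i); b \<in> carrier (A i)\<rbrakk> \<Longrightarrow>
      star (A i) (a \<oplus>\<^bsub>A i\<^esub> b) = star (A i) a \<oplus>\<^bsub>A i\<^esub> star (A i) b"
    and star_mult: "\<lbrakk>a \<in> carrier (A i); b \<in> carrier (A i)\<rbrakk> \<Longrightarrow>
      star (A i) (a \<otimes>\<^bsub>A i\<^esub> b) = star (A i) b \<otimes>\<^bsub>A i\<^esub> star (A i) a"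
    and star_smult: "a \<in> carrier (A i) \<Longrightarrow> star (A i) (c \<odot>\<^bsub>A i\<^esub> a) = cnj c \<odot>\<^bsub>A i\<^esub> star (A i) a"
proof -
  interpret unital_star_algebra "A i" by (rule star_algebra)
  show "\<lbrakk>a \<in> carrier (A i); b \<in> carrier (A i)\<rbrakk> \<Longrightarrow> a \<oplus>\<^bsub>A i\<^esub> b \<in> carrier (A i)"
    "\<lbrakk>a \<in> carrier (A i); b \<in> carrier (A i)\<rbrakk> \<Longrightarrow> a \<otimes>\<^bsub>A i\<^esub> b \<in> carrier (A i)"
    "\<one>\<^bsub>A i\<^esub> \<in> carrier (A i)" by simp_all
  show "a \<in> carrier (A i) \<Longrightarrow> c \<odot>\<^bsub>A i\<^esub> a \<in> carrier (A i)"
    by (rule smult_closed) (simp_all add: complex_field_def)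
  show "a \<in> carrier (A i) \<Longrightarrow> star (A i) a \<in> carrier (A i)"
    "a \<in> carrier (A i) \<Longrightarrow> star (A i) (star (A i) a) = a"
    "\<lbrakk>a \<in> carrier (A i); b \<in> carrier (A i)\<rbrakk> \<Longrightarrow>
      star (A i) (a \<oplus>\<^bsub>A i\<^esub> b) = star (A i) a \<oplus>\<^bsub>A i\<^esub> star (A i) b"
    "\<lbrakk>a \<in> carrier (A i); b \<in> carrier (A i)\<rbrakk> \<Longrightarrow>
      star (A i) (a \<otimes>\<^bsub>A i\<^esub> b) = star (A i) b \<otimes>\<^bsub>A i\<^esub> star (A i) a"
    "a \<in> carrier (A i) \<Longrightarrow> star (A i) (c \<odot>\<^bsub>A i\<^esub> a) = cnj c \<odot>\<^bsub>A i\<^esub> star (A i) a"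
    by (fact star_closed star_star star_add star_mult star_smult)+
qed

lemma star_one: "star (A i) \<one>\<^bsub>A i\<^esub> = \<one>\<^bsub>A i\<^esub>"
proof -
  interpret unital_star_algebra "A i" by (rule star_algebra)
  let ?s = "star (A i) \<one>\<^bsub>A i\<^esub>"
  have "star (A i) ?s = star (A i) (?s \<otimes>\<^bsub>A i\<^esub> \<one>\<^bsub>A i\<^esub>)" by (simp add: star_closed)
  also have "\<dots> = ?s \<otimes>\<^bsub>A i\<^esub> star (A i) ?s" by (rule star_mult) (simp_all add: star_closed)
  finally show ?thesis by (simp add: star_star star_closed)
qed

lemma star_word_closed: "w \<in> lists (letters A) \<Longrightarrow> star_word A w \<in> lists (letters A)"
  by (auto simp: star_word_def letters_def star_closed lists_eq_set)

lemma star_word_star_word: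
  assumes "w \<in> lists (letters A)"
  shows "star_word A (star_word A w) = w"
proof -
  have "map ((\<lambda>(i, a). (i, star (A i) a)) \<circ> (\<lambda>(i, a). (i, star (A i) a))) w = w"
    using assms by (intro map_idI) (auto simp: letters_def star_star lists_eq_set)
  then show ?thesis by (simp add: star_word_def rev_map)
qed

lemma star_word_eq_iff:
  assumes "w \<in> lists (letters A)" "a \<in> carrier (A i)"
  shows "star_word A w = [(i, a)] \<longleftrightarrow> w = [(i, star (A i) a)]"
proof -
  have "star_word A [(i, star (A i) a)] = [(i, a)]" using assms by (simp add: star_word_def star_star)
  moreover have "star_word A [(i, a)] = [(i, star (A i) a)]" by (simp add: star_word_def)
  ultimately show ?thesis using star_word_star_word[OF assms(1)] by metis
qed

lemma star_letter:
  assumes "a \<in> carrier (A i)"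
  shows "star (free_algebra A) (letter i a) = letter i (star (A i) a)"
proof
  fix w
  have "[(i, star (A i) a)] \<in> lists (letters A)" using assms by (simp add: letters_def star_closed)
  then show "star (free_algebra A) (letter i a) w = letter i (star (A i) a) w"
    using star_word_eq_iff[OF _ assms] by (auto simp: letter_def)
qed

lemma free_algebra_star_closed:
  assumes "f \<in> carrier (free_algebra A)"
  shows "star (free_algebra A) f \<in> carrier (free_algebra A)"
proof (rule free_algebra_carrierI[of "star_word A ` {w. f w \<noteq> 0}"])
  fix w assume w: "w \<notin> star_word A ` {w. f w \<noteq> 0}"
  show "star (free_algebra A) f w = 0"
  proof (cases "w \<in> lists (letters A)")
    case True
    have "f (star_word A w) = 0"
    proof (rule ccontr)
      assume "f (star_word A w) \<noteq> 0"
      then have "star_word A (star_word A w) \<in> star_word A ` {w. f w \<noteq> 0}" by blast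
      then show False using w star_word_star_word[OF True] by simp
    qed
    then show ?thesis by simp
  qed simp
next
  show "finite (star_word A ` {w. f w \<noteq> 0})" using assms by (simp add: free_algebra_carrier)
  show "star_word A ` {w. f w \<noteq> 0} \<subseteq> lists (letters A)"
    using assms star_word_closed unfolding free_algebra_carrier by blast
qed

lemma free_algebra_star_mult:
  assumes "f \<in> carrier (free_algebra A)" "g \<in> carrier (free_algebra A)"
  shows "star (free_algebra A) (f \<otimes>\<^bsub>free_algebra A\<^esub> g)
    = star (free_algebra A) g \<otimes>\<^bsub>free_algebra A\<^esub> star (free_algebra A) f" (is "?l = ?r")
proof
  fix w show "?l w = ?r w"
  proof (cases "w \<in> lists (letters A)")
    case True
    have len: "length (star_word A w) = length w" by (simp add: star_word_def)
    have tk: "take k w \<in> lists (letters A)" "drop k w \<in> lists (letters A)" for k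
      using True by (auto dest: in_set_takeD in_set_dropD simp: lists_eq_set)
    have td: "star_word A (take k w) = drop (length w - k) (star_word A w)"
      "star_word A (drop k w) = take (length w - k) (star_word A w)" for k
      by (simp_all add: star_word_def rev_take rev_drop flip: take_map drop_map)
    have "?l w = (\<Sum>k\<le>length w. cnj (f (take k (star_word A w))) * cnj (g (drop k (star_word A w))))"
      using True by (simp add: len)
    \<comment> \<open>Reversing a word turns a cut after \<open>k\<close> letters into a cut after
      \<open>length w - k\<close> letters.\<close>
    also have "\<dots> = (\<Sum>k\<le>length w. cnj (f (take (length w - k) (star_word A w))) * cnj (g (drop (length w - k) (star_word A w))))"
      by (rule sum.reindex_bij_witness[of _ "\<lambda>k. length w - k" "\<lambda>k. length w - k"]) auto
    also have "\<dots> = ?r w" using tk by (simp add: td mult.commute)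
    finally show ?thesis .
  next
    case False
    \<comment> \<open>Off the words over \<open>letters A\<close> the left side is zero by the
      definition of \<open>star\<close>, the right side because members of the carrier are supported
      on such words.\<close>
    have "?r \<in> carrier (free_algebra A)"
      using assms by (intro F.m_closed free_algebra_star_closed)
    then have "?r w = 0" using False unfolding free_algebra_carrier by blast
    then show ?thesis using False by simp
  qed
qed

lemma free_algebra_star_minus:
  assumes "f \<in> carrier (free_algebra A)" "g \<in> carrier (free_algebra A)"
  shows "star (free_algebra A) (f \<ominus>\<^bsub>free_algebra A\<^esub> g)
    = star (free_algebra A) f \<ominus>\<^bsub>free_algebra A\<^esub> star (free_algebra A) g"
  unfolding free_algebra_minus[OF assms] free_algebra_minus[OF assms[THEN free_algebra_star_closed]]
  by auto

lemma coproduct_relations_closed: "coproduct_relations A \<subseteq> carrier (free_algebra A)"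
  unfolding coproduct_relations_def Let_def
  by (auto simp del: free_algebra_simps intro!: F.minus_closed F.a_closed F.m_closed F.one_closed free_algebra_smult_closed
      letter_closed add_closed mult_closed smult_closed one_closed)

sublocale N: ideal "coproduct_ideal A" "free_algebra A"
  unfolding coproduct_ideal_def by (rule F.genideal_ideal[OF coproduct_relations_closed])

lemma relation_in_ideal: "x \<in> coproduct_relations A \<Longrightarrow> x \<in> coproduct_ideal A"
  using F.genideal_self[OF coproduct_relations_closed] unfolding coproduct_ideal_def by blast

end

section \<open>The quotient by the coproduct relations\<close>

lemma free_algebra_smult_mult:
  "(c \<odot>\<^bsub>free_algebra A\<^esub> f) \<otimes>\<^bsub>free_algebra A\<^esub> g = c \<odot>\<^bsub>free_algebra A\<^esub> (f \<otimes>\<^bsub>free_algebra A\<^esub> g)"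
  "f \<otimes>\<^bsub>free_algebra A\<^esub> (c \<odot>\<^bsub>free_algebra A\<^esub> g) = c \<odot>\<^bsub>free_algebra A\<^esub> (f \<otimes>\<^bsub>free_algebra A\<^esub> g)"
  by (simp_all add: sum_distrib_left mult.assoc mult.left_commute)

lemma free_product_simps:
  "carrier (free_product A) = carrier (free_algebra A Quot coproduct_ideal A)"
  "mult (free_product A) = mult (free_algebra A Quot coproduct_ideal A)"
  "one (free_product A) = one (free_algebra A Quot coproduct_ideal A)"
  "zero (free_product A) = zero (free_algebra A Quot coproduct_ideal A)"
  "add (free_product A) = add (free_algebra A Quot coproduct_ideal A)"
  by (simp_all add: free_product_def Let_def)

definition word :: "('i \<times> 'a) list \<Rightarrow> ('i \<times> 'a) list \<Rightarrow> complex" where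
  "word u = (\<lambda>w. if w = u then 1 else 0)"

lemma word_closed: "u \<in> lists (letters A) \<Longrightarrow> word u \<in> carrier (free_algebra A)"
  by (rule free_algebra_carrierI[of "{u}"]) (auto simp: word_def)

lemma word_Cons: "word ((i, a) # u) = letter i a \<otimes>\<^bsub>free_algebra A\<^esub> word u"
proof
  fix w
  \<comment> \<open>At most one term of the convolution is nonzero, the cut after the first
    letter.\<close>
  have "letter i a (take k w) * word u (drop k w) = (if k = 1 then word ((i, a) # u) w else 0)"
    if "k \<le> length w" for k
    using that by (cases w; cases k) (auto simp: letter_def word_def)
  then have "(letter i a \<otimes>\<^bsub>free_algebra A\<^esub> word u) w = (\<Sum>k\<le>length w. if k = 1 then word ((i, a) # u) w else 0)"
    by simp
  also have "\<dots> = word ((i, a) # u) w"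
    by (cases w) (auto simp: word_def sum.delta simp del: sum.atMost_Suc)
  finally show "word ((i, a) # u) w = (letter i a \<otimes>\<^bsub>free_algebra A\<^esub> word u) w" ..
qed

definition coset_of ::
  "('i \<Rightarrow> ('a, 'm) star_algebra_scheme) \<Rightarrow> (('i \<times> 'a) list \<Rightarrow> complex) \<Rightarrow> (('i \<times> 'a) list \<Rightarrow> complex) set" where
  "coset_of A f = coproduct_ideal A +>\<^bsub>free_algebra A\<^esub> f"

lemma letter_embed_eq: "letter_embed A i a = coset_of A (letter i a)"
  by (simp add: letter_embed_def coset_of_def)

context star_algebra_family begin

lemmas letter_in_free_algebra = letter_closed[where A = A]

lemma
  shows coset_of_closed: "f \<in> carrier (free_algebra A) \<Longrightarrow> coset_of A f \<in> carrier (free_product A)"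
    and coset_of_mult: "\<lbrakk>f \<in> carrier (free_algebra A); g \<in> carrier (free_algebra A)\<rbrakk> \<Longrightarrow>
      coset_of A (f \<otimes>\<^bsub>free_algebra A\<^esub> g) = coset_of A f \<otimes>\<^bsub>free_product A\<^esub> coset_of A g"
    and coset_of_add: "\<lbrakk>f \<in> carrier (free_algebra A); g \<in> carrier (free_algebra A)\<rbrakk> \<Longrightarrow>
      coset_of A (f \<oplus>\<^bsub>free_algebra A\<^esub> g) = coset_of A f \<oplus>\<^bsub>free_product A\<^esub> coset_of A g"
    and coset_of_one: "coset_of A \<one>\<^bsub>free_algebra A\<^esub> = \<one>\<^bsub>free_product A\<^esub>"
  using N.rcos_ring_hom
  by (auto simp: coset_of_def free_product_simps ring_hom_def Pi_iff simp del: free_algebra_simps)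

lemma free_product_cases:
  assumes "x \<in> carrier (free_product A)"
  obtains f where "f \<in> carrier (free_algebra A)" "x = coset_of A f"
  using assms by (auto simp: free_product_simps FactRing_def A_RCOSETS_def' coset_of_def simp del: free_algebra_simps)

lemma coset_of_eqI:
  assumes "f \<in> carrier (free_algebra A)" "g \<in> carrier (free_algebra A)"
    and "f \<ominus>\<^bsub>free_algebra A\<^esub> g \<in> coproduct_ideal A"
  shows "coset_of A f = coset_of A g"
  using F.quotient_eq_iff_same_a_r_cos[OF N.ideal_axioms assms(1,2)] assms(3) by (simp add: coset_of_def)

text \<open>The record \<open>free_product\<close> shares the ring fields of the library's quotient
  but is a different record, so the ring axioms are carried over one at a time.\<close>

sublocale P: ring "free_product A"
proof -
  interpret Q: ring "free_algebra A Quot coproduct_ideal A" by (rule N.quotient_is_ring)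
  have "abelian_group (free_product A)"
    by (rule abelian_groupI)
      (auto simp: free_product_simps Q.a_ac intro!: bexI[of _ "\<ominus>\<^bsub>free_algebra A Quot coproduct_ideal A\<^esub> x" for x] Q.l_neg)
  moreover have "Group.monoid (free_product A)"
    by (rule monoidI) (simp_all add: free_product_simps Q.m_assoc)
  ultimately show "ring (free_product A)"
    by (rule ringI) (simp_all add: free_product_simps Q.l_distr Q.r_distr)
qed

lemma coset_member:
  assumes "f \<in> carrier (free_algebra A)" "g \<in> coset_of A f"
  shows "g \<in> carrier (free_algebra A)" "g \<ominus>\<^bsub>free_algebra A\<^esub> f \<in> coproduct_ideal A"
proof -
  show g: "g \<in> carrier (free_algebra A)"
    using assms F.a_r_coset_subset_G[OF N.a_subset] unfolding coset_of_def by blast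
  have "coset_of A g = coset_of A f"
    using N.a_repr_independence'[OF assms(2)[unfolded coset_of_def] assms(1)] by (simp add: coset_of_def)
  then show "g \<ominus>\<^bsub>free_algebra A\<^esub> f \<in> coproduct_ideal A"
    using F.quotient_eq_iff_same_a_r_cos[OF N.ideal_axioms g assms(1)] by (simp add: coset_of_def)
qed

text \<open>A ring ideal absorbs scalars because scaling by \<open>c\<close> is multiplication by
  \<open>c\<close> times the unit.\<close>

lemma ideal_smult:
  assumes "f \<in> coproduct_ideal A"
  shows "c \<odot>\<^bsub>free_algebra A\<^esub> f \<in> coproduct_ideal A"
proof -
  have "(c \<odot>\<^bsub>free_algebra A\<^esub> \<one>\<^bsub>free_algebra A\<^esub>) \<otimes>\<^bsub>free_algebra A\<^esub> f \<in> coproduct_ideal A"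
    by (rule N.I_l_closed[OF assms free_algebra_smult_closed[OF F.one_closed]])
  then show ?thesis
    unfolding free_algebra_smult_mult F.l_one[OF N.Icarr[OF assms]] .
qed

text \<open>Scalar multiplication on cosets is a union over all representatives. Any two of them
  differ by an element of the ideal, so the union consists of a single coset.\<close>

lemma coset_of_smult:
  assumes f: "f \<in> carrier (free_algebra A)"
  shows "coset_of A (c \<odot>\<^bsub>free_algebra A\<^esub> f) = c \<odot>\<^bsub>free_product A\<^esub> coset_of A f"
proof -
  have "coset_of A (c \<odot>\<^bsub>free_algebra A\<^esub> g) = coset_of A (c \<odot>\<^bsub>free_algebra A\<^esub> f)" if "g \<in> coset_of A f" for g
  proof -
    note g = coset_member[OF f that]
    have "c \<odot>\<^bsub>free_algebra A\<^esub> g \<ominus>\<^bsub>free_algebra A\<^esub> c \<odot>\<^bsub>free_algebra A\<^esub> f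
        = c \<odot>\<^bsub>free_algebra A\<^esub> (g \<ominus>\<^bsub>free_algebra A\<^esub> f)"
      unfolding free_algebra_minus[OF g(1) f]
        free_algebra_minus[OF free_algebra_smult_closed[OF g(1)] free_algebra_smult_closed[OF f]]
      by (simp add: right_diff_distrib)
    then show ?thesis
      using g f ideal_smult[OF g(2)] by (intro coset_of_eqI free_algebra_smult_closed) simp_all
  qed
  moreover have "f \<in> coset_of A f" using N.a_rcos_self[OF f] by (simp add: coset_of_def)
  ultimately have "(\<Union>g\<in>coset_of A f. coset_of A (c \<odot>\<^bsub>free_algebra A\<^esub> g)) = coset_of A (c \<odot>\<^bsub>free_algebra A\<^esub> f)"
    by blast
  then show ?thesis by (simp add: free_product_def Let_def coset_of_def del: free_algebra_simps)
qed

text \<open>The elements whose star lies in the ideal form an ideal themselves, and it contains the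
  relations because the involution maps each family of relations into itself (in the product
  relation the starred factors change places). Minimality of the generated ideal gives the
  claim.\<close>

lemma star_ideal:
  assumes "f \<in> coproduct_ideal A"
  shows "star (free_algebra A) f \<in> coproduct_ideal A"
proof -
  let ?F = "free_algebra A"
  let ?I = "{f \<in> carrier ?F. star ?F f \<in> coproduct_ideal A}"
  have zero: "star ?F \<zero>\<^bsub>?F\<^esub> = \<zero>\<^bsub>?F\<^esub>" by auto
  have one: "star ?F \<one>\<^bsub>?F\<^esub> = \<one>\<^bsub>?F\<^esub>" by (auto simp: star_word_def)
  have add: "star ?F (f \<oplus>\<^bsub>?F\<^esub> g) = star ?F f \<oplus>\<^bsub>?F\<^esub> star ?F g" for f g by auto
  have smult: "star ?F (c \<odot>\<^bsub>?F\<^esub> f) = cnj c \<odot>\<^bsub>?F\<^esub> star ?F f" for c f by auto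
  note closed = add_closed mult_closed smult_closed one_closed star_closed letter_in_free_algebra
    free_algebra_smult_closed F.a_closed F.m_closed F.one_closed F.minus_closed
  have "ideal ?I ?F"
  proof (rule idealI[OF F.ring_axioms])
    show "subgroup ?I (add_monoid ?F)"
    proof (rule subgroup.intro, goal_cases)
      case (4 f)
      then have f: "f \<in> carrier ?F" "star ?F f \<in> coproduct_ideal A" by simp_all
      have "\<ominus>\<^bsub>?F\<^esub> f = \<zero>\<^bsub>?F\<^esub> \<ominus>\<^bsub>?F\<^esub> f"
        using f(1) by (simp add: a_minus_def del: free_algebra_simps)
      moreover have "star ?F (\<zero>\<^bsub>?F\<^esub> \<ominus>\<^bsub>?F\<^esub> f) = \<ominus>\<^bsub>?F\<^esub> star ?F f"
        unfolding free_algebra_star_minus[OF F.zero_closed f(1)] zero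
        using free_algebra_star_closed[OF f(1)] by (simp add: a_minus_def del: free_algebra_simps)
      ultimately show ?case
        using f by (simp add: a_inv_def[symmetric] N.a_inv_closed del: free_algebra_simps)
    qed (auto simp: add zero N.a_closed simp del: free_algebra_simps)
  qed (auto simp: free_algebra_star_mult N.I_l_closed N.I_r_closed free_algebra_star_closed
      simp del: free_algebra_simps)
  moreover have "coproduct_relations A \<subseteq> ?I"
  proof
    fix x assume x: "x \<in> coproduct_relations A"
    from x have "star ?F x \<in> coproduct_relations A"
      unfolding coproduct_relations_def Let_def
    proof (elim UnE, goal_cases)
      case 1
      then obtain i a b where x: "x = letter i (a \<oplus>\<^bsub>A i\<^esub> b) \<ominus>\<^bsub>?F\<^esub> (letter i a \<oplus>\<^bsub>?F\<^esub> letter i b)"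
        "a \<in> carrier (A i)" "b \<in> carrier (A i)" by blast
      have "star ?F x = letter i (star (A i) a \<oplus>\<^bsub>A i\<^esub> star (A i) b)
          \<ominus>\<^bsub>?F\<^esub> (letter i (star (A i) a) \<oplus>\<^bsub>?F\<^esub> letter i (star (A i) b))"
        using x by (simp add: free_algebra_star_minus add star_letter star_add closed del: free_algebra_simps)
      then show ?case using x star_closed by blast
    next
      case 2
      then obtain i c a where x: "x = letter i (c \<odot>\<^bsub>A i\<^esub> a) \<ominus>\<^bsub>?F\<^esub> (c \<odot>\<^bsub>?F\<^esub> letter i a)"
        "a \<in> carrier (A i)" by blast
      have "star ?F x = letter i (cnj c \<odot>\<^bsub>A i\<^esub> star (A i) a) \<ominus>\<^bsub>?F\<^esub> (cnj c \<odot>\<^bsub>?F\<^esub> letter i (star (A i) a))"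
        using x by (simp add: free_algebra_star_minus smult star_letter star_smult closed del: free_algebra_simps)
      then show ?case using x star_closed by blast
    next
      case 3
      then obtain i a b where x: "x = letter i (a \<otimes>\<^bsub>A i\<^esub> b) \<ominus>\<^bsub>?F\<^esub> (letter i a \<otimes>\<^bsub>?F\<^esub> letter i b)"
        "a \<in> carrier (A i)" "b \<in> carrier (A i)" by blast
      have "star ?F x = letter i (star (A i) b \<otimes>\<^bsub>A i\<^esub> star (A i) a)
          \<ominus>\<^bsub>?F\<^esub> (letter i (star (A i) b) \<otimes>\<^bsub>?F\<^esub> letter i (star (A i) a))"
        using x by (simp add: free_algebra_star_minus free_algebra_star_mult star_letter star_mult closed
            del: free_algebra_simps)
      then show ?case using x star_closed by blast
    next
      case 4
      then obtain i where x: "x = letter i \<one>\<^bsub>A i\<^esub> \<ominus>\<^bsub>?F\<^esub> \<one>\<^bsub>?F\<^esub>" by blast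
      have "star ?F x = x"
        unfolding x by (simp add: free_algebra_star_minus one star_letter star_one closed del: free_algebra_simps)
      then show ?case using x by blast
    qed
    then show "x \<in> ?I" using x coproduct_relations_closed relation_in_ideal by blast
  qed
  ultimately have "coproduct_ideal A \<subseteq> ?I" unfolding coproduct_ideal_def by (rule F.genideal_minimal)
  then show ?thesis using assms by blast
qed

lemma coset_of_star:
  assumes f: "f \<in> carrier (free_algebra A)"
  shows "coset_of A (star (free_algebra A) f) = star (free_product A) (coset_of A f)"
proof -
  have "coset_of A (star (free_algebra A) g) = coset_of A (star (free_algebra A) f)" if "g \<in> coset_of A f" for g
  proof -
    note g = coset_member[OF f that]
    show ?thesis
      using star_ideal[OF g(2)] unfolding free_algebra_star_minus[OF g(1) f]
      by (intro coset_of_eqI free_algebra_star_closed g(1) f)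
  qed
  moreover have "f \<in> coset_of A f" using N.a_rcos_self[OF f] by (simp add: coset_of_def)
  ultimately have "(\<Union>g\<in>coset_of A f. coset_of A (star (free_algebra A) g)) = coset_of A (star (free_algebra A) f)"
    by blast
  then show ?thesis by (simp add: free_product_def Let_def coset_of_def del: free_algebra_simps)
qed

lemma free_product_star_closed:
  assumes "x \<in> carrier (free_product A)"
  shows "star (free_product A) x \<in> carrier (free_product A)"
  using assms
  by (elim free_product_cases) (simp add: coset_of_closed free_algebra_star_closed flip: coset_of_star
      del: free_algebra_simps)

lemma free_product_smult_mult:
  assumes "x \<in> carrier (free_product A)" "y \<in> carrier (free_product A)"
  shows "(c \<odot>\<^bsub>free_product A\<^esub> x) \<otimes>\<^bsub>free_product A\<^esub> y = c \<odot>\<^bsub>free_product A\<^esub> (x \<otimes>\<^bsub>free_product A\<^esub> y)"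
    and "x \<otimes>\<^bsub>free_product A\<^esub> (c \<odot>\<^bsub>free_product A\<^esub> y) = c \<odot>\<^bsub>free_product A\<^esub> (x \<otimes>\<^bsub>free_product A\<^esub> y)"
  using assms
  by (elim free_product_cases; simp add: free_algebra_smult_closed free_algebra_smult_mult
      flip: coset_of_smult coset_of_mult del: free_algebra_simps)+

lemma
  shows letter_embed_closed: "a \<in> carrier (A i) \<Longrightarrow> letter_embed A i a \<in> carrier (free_product A)"
    and letter_embed_add: "\<lbrakk>a \<in> carrier (A i); b \<in> carrier (A i)\<rbrakk> \<Longrightarrow>
      letter_embed A i (a \<oplus>\<^bsub>A i\<^esub> b) = letter_embed A i a \<oplus>\<^bsub>free_product A\<^esub> letter_embed A i b"
    and letter_embed_smult: "a \<in> carrier (A i) \<Longrightarrow>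
      letter_embed A i (c \<odot>\<^bsub>A i\<^esub> a) = c \<odot>\<^bsub>free_product A\<^esub> letter_embed A i a"
    and letter_embed_mult: "\<lbrakk>a \<in> carrier (A i); b \<in> carrier (A i)\<rbrakk> \<Longrightarrow>
      letter_embed A i (a \<otimes>\<^bsub>A i\<^esub> b) = letter_embed A i a \<otimes>\<^bsub>free_product A\<^esub> letter_embed A i b"
    and letter_embed_one: "letter_embed A i \<one>\<^bsub>A i\<^esub> = \<one>\<^bsub>free_product A\<^esub>"
    and letter_embed_star: "a \<in> carrier (A i) \<Longrightarrow>
      letter_embed A i (star (A i) a) = star (free_product A) (letter_embed A i a)"
proof -
  note closed = add_closed mult_closed smult_closed one_closed star_closed letter_in_free_algebra
    free_algebra_smult_closed F.a_closed F.m_closed F.one_closed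
  show "letter_embed A i a \<in> carrier (free_product A)" if "a \<in> carrier (A i)"
    using that unfolding letter_embed_eq by (intro coset_of_closed letter_in_free_algebra)
  show "letter_embed A i (a \<oplus>\<^bsub>A i\<^esub> b) = letter_embed A i a \<oplus>\<^bsub>free_product A\<^esub> letter_embed A i b"
    if "a \<in> carrier (A i)" "b \<in> carrier (A i)"
    unfolding letter_embed_eq coset_of_add[OF letter_in_free_algebra[OF that(1)] letter_in_free_algebra[OF that(2)], symmetric]
    using that by (intro coset_of_eqI relation_in_ideal closed) (auto simp: coproduct_relations_def Let_def simp del: free_algebra_simps)
  show "letter_embed A i (c \<odot>\<^bsub>A i\<^esub> a) = c \<odot>\<^bsub>free_product A\<^esub> letter_embed A i a" if "a \<in> carrier (A i)"
    unfolding letter_embed_eq coset_of_smult[OF letter_in_free_algebra[OF that], symmetric]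
    using that by (intro coset_of_eqI relation_in_ideal closed) (auto simp: coproduct_relations_def Let_def simp del: free_algebra_simps)
  show "letter_embed A i (a \<otimes>\<^bsub>A i\<^esub> b) = letter_embed A i a \<otimes>\<^bsub>free_product A\<^esub> letter_embed A i b"
    if "a \<in> carrier (A i)" "b \<in> carrier (A i)"
    unfolding letter_embed_eq coset_of_mult[OF letter_in_free_algebra[OF that(1)] letter_in_free_algebra[OF that(2)], symmetric]
    using that by (intro coset_of_eqI relation_in_ideal closed) (auto simp: coproduct_relations_def Let_def simp del: free_algebra_simps)
  show "letter_embed A i \<one>\<^bsub>A i\<^esub> = \<one>\<^bsub>free_product A\<^esub>"
    unfolding letter_embed_eq coset_of_one[symmetric]
    by (intro coset_of_eqI relation_in_ideal closed) (auto simp: coproduct_relations_def Let_def simp del: free_algebra_simps)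
  show "letter_embed A i (star (A i) a) = star (free_product A) (letter_embed A i a)" if "a \<in> carrier (A i)"
    unfolding letter_embed_eq coset_of_star[OF letter_in_free_algebra[OF that], symmetric] star_letter[OF that] ..
qed

lemma word_product_Nil: "word_product A [] = \<one>\<^bsub>free_product A\<^esub>"
  by (simp add: word_product_def)

lemma word_product_Cons:
  "word_product A ((i, a) # u) = letter_embed A i a \<otimes>\<^bsub>free_product A\<^esub> word_product A u"
  by (simp add: word_product_def)

lemma word_product_closed:
  "u \<in> lists (letters A) \<Longrightarrow> word_product A u \<in> carrier (free_product A)"
  by (induction u) (auto simp: word_product_Nil word_product_Cons letters_def letter_embed_closed)

lemma word_product_append:
  assumes "u \<in> lists (letters A)" "v \<in> lists (letters A)"
  shows "word_product A (u @ v) = word_product A u \<otimes>\<^bsub>free_product A\<^esub> word_product A v"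
  using assms(1)
proof induction
  case Nil
  show ?case using assms(2) by (simp add: word_product_Nil word_product_closed)
next
  case (Cons l u)
  then show ?case using assms(2)
    by (cases l) (simp add: word_product_Cons letters_def[of A] letter_embed_closed P.m_assoc
        word_product_closed[unfolded letters_def])
qed

lemma coset_of_word: "u \<in> lists (letters A) \<Longrightarrow> coset_of A (word u) = word_product A u"
proof (induction u)
  case Nil
  have "word [] = \<one>\<^bsub>free_algebra A\<^esub>" by (simp add: word_def)
  then show ?case by (simp add: word_product_Nil coset_of_one del: free_algebra_simps)
next
  case (Cons l u)
  obtain i a where l: "l = (i, a)" by (cases l)
  with Cons have "a \<in> carrier (A i)" "u \<in> lists (letters A)" by (auto simp: letters_def)
  with Cons.IH show ?case
    unfolding l word_Cons[of i a u A] word_product_Cons letter_embed_eq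
    by (simp add: coset_of_mult letter_in_free_algebra word_closed del: free_algebra_simps)
qed

text \<open>Every element is the coset of a finitely supported function, hence a linear combination
  of products of letters. The induction removes one word of the support at a time.\<close>

lemma functional_eqI:
  assumes f: "unital_linear_functional (free_product A) f" and g: "unital_linear_functional (free_product A) g"
    and eq: "\<And>u. u \<in> lists (letters A) \<Longrightarrow> f (word_product A u) = g (word_product A u)"
    and x: "x \<in> carrier (free_product A)"
  shows "f x = g x"
proof -
  obtain h where h: "h \<in> carrier (free_algebra A)" and xh: "x = coset_of A h"
    using x by (rule free_product_cases)
  have add: "F (coset_of A (h \<oplus>\<^bsub>free_algebra A\<^esub> k)) = F (coset_of A h) + F (coset_of A k)"
    "F (coset_of A (c \<odot>\<^bsub>free_algebra A\<^esub> h)) = c * F (coset_of A h)"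
    if "unital_linear_functional (free_product A) F" "h \<in> carrier (free_algebra A)" "k \<in> carrier (free_algebra A)"
    for F h k c
    using that unfolding coset_of_add[OF that(2,3)] coset_of_smult[OF that(2)]
    by (auto simp: unital_linear_functional_def coset_of_closed)
  have "f (coset_of A h) = g (coset_of A h)"
    if "finite S" "S \<subseteq> lists (letters A)" "\<And>w. w \<notin> S \<Longrightarrow> h w = 0" for S h
    using that
  proof (induction S arbitrary: h rule: finite_induct)
    case empty
    then have h: "h = 0 \<odot>\<^bsub>free_algebra A\<^esub> \<one>\<^bsub>free_algebra A\<^esub>" by auto
    show ?case unfolding h add(2)[OF f F.one_closed F.one_closed] add(2)[OF g F.one_closed F.one_closed] by simp
  next
    case (insert u S)
    define k where "k = h(u := 0)"
    have k: "k \<in> carrier (free_algebra A)"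
      using insert.prems insert.hyps by (intro free_algebra_carrierI[of S]) (auto simp: k_def)
    have u: "u \<in> lists (letters A)" using insert.prems by simp
    have hk: "h = k \<oplus>\<^bsub>free_algebra A\<^esub> (h u \<odot>\<^bsub>free_algebra A\<^esub> word u)"
      by (auto simp: k_def word_def)
    have "f (coset_of A k) = g (coset_of A k)"
      using insert.prems by (intro insert.IH) (auto simp: k_def)
    moreover have "f (coset_of A (word u)) = g (coset_of A (word u))"
      using eq[OF u] coset_of_word[OF u] by simp
    moreover have split: "F (coset_of A h) = F (coset_of A k) + h u * F (coset_of A (word u))"
      if "unital_linear_functional (free_product A) F" for F
      by (subst hk) (simp only: add[OF that k free_algebra_smult_closed[OF word_closed[OF u]]]
          add[OF that word_closed[OF u] k])
    ultimately show ?case unfolding split[OF f] split[OF g] by simp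
  qed
  from this[of "{w. h w \<noteq> 0}" h] show ?thesis using h unfolding xh free_algebra_carrier by blast
qed

end

section \<open>Uniqueness of the alpha-free product\<close>

context star_algebra_family begin

lemma functional_word_add:
  assumes "unital_linear_functional (free_product A) f"
    and "u \<in> lists (letters A)" "v \<in> lists (letters A)" "a \<in> carrier (A i)" "b \<in> carrier (A i)"
  shows "f (word_product A (u @ (i, a \<oplus>\<^bsub>A i\<^esub> b) # v))
    = f (word_product A (u @ (i, a) # v)) + f (word_product A (u @ (i, b) # v))"
proof -
  have "(i, a) # v \<in> lists (letters A)" "(i, b) # v \<in> lists (letters A)"
    "(i, a \<oplus>\<^bsub>A i\<^esub> b) # v \<in> lists (letters A)"
    using assms(3-5) by (simp_all add: letters_def add_closed)
  then have "word_product A (u @ (i, a \<oplus>\<^bsub>A i\<^esub> b) # v)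
    = word_product A (u @ (i, a) # v) \<oplus>\<^bsub>free_product A\<^esub> word_product A (u @ (i, b) # v)"
    using assms(2-5)
    by (simp add: word_product_append word_product_Cons letter_embed_add letter_embed_closed
        word_product_closed P.l_distr P.r_distr del: in_lists_conv_set)
  moreover have "word_product A (u @ (i, c) # v) \<in> carrier (free_product A)" if "c \<in> carrier (A i)" for c
    using assms(2,3) that by (intro word_product_closed) (auto simp: letters_def)
  ultimately show ?thesis using assms by (simp add: unital_linear_functional_def)
qed

lemma functional_word_smult:
  assumes "unital_linear_functional (free_product A) f"
    and "u \<in> lists (letters A)" "v \<in> lists (letters A)" "a \<in> carrier (A i)"
  shows "f (word_product A (u @ (i, c \<odot>\<^bsub>A i\<^esub> a) # v)) = c * f (word_product A (u @ (i, a) # v))"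
proof -
  have "(i, a) # v \<in> lists (letters A)" "(i, c \<odot>\<^bsub>A i\<^esub> a) # v \<in> lists (letters A)"
    using assms(3,4) by (simp_all add: letters_def smult_closed)
  then have "word_product A (u @ (i, c \<odot>\<^bsub>A i\<^esub> a) # v)
    = c \<odot>\<^bsub>free_product A\<^esub> word_product A (u @ (i, a) # v)"
    using assms(2-4)
    by (simp add: word_product_append word_product_Cons letter_embed_smult letter_embed_closed
        word_product_closed free_product_smult_mult del: in_lists_conv_set)
  moreover have "word_product A (u @ (i, a) # v) \<in> carrier (free_product A)"
    using assms(2-4) by (intro word_product_closed) (auto simp: letters_def)
  ultimately show ?thesis using assms by (simp add: unital_linear_functional_def)
qed

lemma word_product_one:
  assumes "u \<in> lists (letters A)" "v \<in> lists (letters A)"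
  shows "word_product A (u @ (i, \<one>\<^bsub>A i\<^esub>) # v) = word_product A (u @ v)"
proof -
  have "(i, \<one>\<^bsub>A i\<^esub>) # v \<in> lists (letters A)"
    using assms by (simp add: letters_def one_closed)
  then show ?thesis
    using assms by (simp add: word_product_append word_product_Cons letter_embed_one word_product_closed
        del: in_lists_conv_set)
qed

lemma word_product_merge:
  assumes "u \<in> lists (letters A)" "v \<in> lists (letters A)" "a \<in> carrier (A i)" "b \<in> carrier (A i)"
  shows "word_product A (u @ (i, a) # (i, b) # v) = word_product A (u @ (i, a \<otimes>\<^bsub>A i\<^esub> b) # v)"
proof -
  have "(i, a) # (i, b) # v \<in> lists (letters A)" "(i, a \<otimes>\<^bsub>A i\<^esub> b) # v \<in> lists (letters A)"
    using assms(2-4) by (simp_all add: letters_def mult_closed)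
  then show ?thesis
    using assms by (simp add: word_product_append word_product_Cons letter_embed_mult letter_embed_closed
        word_product_closed P.m_assoc del: in_lists_conv_set)
qed

end

lemma not_distinct_adj_split:
  "\<not> distinct_adj xs \<Longrightarrow> \<exists>ys x zs. xs = ys @ x # x # zs"
proof (induction xs rule: induct_list012)
  case (3 x y zs)
  show ?case
  proof (cases "x = y")
    case True
    then show ?thesis by (intro exI[of _ "[]"]) auto
  next
    case False
    with 3 obtain ys w ws where "y # zs = ys @ w # w # ws" by auto
    then show ?thesis by (intro exI[of _ "x # ys"]) auto
  qed
qed auto

text \<open>These are the two ways of dealing with a position: the zero functional imposes no
  condition, while a unital one lets the letter be centered by subtracting a multiple of the
  unit.\<close>

lemma position_functional_cases:
  assumes "\<And>i. unital_linear_functional (A i) (\<chi> i)" "\<And>i. unital_linear_functional (A i) (\<psi> i)"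
    "\<And>i. unital_linear_functional (A i) (\<theta> i)"
  shows "position_functional \<chi> \<psi> \<theta> js k = (\<lambda>_. 0) \<or>
    unital_linear_functional (A (js ! k)) (position_functional \<chi> \<psi> \<theta> js k)"
  using assms by (simp add: position_functional_def)

text \<open>Two inductions are nested. The outer one is on the length of the word and also treats
  words that do not alternate, by multiplying two neighbours with the same index. The inner one is
  on the number \<open>j\<close> of leading positions that are not yet known to be centered.
  Centering a letter keeps the index sequence, so the functionals \<open>p\<close> stay the same
  throughout the inner induction.\<close>

lemma vanishes_on_centered_words_unique:
  fixes A :: "'i::linorder \<Rightarrow> ('a, 'm) star_algebra_scheme"
  assumes "star_algebra_family A"
    and \<chi>: "\<And>i. unital_linear_functional (A i) (\<chi> i)" and \<psi>: "\<And>i. unital_linear_functional (A i) (\<psi> i)"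
    and \<theta>: "\<And>i. unital_linear_functional (A i) (\<theta> i)"
    and f: "unital_linear_functional (free_product A) f" "vanishes_on_centered_words A \<chi> \<psi> \<theta> f"
    and g: "unital_linear_functional (free_product A) g" "vanishes_on_centered_words A \<chi> \<psi> \<theta> g"
    and x: "x \<in> carrier (free_product A)"
  shows "f x = g x"
proof -
  interpret star_algebra_family A by fact
  have "f (word_product A w) = g (word_product A w)" if "w \<in> lists (letters A)" for w
    using that
  proof (induction w rule: length_induct)
    case (1 w)
    have IH: "f (word_product A w') = g (word_product A w')"
      if "w' \<in> lists (letters A)" "length w' < length w" for w'
      using 1 that by blast
    consider "w = []" | "w \<noteq> []" "distinct_adj (map fst w)" | "\<not> distinct_adj (map fst w)" by blast
    then show ?case
    proof cases
      case 1
      then show ?thesis using f(1) g(1) by (simp add: unital_linear_functional_def word_product_Nil)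
    next
      case 3
      then obtain js i ks where "map fst w = js @ i # i # ks" using not_distinct_adj_split by blast
      then obtain u a b v where w: "w = u @ (i, a) # (i, b) # v"
        by (auto simp: map_eq_append_conv map_eq_Cons_conv)
      then have mem: "u \<in> lists (letters A)" "v \<in> lists (letters A)" "a \<in> carrier (A i)" "b \<in> carrier (A i)"
        using \<open>w \<in> lists (letters A)\<close> by (auto simp: letters_def)
      have "u @ (i, a \<otimes>\<^bsub>A i\<^esub> b) # v \<in> lists (letters A)" using mem by (auto simp: letters_def mult_closed)
      then show ?thesis unfolding w word_product_merge[OF mem] by (rule IH) (simp add: w)
    next
      case 2
      define js where "js = map fst w"
      define p where "p = position_functional \<chi> \<psi> \<theta> js"
      \<comment> \<open>For \<open>j = 0\<close> the word is centered and both functionals vanish on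
        it; for \<open>j = length js\<close> nothing is assumed about the letters.\<close>
      have partial: "f (word_product A v) = g (word_product A v)"
        if "j \<le> length js" "v \<in> lists (letters A)" "map fst v = js" "\<And>k. \<lbrakk>j \<le> k; k < length v\<rbrakk> \<Longrightarrow> p k (snd (v ! k)) = 0"
        for j v
        using that
      proof (induction j arbitrary: v)
        case 0
        have "v \<noteq> [] \<and> distinct_adj (map fst v) \<and>
            (\<forall>k<length v. position_functional \<chi> \<psi> \<theta> (map fst v) k (snd (v ! k)) = 0)"
          using 0 2 by (auto simp: js_def p_def)
        then show ?case using f(2) g(2) 0 unfolding vanishes_on_centered_words_def by metis
      next
        case (Suc j)
        have len: "length v = length js" using Suc.prems(3) by (metis length_map)
        have j: "j < length v" using Suc.prems(1) len by simp
        consider "p j = (\<lambda>_. 0)" | "unital_linear_functional (A (js ! j)) (p j)"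
          using position_functional_cases[of A \<chi> \<psi> \<theta>, OF \<chi> \<psi> \<theta>] unfolding p_def by blast
        then show ?case
        proof cases
          case 1
          have "p k (snd (v ! k)) = 0" if "j \<le> k" "k < length v" for k
            using 1 Suc.prems(4)[of k] that by (cases "k = j") auto
          then show ?thesis using Suc by (intro Suc.IH) auto
        next
          case 2
          define i where "i = js ! j"
          define a where "a = snd (v ! j)"
          define c where "c = p j a"
          define u where "u = take j v"
          define t where "t = drop (Suc j) v"
          \<comment> \<open>Since \<open>p j\<close> is unital, subtracting \<open>p j a\<close>
            times the unit puts the letter into its kernel.\<close>
          define b where "b = a \<oplus>\<^bsub>A i\<^esub> ((- c) \<odot>\<^bsub>A i\<^esub> \<one>\<^bsub>A i\<^esub>)"
          have vj: "v ! j = (i, a)"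
            using j Suc.prems(3) by (metis a_def i_def nth_map prod.collapse)
          have v: "v = u @ (i, a) # t" unfolding u_def t_def vj[symmetric] by (rule id_take_nth_drop[OF j])
          have mem: "u \<in> lists (letters A)" "t \<in> lists (letters A)" "a \<in> carrier (A i)"
            using Suc.prems(2) unfolding v by (auto simp: letters_def)
          have b: "b \<in> carrier (A i)" using mem by (simp add: b_def add_closed smult_closed one_closed)
          have lu: "length u = j" using j by (simp add: u_def)
          have pb: "p j b = 0"
            using 2 mem one_closed[of i] smult_closed[of _ i]
            by (simp add: unital_linear_functional_def b_def c_def i_def)
          have split: "F (word_product A v) = F (word_product A (u @ (i, b) # t)) + c * F (word_product A (u @ t))"
            if "unital_linear_functional (free_product A) F" for F
          proof -
            have "F (word_product A (u @ (i, b) # t)) = F (word_product A v) - c * F (word_product A (u @ t))"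
              using that mem unfolding v b_def
              by (simp add: functional_word_add functional_word_smult word_product_one smult_closed one_closed
                  del: in_lists_conv_set)
            then show ?thesis by simp
          qed
          have "f (word_product A (u @ (i, b) # t)) = g (word_product A (u @ (i, b) # t))"
          proof (rule Suc.IH)
            show "u @ (i, b) # t \<in> lists (letters A)" using mem b by (auto simp: letters_def)
            show "map fst (u @ (i, b) # t) = js" using Suc.prems(3) unfolding v by simp
            fix k assume k: "j \<le> k" "k < length (u @ (i, b) # t)"
            show "p k (snd ((u @ (i, b) # t) ! k)) = 0"
            proof (cases "k = j")
              case True
              then show ?thesis using pb lu by (simp add: nth_append)
            next
              case False
              with k Suc.prems(4)[of k] lu show ?thesis unfolding v by (simp add: nth_append nth_Cons')
            qed
          qed (use Suc.prems in simp)
          \<comment> \<open>Deleting a letter may bring equal indices together and changes peaks and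
            bottoms. This does no harm, since the outer hypothesis covers every shorter
            word.\<close>
          moreover have "f (word_product A (u @ t)) = g (word_product A (u @ t))"
            using mem len unfolding v by (intro IH) (simp_all add: js_def)
          ultimately show ?thesis unfolding split[OF f(1)] split[OF g(1)] by simp
        qed
      qed
      show ?thesis
        by (rule partial[OF order_refl \<open>w \<in> lists (letters A)\<close>]) (auto simp: js_def)
    qed
  qed
  then show ?thesis using functional_eqI[OF f(1) g(1)] x by blast
qed

section \<open>Operators on the free product space\<close>

lemma adjointable_operators_simps [simp]:
  "carrier (adjointable_operators H) = {T \<in> linear_maps H H. \<exists>S. is_adjoint H H T S}"
  "mult (adjointable_operators H) = compose (carrier H)"
  "one (adjointable_operators H) = (\<lambda>x\<in>carrier H. x)"
  "add (adjointable_operators H) = (\<lambda>S T. \<lambda>x\<in>carrier H. S x \<oplus>\<^bsub>H\<^esub> T x)"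
  "smult (adjointable_operators H) = (\<lambda>c T. \<lambda>x\<in>carrier H. c \<odot>\<^bsub>H\<^esub> T x)"
  "star (adjointable_operators H) = adjoint H H"
  by (simp_all add: adjointable_operators_def)

lemma is_adjoint_adjoint:
  assumes "pre_hilbert_space H" "T \<in> carrier (adjointable_operators H)"
  shows "is_adjoint H H T (adjoint H H T)"
  using assms adjoint_eqI by fastforce

lemma linear_maps_closed: "T \<in> linear_maps H K \<Longrightarrow> x \<in> carrier H \<Longrightarrow> T x \<in> carrier K"
  by (auto simp: linear_maps_def)

lemma linear_maps_compose:
  assumes "S \<in> linear_maps K L" "T \<in> linear_maps H K" "module complex_field H"
  shows "compose (carrier H) S T \<in> linear_maps H L"
proof -
  interpret module complex_field H by fact
  have "c \<odot>\<^bsub>H\<^esub> x \<in> carrier H" if "x \<in> carrier H" for c x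
    using that by (intro smult_closed) (simp_all add: complex_field_def)
  then show ?thesis
    using assms(1,2) by (auto simp: linear_maps_def compose_def PiE_iff)
qed

lemma linear_maps_span_of:
  assumes T: "T \<in> linear_maps (generated_space X k) (generated_space Y l)" and "S \<subseteq> X"
    and gen: "\<And>w. w \<in> S \<Longrightarrow> T (generator X k w) \<in> span_of Y l S'"
    and x: "x \<in> span_of X k S"
  shows "T x \<in> span_of Y l S'"
  using x
proof (induction rule: span_of_induct)
  case zero
  then show ?case
    using linear_maps_zero[OF T module_generated_space module_generated_space] by (simp add: zero_in_span_of)
next
  case (add c w y)
  have "w \<in> X" "y \<in> span_of X k X" using add assms(2) span_of_mono[OF assms(2), of X k] by blast+
  then show ?case
    using add gen by (simp add: linear_maps_combine[OF T] add_in_span_of smult_in_span_of)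
qed

section \<open>Star-representations and vector states\<close>

context pre_hilbert_space begin

lemma representation_star:
  assumes "unital_star_hom B (adjointable_operators H) \<tau>" "a \<in> carrier B" "x \<in> carrier H" "y \<in> carrier H"
  shows "ip H (\<tau> (star B a) y) x = ip H y (\<tau> a x)"
proof -
  have "\<tau> a \<in> carrier (adjointable_operators H)" and "\<tau> (star B a) = adjoint H H (\<tau> a)"
    using assms(1,2) by (auto simp: unital_star_hom_def ring_hom_def)
  with is_adjoint_adjoint[OF pre_hilbert_space_axioms] show ?thesis
    using assms(3,4) by (simp add: is_adjoint_def)
qed

lemma representation_closed:
  assumes "unital_star_hom B (adjointable_operators H) \<tau>" "a \<in> carrier B"
  shows "\<tau> a \<in> carrier (adjointable_operators H)"
  using assms by (auto simp: unital_star_hom_def ring_hom_def)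

end

text \<open>The value at the product of \<open>star a\<close> and \<open>a\<close> is the squared
  norm of \<open>J a \<xi>\<close>.\<close>

lemma vector_state:
  assumes "star_algebra_family A" "pre_hilbert_space H" "\<xi> \<in> carrier H" "ip H \<xi> \<xi> = 1"
    and J: "unital_star_hom (free_product A) (adjointable_operators H) J"
  shows "state (free_product A) (\<lambda>a. ip H \<xi> (J a \<xi>))"
proof -
  interpret A: star_algebra_family A by fact
  interpret H: pre_hilbert_space H by fact
  have closed: "J x \<xi> \<in> carrier H" if "x \<in> carrier (free_product A)" for x
    using H.representation_closed[OF J that] assms(3) by (auto intro: linear_maps_closed)
  have "unital_linear_functional (free_product A) (\<lambda>a. ip H \<xi> (J a \<xi>))"
    using J assms(3,4) closed H.ip_add_right H.ip_smult_right
    by (auto simp: unital_linear_functional_def unital_star_hom_def ring_hom_def)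
  moreover have "ip H \<xi> (J (star (free_product A) a \<otimes>\<^bsub>free_product A\<^esub> a) \<xi>) \<in> \<real>\<^sub>\<ge>\<^sub>0"
    if a: "a \<in> carrier (free_product A)" for a
  proof -
    let ?s = "star (free_product A) a"
    have s: "?s \<in> carrier (free_product A)" using a by (rule A.free_product_star_closed)
    have "ip H \<xi> (J (?s \<otimes>\<^bsub>free_product A\<^esub> a) \<xi>) = ip H \<xi> (J ?s (J a \<xi>))"
      using J a s assms(3) by (auto simp: unital_star_hom_def ring_hom_def compose_def)
    also have "\<dots> = cnj (ip H (J ?s (J a \<xi>)) \<xi>)"
      using H.representation_closed[OF J s] closed[OF a] assms(3)
      by (intro H.ip_commute) (auto intro: linear_maps_closed)
    also have "\<dots> = cnj (ip H (J a \<xi>) (J a \<xi>))"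
      using H.representation_star[OF J a assms(3) closed[OF a]] by simp
    also have "\<dots> = ip H (J a \<xi>) (J a \<xi>)"
      using H.ip_commute closed[OF a] by metis
    finally show ?thesis using H.ip_nonneg[OF closed[OF a]] by simp
  qed
  ultimately show ?thesis by (simp add: state_def)
qed

section \<open>Operators on binary tensor products\<close>

lemma tensor_apply:
  assumes "u \<in> carrier H" "v \<in> carrier K"
  shows "tensor H K f g (u, v) = ip H u f * ip K v g"
  using assms by (simp add: tensor_def generator_def tensor_kernel_def)

lemma tensor_closed:
  assumes "f \<in> carrier H" "g \<in> carrier K"
  shows "tensor H K f g \<in> carrier (tensor_space H K)"
  using assms by (simp add: tensor_def tensor_space_def generator_in_span_of)

text \<open>Adjointability of \<open>T\<close> enters here: if \<open>S\<close> is an adjoint of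
  \<open>T\<close>, then applying \<open>S\<close> to the first factor supplies the candidate
  adjoint required by the extension principle.\<close>

lemma tensor_operator_spec:
  assumes H: "pre_hilbert_space H" and K: "pre_hilbert_space K"
    and T: "T \<in> carrier (adjointable_operators H)"
  shows "tensor_operator H K T (\<lambda>x\<in>carrier K. x) \<in> linear_maps (tensor_space H K) (tensor_space H K)"
    and "\<lbrakk>f \<in> carrier H; g \<in> carrier K\<rbrakk> \<Longrightarrow>
      tensor_operator H K T (\<lambda>x\<in>carrier K. x) (tensor H K f g) = tensor H K (T f) g"
proof -
  interpret H: pre_hilbert_space H by fact
  interpret K: pre_hilbert_space K by fact
  let ?X = "carrier H \<times> carrier K" and ?k = "tensor_kernel H K" and ?I = "\<lambda>x\<in>carrier K. x"
  let ?P = "\<lambda>R. R \<in> linear_maps (tensor_space H K) (tensor_space H K) \<and>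
        (\<forall>f\<in>carrier H. \<forall>g\<in>carrier K. R (tensor H K f g) = tensor H K (T f) (?I g))"
  obtain S where S: "is_adjoint H H T S" using T by auto
  have Tc: "T f \<in> carrier H" if "f \<in> carrier H" for f using T that by (auto intro: linear_maps_closed)
  have Sc: "S f \<in> carrier H" if "f \<in> carrier H" for f using S that by (auto simp: is_adjoint_def intro: linear_maps_closed)
  have psd: "psd_kernel ?X ?k" by (rule psd_kernel_tensor[OF H K])
  have closed: "tensor H K (T' (fst p)) (snd p) \<in> span_of ?X ?k ?X"
    if "p \<in> ?X" "\<And>f. f \<in> carrier H \<Longrightarrow> T' f \<in> carrier H" for p T'
    using that tensor_closed[of "T' (fst p)" H "snd p" K] by (auto simp: tensor_space_def)
  have closed_T: "tensor H K (T (fst p)) (snd p) \<in> span_of ?X ?k ?X" if "p \<in> ?X" for p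
    using that Tc by (rule closed)
  have closed_S: "tensor H K (S (fst p)) (snd p) \<in> span_of ?X ?k ?X" if "p \<in> ?X" for p
    using that Sc by (rule closed)
  have compat: "tensor H K (S (fst p)) (snd p) w = cnj (tensor H K (T (fst w)) (snd w) p)"
    if "w \<in> ?X" "p \<in> ?X" for w p
  proof -
    obtain f g u v where wp: "w = (f, g)" "p = (u, v)" by (metis surj_pair)
    with that have mem: "f \<in> carrier H" "g \<in> carrier K" "u \<in> carrier H" "v \<in> carrier K" by auto
    have "ip H f (S u) = cnj (ip H u (T f))"
      using S mem H.ip_commute[OF Sc[OF mem(3)] mem(1)] by (simp add: is_adjoint_def)
    then show ?thesis using mem K.ip_commute[OF mem(4,2)] by (simp add: wp tensor_apply)
  qed
  obtain R where R: "R \<in> linear_maps (generated_space ?X ?k) (generated_space ?X ?k)"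
    "\<forall>w\<in>?X. R (generator ?X ?k w) = tensor H K (T (fst w)) (snd w)"
    using adjoint_pair_extension[OF psd psd closed_T closed_S compat] by blast
  have PR: "?P R" using R by (auto simp: tensor_space_def tensor_def)
  have "R' = R" if "?P R'" for R'
    using that R PR unfolding tensor_space_def
    by (intro linear_maps_generated_eqI[OF _ _ module_generated_space]) (auto simp: tensor_def)
  then have "tensor_operator H K T ?I = R"
    unfolding tensor_operator_def using PR by (intro the_equality)
  with PR show "tensor_operator H K T ?I \<in> linear_maps (tensor_space H K) (tensor_space H K)"
    and "\<lbrakk>f \<in> carrier H; g \<in> carrier K\<rbrakk> \<Longrightarrow> tensor_operator H K T ?I (tensor H K f g) = tensor H K (T f) g"
    by simp_all
qed

section \<open>The free product space and the operators \<open>lambda_op\<close>\<close>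

locale pointed_family =
  fixes Hs :: "'i \<Rightarrow> ('h, 'm) pre_hilbert_scheme" and \<xi>s :: "'i \<Rightarrow> 'h"
  assumes pointed: "\<And>i. pointed_pre_hilbert_space (Hs i) (\<xi>s i)"
begin

lemma pre_hilbert: "pre_hilbert_space (Hs i)" and \<xi>_closed: "\<xi>s i \<in> carrier (Hs i)"
  and \<xi>_unit: "ip (Hs i) (\<xi>s i) (\<xi>s i) = 1"
  using pointed by (auto simp: pointed_pre_hilbert_space_def)

sublocale W: psd_kernel "tensor_words Hs \<xi>s" "word_kernel Hs"
  by (rule psd_kernel_subset[OF psd_kernel_word[OF pre_hilbert]]) (auto simp: tensor_words_def centered_def)

abbreviation rest_words :: "'i \<Rightarrow> ('i \<times> 'h) list set" where
  "rest_words i \<equiv> {w \<in> tensor_words Hs \<xi>s. map fst w \<in> seqs_rest i}"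

lemma rest_space_eq:
  "rest_space Hs \<xi>s i = (generated_space (tensor_words Hs \<xi>s) (word_kernel Hs))
    \<lparr>carrier := span_of (tensor_words Hs \<xi>s) (word_kernel Hs) (rest_words i)\<rparr>"
  by (simp add: rest_space_def free_space_def summands_def)

lemma rest_space_simps [simp]:
  "carrier (rest_space Hs \<xi>s i) = span_of (tensor_words Hs \<xi>s) (word_kernel Hs) (rest_words i)"
  "ip (rest_space Hs \<xi>s i) = ip (generated_space (tensor_words Hs \<xi>s) (word_kernel Hs))"
  by (simp_all add: rest_space_eq)

lemma pre_hilbert_rest: "pre_hilbert_space (rest_space Hs \<xi>s i)"
  unfolding rest_space_eq by (rule W.pre_hilbert_space_span_of) auto

lemma pre_hilbert_free: "pre_hilbert_space (free_space Hs \<xi>s)"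
  unfolding free_space_def by (rule W.pre_hilbert_space_generated)

lemma module_free: "module complex_field (free_space Hs \<xi>s)"
  unfolding free_space_def by (rule module_generated_space)

lemma Nil_tensor_word: "[] \<in> tensor_words Hs \<xi>s"
  by (simp add: tensor_words_def)

lemma Cons_tensor_word:
  "(i, f) # w \<in> tensor_words Hs \<xi>s \<longleftrightarrow> f \<in> centered (Hs i) (\<xi>s i) \<and> w \<in> rest_words i"
  by (cases w) (auto simp: tensor_words_def seqs_rest_def)

lemma vacuum_closed: "vacuum Hs \<xi>s \<in> carrier (free_space Hs \<xi>s)"
  by (simp add: vacuum_def word_vector_def free_space_def generator_in_span_of Nil_tensor_word)

lemma vacuum_unit: "ip (free_space Hs \<xi>s) (vacuum Hs \<xi>s) (vacuum Hs \<xi>s) = 1"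
  using Nil_tensor_word
  by (simp add: vacuum_def word_vector_def free_space_def W.ip_generator generator_in_span_of
      generator_apply word_kernel_Nil)

text \<open>The orthogonal projection of \<open>Hs i\<close> onto the complement of the unit
  vector.\<close>

definition centering :: "'i \<Rightarrow> 'h \<Rightarrow> 'h" where
  "centering i h = h \<ominus>\<^bsub>Hs i\<^esub> (ip (Hs i) (\<xi>s i) h \<odot>\<^bsub>Hs i\<^esub> \<xi>s i)"

lemma
  assumes h: "h \<in> carrier (Hs i)"
  shows centering_centered: "centering i h \<in> centered (Hs i) (\<xi>s i)"
    and ip_centering: "f \<in> centered (Hs i) (\<xi>s i) \<Longrightarrow> ip (Hs i) f (centering i h) = ip (Hs i) f h"
proof -
  interpret pre_hilbert_space "Hs i" by (rule pre_hilbert)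
  have c: "c \<odot>\<^bsub>Hs i\<^esub> \<xi>s i \<in> carrier (Hs i)" for c
    by (intro smult_closed \<xi>_closed) (simp add: complex_field_def)
  show "centering i h \<in> centered (Hs i) (\<xi>s i)"
    using h c \<xi>_closed \<xi>_unit
    by (simp add: centered_def centering_def ip_minus_right ip_smult_right)
  show "ip (Hs i) f (centering i h) = ip (Hs i) f h" if "f \<in> centered (Hs i) (\<xi>s i)"
    using that h c \<xi>_closed ip_commute[of "\<xi>s i" f]
    by (simp add: centered_def centering_def ip_minus_right ip_smult_right)
qed

text \<open>The creation operator that prepends \<open>f\<close>, encoded through its inner products
  with the words. It thus makes sense for an arbitrary vector \<open>g\<close>, without choosing a
  representation of \<open>g\<close> as a combination of words.\<close>

definition creation :: "'i \<Rightarrow> 'h \<Rightarrow> ('i, 'h) fock_vector \<Rightarrow> ('i, 'h) fock_vector" where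
  "creation i f g = (\<lambda>w. case w of [] \<Rightarrow> 0 | (j, u) # v \<Rightarrow>
     if w \<in> tensor_words Hs \<xi>s \<and> j = i then ip (Hs i) u f * g v else 0)"

lemma creation_generator:
  assumes "f \<in> centered (Hs i) (\<xi>s i)" "w \<in> rest_words i"
  shows "creation i f (word_vector Hs \<xi>s w) = word_vector Hs \<xi>s ((i, f) # w)"
proof
  fix v show "creation i f (word_vector Hs \<xi>s w) v = word_vector Hs \<xi>s ((i, f) # w) v"
    by (cases v) (auto simp: creation_def word_vector_def generator_def word_kernel_Cons
        Cons_tensor_word word_kernel_eq_0)
qed

lemma creation_closed:
  assumes f: "f \<in> centered (Hs i) (\<xi>s i)" and g: "g \<in> carrier (rest_space Hs \<xi>s i)"
  shows "creation i f g \<in> carrier (free_space Hs \<xi>s)"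
  using g unfolding rest_space_simps free_space_def generated_space_simps
proof (induction rule: span_of_induct)
  case zero
  have "creation i f (\<lambda>v. 0) = (\<lambda>v. 0)" by (auto simp: creation_def split: list.split)
  then show ?case by (simp add: zero_in_span_of)
next
  case (add c w y)
  have "creation i f (\<lambda>v. c * word_vector Hs \<xi>s w v + y v)
      = (\<lambda>v. c * creation i f (word_vector Hs \<xi>s w) v + creation i f y v)"
    by (auto simp: creation_def algebra_simps split: list.split)
  moreover have "(i, f) # w \<in> tensor_words Hs \<xi>s" using f add by (simp add: Cons_tensor_word)
  ultimately show ?case
    using add creation_generator[OF f add(1)] unfolding word_vector_def
    by (simp add: add_in_span_of smult_in_span_of generator_in_span_of)
qed

text \<open>The value of \<open>U\<^sub>i\<^sup>*\<close> on \<open>h \<otimes> g\<close>.\<close>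

definition attach :: "'i \<Rightarrow> 'h \<Rightarrow> ('i, 'h) fock_vector \<Rightarrow> ('i, 'h) fock_vector" where
  "attach i h g = (\<lambda>w. ip (Hs i) (\<xi>s i) h * g w + creation i (centering i h) g w)"

lemma attach_closed:
  assumes "h \<in> carrier (Hs i)" "g \<in> carrier (rest_space Hs \<xi>s i)"
  shows "attach i h g \<in> carrier (free_space Hs \<xi>s)"
proof -
  have "g \<in> span_of (tensor_words Hs \<xi>s) (word_kernel Hs) (tensor_words Hs \<xi>s)"
    using assms(2) span_of_mono[of "rest_words i" "tensor_words Hs \<xi>s"] by auto
  then show ?thesis
    using creation_closed[OF centering_centered[OF assms(1)] assms(2)]
    by (simp add: attach_def free_space_def add_in_span_of smult_in_span_of)
qed

lemma U_on_word_closed: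
  assumes "w \<in> tensor_words Hs \<xi>s"
  shows "U_on_word Hs \<xi>s i w \<in> carrier (tensor_space (Hs i) (rest_space Hs \<xi>s i))"
proof (cases w)
  case Nil
  then show ?thesis
    using Nil_tensor_word by (auto simp: U_on_word_def vacuum_def word_vector_def seqs_rest_def
        intro!: tensor_closed \<xi>_closed generator_in_span_of)
next
  case (Cons p v)
  obtain j f where p: "p = (j, f)" by fastforce
  have "f \<in> carrier (Hs j)" "v \<in> rest_words j"
    using assms unfolding Cons p Cons_tensor_word by (auto simp: centered_def)
  moreover have "w \<in> rest_words i" if "j \<noteq> i" using assms that by (auto simp: Cons p seqs_rest_def)
  ultimately show ?thesis
    by (auto simp: U_on_word_def Cons p word_vector_def intro!: tensor_closed \<xi>_closed generator_in_span_of)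
qed

text \<open>This is the compatibility condition of the extension principle: \<open>attach\<close>
  and \<open>U_on_word\<close> are adjoint to each other on generators. A word beginning with
  \<open>i\<close> is seen only by the creation part, any other word only by the scalar
  part.\<close>

lemma attach_U_on_word:
  assumes w: "w \<in> tensor_words Hs \<xi>s" and h: "h \<in> carrier (Hs i)" and g: "g \<in> carrier (rest_space Hs \<xi>s i)"
  shows "attach i h g w = cnj (U_on_word Hs \<xi>s i w (h, g))"
proof -
  interpret Hi: pre_hilbert_space "Hs i" by (rule pre_hilbert)
  have gX: "g \<in> span_of (tensor_words Hs \<xi>s) (word_kernel Hs) (tensor_words Hs \<xi>s)"
    using g span_of_mono[of "rest_words i" "tensor_words Hs \<xi>s"] by auto
  have gw: "cnj (ip (rest_space Hs \<xi>s i) g (word_vector Hs \<xi>s v)) = g v" if "v \<in> tensor_words Hs \<xi>s" for v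
    using W.ip_span_commute[OF gX generator_in_span_of[OF that]] W.ip_generator[OF that gX]
    by (simp add: word_vector_def)
  have hx: "cnj (ip (Hs i) h f) = ip (Hs i) f h" if "f \<in> carrier (Hs i)" for f
    using Hi.ip_commute[OF h that] by simp
  show ?thesis
  proof (cases w)
    case Nil
    then show ?thesis
      using gw[OF Nil_tensor_word] hx[OF \<xi>_closed] h g
      by (simp add: U_on_word_def tensor_apply attach_def creation_def vacuum_def del: rest_space_simps)
  next
    case (Cons p v)
    obtain j f where p: "p = (j, f)" by fastforce
    have fv: "f \<in> centered (Hs j) (\<xi>s j)" "v \<in> tensor_words Hs \<xi>s"
      using w unfolding Cons p Cons_tensor_word by auto
    show ?thesis
    proof (cases "j = i")
      case True
      \<comment> \<open>The words generating H(i) do not begin with \<open>i\<close>, so their index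
        sequences differ from that of \<open>w\<close>.\<close>
      have "g w = 0"
        using g unfolding rest_space_simps
        by (rule span_of_vanishes) (auto intro!: word_kernel_eq_0 simp: Cons p True seqs_rest_def)
      moreover have "f \<in> carrier (Hs i)" using fv True by (simp add: centered_def)
      ultimately show ?thesis
        using gw[OF fv(2)] hx[of f] h g w fv True ip_centering[OF h, of f]
        by (simp add: U_on_word_def tensor_apply attach_def creation_def Cons p del: rest_space_simps)
    next
      case False
      then show ?thesis
        using gw[OF w] hx[OF \<xi>_closed] h g w
        by (simp add: U_on_word_def tensor_apply attach_def creation_def Cons p del: rest_space_simps)
    qed
  qed
qed

text \<open>A single application of the extension principle yields the canonical map together with
  its adjoint, so the adjoint is computed on simple tensors without inverting the map.\<close>

lemma
  shows canonical_U_linear: "canonical_U Hs \<xi>s i \<in> linear_maps (free_space Hs \<xi>s) (tensor_space (Hs i) (rest_space Hs \<xi>s i))"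
    and canonical_U_word: "w \<in> tensor_words Hs \<xi>s \<Longrightarrow> canonical_U Hs \<xi>s i (word_vector Hs \<xi>s w) = U_on_word Hs \<xi>s i w"
    and adjoint_U_linear: "adjoint (free_space Hs \<xi>s) (tensor_space (Hs i) (rest_space Hs \<xi>s i)) (canonical_U Hs \<xi>s i)
      \<in> linear_maps (tensor_space (Hs i) (rest_space Hs \<xi>s i)) (free_space Hs \<xi>s)"
    and adjoint_U_tensor: "\<lbrakk>h \<in> carrier (Hs i); g \<in> carrier (rest_space Hs \<xi>s i)\<rbrakk> \<Longrightarrow>
      adjoint (free_space Hs \<xi>s) (tensor_space (Hs i) (rest_space Hs \<xi>s i)) (canonical_U Hs \<xi>s i)
        (tensor (Hs i) (rest_space Hs \<xi>s i) h g) = attach i h g"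
proof -
  let ?X = "tensor_words Hs \<xi>s" and ?k = "word_kernel Hs"
  let ?Y = "carrier (Hs i) \<times> carrier (rest_space Hs \<xi>s i)"
  let ?l = "tensor_kernel (Hs i) (rest_space Hs \<xi>s i)"
  have psd: "psd_kernel ?Y ?l" by (rule psd_kernel_tensor[OF pre_hilbert pre_hilbert_rest])
  have closed: "U_on_word Hs \<xi>s i w \<in> span_of ?Y ?l ?Y" if "w \<in> ?X" for w
    using U_on_word_closed[OF that, of i] by (simp add: tensor_space_def)
  have closed': "attach i (fst p) (snd p) \<in> span_of ?X ?k ?X" if "p \<in> ?Y" for p
    using that attach_closed[of "fst p" i "snd p"] by (auto simp: free_space_def)
  have compat: "attach i (fst p) (snd p) w = cnj (U_on_word Hs \<xi>s i w p)" if "w \<in> ?X" "p \<in> ?Y" for w p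
    using attach_U_on_word[of w "fst p" i "snd p"] that by (simp add: mem_Times_iff del: rest_space_simps)
  obtain U S where US: "U \<in> linear_maps (generated_space ?X ?k) (generated_space ?Y ?l)"
    "is_adjoint (generated_space ?X ?k) (generated_space ?Y ?l) U S"
    "\<forall>w\<in>?X. U (generator ?X ?k w) = U_on_word Hs \<xi>s i w"
    "\<forall>p\<in>?Y. S (generator ?Y ?l p) = attach i (fst p) (snd p)"
    using adjoint_pair_extension[OF W.psd_kernel_axioms psd closed closed' compat] by blast
  let ?P = "\<lambda>U. U \<in> linear_maps (free_space Hs \<xi>s) (tensor_space (Hs i) (rest_space Hs \<xi>s i)) \<and>
        (\<forall>w\<in>tensor_words Hs \<xi>s. U (word_vector Hs \<xi>s w) = U_on_word Hs \<xi>s i w)"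
  have PU: "?P U" using US(1,3) by (simp add: free_space_def tensor_space_def word_vector_def)
  have "U' = U" if "?P U'" for U'
    using that PU unfolding free_space_def tensor_space_def word_vector_def
    by (intro linear_maps_generated_eqI[OF _ _ module_generated_space]) auto
  then have U: "canonical_U Hs \<xi>s i = U"
    unfolding canonical_U_def using PU by (intro the_equality)
  have S: "adjoint (free_space Hs \<xi>s) (tensor_space (Hs i) (rest_space Hs \<xi>s i)) U = S"
    using US(2) by (intro adjoint_eqI pre_hilbert_free) (simp add: free_space_def tensor_space_def)
  show "canonical_U Hs \<xi>s i \<in> linear_maps (free_space Hs \<xi>s) (tensor_space (Hs i) (rest_space Hs \<xi>s i))"
    "w \<in> tensor_words Hs \<xi>s \<Longrightarrow> canonical_U Hs \<xi>s i (word_vector Hs \<xi>s w) = U_on_word Hs \<xi>s i w"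
    using PU unfolding U by simp_all
  show "adjoint (free_space Hs \<xi>s) (tensor_space (Hs i) (rest_space Hs \<xi>s i)) (canonical_U Hs \<xi>s i)
      \<in> linear_maps (tensor_space (Hs i) (rest_space Hs \<xi>s i)) (free_space Hs \<xi>s)"
    using US(2) unfolding U S by (simp add: is_adjoint_def free_space_def tensor_space_def)
  show "adjoint (free_space Hs \<xi>s) (tensor_space (Hs i) (rest_space Hs \<xi>s i)) (canonical_U Hs \<xi>s i)
        (tensor (Hs i) (rest_space Hs \<xi>s i) h g) = attach i h g"
    if "h \<in> carrier (Hs i)" "g \<in> carrier (rest_space Hs \<xi>s i)"
    using US(4)[THEN bspec, of "(h, g)"] that unfolding U S by (simp add: tensor_def)
qed

lemma lambda_op_linear:
  assumes "T \<in> carrier (adjointable_operators (Hs i))"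
  shows "lambda_op Hs \<xi>s i T \<in> linear_maps (free_space Hs \<xi>s) (free_space Hs \<xi>s)"
  unfolding lambda_op_def Let_def
  by (intro linear_maps_compose[OF adjoint_U_linear] linear_maps_compose[OF _ canonical_U_linear]
      tensor_operator_spec(1) pre_hilbert pre_hilbert_rest assms module_free)

text \<open>For a word not beginning with \<open>i\<close>, the empty one included, the canonical
  map puts the unit vector in front, \<open>T\<close> acts on it, and \<open>attach\<close> splits
  the result into its multiple of the unit vector and its centered part. Words beginning with
  \<open>i\<close> never meet an operator of index \<open>i\<close> in the main argument.\<close>

lemma lambda_op_word:
  assumes T: "T \<in> carrier (adjointable_operators (Hs i))" and w: "w \<in> rest_words i"
  shows "lambda_op Hs \<xi>s i T (word_vector Hs \<xi>s w)
    = (\<lambda>v. ip (Hs i) (\<xi>s i) (T (\<xi>s i)) * word_vector Hs \<xi>s w v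
        + word_vector Hs \<xi>s ((i, centering i (T (\<xi>s i))) # w) v)"
proof -
  have wX: "w \<in> tensor_words Hs \<xi>s" using w by simp
  have T\<xi>: "T (\<xi>s i) \<in> carrier (Hs i)" using T \<xi>_closed by (auto intro: linear_maps_closed)
  have U: "U_on_word Hs \<xi>s i w = tensor (Hs i) (rest_space Hs \<xi>s i) (\<xi>s i) (word_vector Hs \<xi>s w)"
    using w by (cases w) (auto simp: U_on_word_def vacuum_def seqs_rest_def)
  have wr: "word_vector Hs \<xi>s w \<in> carrier (rest_space Hs \<xi>s i)"
    using w by (simp add: word_vector_def generator_in_span_of)
  have wf: "word_vector Hs \<xi>s w \<in> carrier (free_space Hs \<xi>s)"
    using wX by (simp add: word_vector_def free_space_def generator_in_span_of)
  have "lambda_op Hs \<xi>s i T (word_vector Hs \<xi>s w) = attach i (T (\<xi>s i)) (word_vector Hs \<xi>s w)"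
    unfolding lambda_op_def Let_def
    by (simp only: compose_eq[OF wf] canonical_U_word[OF wX] U
        tensor_operator_spec(2)[OF pre_hilbert pre_hilbert_rest T \<xi>_closed wr] adjoint_U_tensor[OF T\<xi> wr])
  also have "creation i (centering i (T (\<xi>s i))) (word_vector Hs \<xi>s w)
      = word_vector Hs \<xi>s ((i, centering i (T (\<xi>s i))) # w)"
    by (rule creation_generator[OF centering_centered[OF T\<xi>] w])
  then have "attach i (T (\<xi>s i)) (word_vector Hs \<xi>s w)
    = (\<lambda>v. ip (Hs i) (\<xi>s i) (T (\<xi>s i)) * word_vector Hs \<xi>s w v
        + word_vector Hs \<xi>s ((i, centering i (T (\<xi>s i))) # w) v)"
    by (simp add: attach_def)
  finally show ?thesis .
qed

text \<open>A word vector either lies in the sum of summands or is orthogonal to it, so the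
  candidate is the vector itself or zero. The remaining work is to show that the definite
  description in \<open>orth_proj\<close> has only this solution.\<close>

lemma proj_word:
  assumes w: "w \<in> tensor_words Hs \<xi>s"
  shows "proj Hs \<xi>s S (word_vector Hs \<xi>s w) = (if map fst w \<in> S then word_vector Hs \<xi>s w else (\<lambda>v. 0))"
proof -
  let ?X = "tensor_words Hs \<xi>s" and ?k = "word_kernel Hs"
  let ?H = "generated_space ?X ?k" and ?K = "summands Hs \<xi>s S"
  interpret H: pre_hilbert_space ?H by (rule W.pre_hilbert_space_generated)
  define x where "x = generator ?X ?k w"
  have x: "x \<in> carrier ?H" using w by (simp add: x_def generator_in_span_of)
  have sub: "z \<in> carrier ?H" if "z \<in> ?K" for z
    using that span_of_mono[of "{w \<in> ?X. map fst w \<in> S}" ?X ?X ?k] by (auto simp: summands_def)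
  let ?y = "if map fst w \<in> S then x else (\<lambda>v. 0)"
  have "(THE y. y \<in> ?K \<and> (\<forall>z\<in>?K. ip ?H z (x \<ominus>\<^bsub>?H\<^esub> y) = 0)) = ?y"
  proof (rule the_equality, intro conjI ballI)
    show y: "?y \<in> ?K" using w by (auto simp: summands_def x_def intro: generator_in_span_of zero_in_span_of)
    show "ip ?H z (x \<ominus>\<^bsub>?H\<^esub> ?y) = 0" if z: "z \<in> ?K" for z
    proof (cases "map fst w \<in> S")
      case True
      then show ?thesis using x sub[OF z] by (simp add: H.ip_minus_right del: generated_space_simps)
    next
      case False
      have "z w = 0"
        using z unfolding summands_def
        by (rule span_of_vanishes) (use False in \<open>auto intro: word_kernel_eq_0\<close>)
      moreover have "ip ?H z x = cnj (z w)"
        using W.ip_span_commute[of x z] W.ip_generator[OF w, of z] x sub[OF z] by (simp add: x_def)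
      ultimately show ?thesis
        using False x sub[OF z] sub[OF y] H.ip_zero_right[OF sub[OF z]] by (simp add: H.ip_minus_right)
    qed
    fix y' assume y': "y' \<in> ?K \<and> (\<forall>z\<in>?K. ip ?H z (x \<ominus>\<^bsub>?H\<^esub> y') = 0)"
    \<comment> \<open>The difference of two solutions lies in the subspace and is orthogonal to all
      of it, in particular to itself.\<close>
    define d where "d = (\<lambda>v. y' v + - 1 * ?y v)"
    have d: "d \<in> ?K"
      using y y' unfolding d_def summands_def by (intro add_in_span_of smult_in_span_of) auto
    have deq: "d = y' \<ominus>\<^bsub>?H\<^esub> ?y"
      using sub[OF y] sub[of y'] y' by (simp add: d_def generated_space_minus)
    have "ip ?H d x - ip ?H d y' = 0"
      using y' d sub[OF d] sub[of y'] x H.ip_minus_right[of d x y'] by simp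
    moreover have "ip ?H d x - ip ?H d ?y = 0"
      using \<open>\<And>z. z \<in> ?K \<Longrightarrow> ip ?H z (x \<ominus>\<^bsub>?H\<^esub> ?y) = 0\<close>[OF d]
        H.ip_minus_right[OF sub[OF d] x sub[OF y]] by simp
    ultimately have "ip ?H d d = 0"
      using H.ip_minus_right[OF sub[OF d] sub[of y'] sub[OF y]] y' unfolding deq[symmetric] by simp
    then have "d = (\<lambda>v. 0)" using H.ip_definite[OF sub[OF d]] by simp
    then have "y' v = ?y v" for v unfolding d_def by (drule_tac fun_cong[of _ _ v]) simp
    then show "y' = ?y" by blast
  qed
  then show ?thesis
    using x unfolding orth_proj_def free_space_def word_vector_def x_def by simp
qed

end

section \<open>Values of the three representations on word vectors\<close>

context pointed_family begin

lemma lambda_op_zero: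
  assumes "T \<in> carrier (adjointable_operators (Hs i))"
  shows "lambda_op Hs \<xi>s i T (\<lambda>v. 0) = (\<lambda>v. 0)"
  using linear_maps_zero[OF lambda_op_linear[OF assms] module_free module_free]
  by (simp add: free_space_def)

lemma adjointable_mult_proj_word:
  assumes "T \<in> carrier (adjointable_operators (Hs i))" "w \<in> tensor_words Hs \<xi>s"
  shows "(lambda_op Hs \<xi>s i T \<otimes>\<^bsub>adjointable_operators (free_space Hs \<xi>s)\<^esub> proj Hs \<xi>s S) (word_vector Hs \<xi>s w)
    = (if map fst w \<in> S then lambda_op Hs \<xi>s i T (word_vector Hs \<xi>s w) else (\<lambda>v. 0))"
proof -
  have "word_vector Hs \<xi>s w \<in> carrier (free_space Hs \<xi>s)"
    using assms(2) by (simp add: word_vector_def free_space_def generator_in_span_of)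
  then show ?thesis using assms by (simp add: compose_eq proj_word lambda_op_zero)
qed

end

lemma seqs_mem:
  fixes i :: "'i::linorder"
  shows "[] \<in> seqs_H i" "[] \<notin> seqs_B i" "[] \<notin> seqs_C i"
    and "j < i \<Longrightarrow> j # js \<notin> seqs_H i" "j < i \<Longrightarrow> j # js \<in> seqs_B i" "j < i \<Longrightarrow> j # js \<notin> seqs_C i"
    and "i < j \<Longrightarrow> j # js \<notin> seqs_H i" "i < j \<Longrightarrow> j # js \<notin> seqs_B i" "i < j \<Longrightarrow> j # js \<in> seqs_C i"
  by (auto simp: seqs_H_def seqs_B_def seqs_C_def)

text \<open>For a word not beginning with \<open>i\<close>, exactly one of the projections in each
  formula keeps it and the others annihilate it. A smaller first index places the word in B(i), a
  larger one in C(i); only at the vacuum do the three constructions differ.\<close>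

lemma J_values:
  fixes Hs :: "'i::linorder \<Rightarrow> ('h, 'm) pre_hilbert_scheme"
  assumes "pointed_family Hs \<xi>s" and w: "w \<in> tensor_words Hs \<xi>s"
    and \<pi>: "\<pi> i a \<in> carrier (adjointable_operators (Hs i))"
    and \<sigma>: "\<sigma> i a \<in> carrier (adjointable_operators (Hs i))"
    and \<rho>: "\<rho> i a \<in> carrier (adjointable_operators (Hs i))"
  defines "js \<equiv> map fst w" and "x \<equiv> word_vector Hs \<xi>s w"
  shows "js = [] \<Longrightarrow> J_alpha Hs \<xi>s \<pi> \<sigma> \<rho> i a x = lambda_op Hs \<xi>s i (\<pi> i a) x"
    and "js = [] \<Longrightarrow> J_beta Hs \<xi>s \<sigma> \<rho> i a x = lambda_op Hs \<xi>s i (\<sigma> i a) x"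
    and "js = [] \<Longrightarrow> J_gamma Hs \<xi>s \<sigma> \<rho> i a x = lambda_op Hs \<xi>s i (\<rho> i a) x"
    and "\<lbrakk>js \<noteq> []; hd js < i\<rbrakk> \<Longrightarrow> J_alpha Hs \<xi>s \<pi> \<sigma> \<rho> i a x = lambda_op Hs \<xi>s i (\<sigma> i a) x"
    and "\<lbrakk>js \<noteq> []; hd js < i\<rbrakk> \<Longrightarrow> J_beta Hs \<xi>s \<sigma> \<rho> i a x = lambda_op Hs \<xi>s i (\<sigma> i a) x"
    and "\<lbrakk>js \<noteq> []; hd js < i\<rbrakk> \<Longrightarrow> J_gamma Hs \<xi>s \<sigma> \<rho> i a x = lambda_op Hs \<xi>s i (\<sigma> i a) x"
    and "\<lbrakk>js \<noteq> []; hd js > i\<rbrakk> \<Longrightarrow> J_alpha Hs \<xi>s \<pi> \<sigma> \<rho> i a x = lambda_op Hs \<xi>s i (\<rho> i a) x"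
    and "\<lbrakk>js \<noteq> []; hd js > i\<rbrakk> \<Longrightarrow> J_beta Hs \<xi>s \<sigma> \<rho> i a x = lambda_op Hs \<xi>s i (\<rho> i a) x"
    and "\<lbrakk>js \<noteq> []; hd js > i\<rbrakk> \<Longrightarrow> J_gamma Hs \<xi>s \<sigma> \<rho> i a x = lambda_op Hs \<xi>s i (\<rho> i a) x"
proof -
  interpret pointed_family Hs \<xi>s by fact
  let ?L = "adjointable_operators (free_space Hs \<xi>s)"
  have x: "x \<in> carrier (free_space Hs \<xi>s)"
    using w by (simp add: x_def word_vector_def free_space_def generator_in_span_of)
  have add: "(S \<oplus>\<^bsub>?L\<^esub> T) x = (\<lambda>v. S x v + T x v)" for S T
    using x by (simp add: free_space_def)
  note vals = adjointable_mult_proj_word[OF \<pi> w, folded x_def js_def]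
    adjointable_mult_proj_word[OF \<sigma> w, folded x_def js_def]
    adjointable_mult_proj_word[OF \<rho> w, folded x_def js_def]
  note unfold = J_alpha_def J_beta_def J_gamma_def Let_def add vals
  show "js = [] \<Longrightarrow> J_alpha Hs \<xi>s \<pi> \<sigma> \<rho> i a x = lambda_op Hs \<xi>s i (\<pi> i a) x"
    "js = [] \<Longrightarrow> J_beta Hs \<xi>s \<sigma> \<rho> i a x = lambda_op Hs \<xi>s i (\<sigma> i a) x"
    "js = [] \<Longrightarrow> J_gamma Hs \<xi>s \<sigma> \<rho> i a x = lambda_op Hs \<xi>s i (\<rho> i a) x"
    unfolding unfold by (simp_all add: seqs_mem)
  show "\<lbrakk>js \<noteq> []; hd js < i\<rbrakk> \<Longrightarrow> J_alpha Hs \<xi>s \<pi> \<sigma> \<rho> i a x = lambda_op Hs \<xi>s i (\<sigma> i a) x"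
    "\<lbrakk>js \<noteq> []; hd js < i\<rbrakk> \<Longrightarrow> J_beta Hs \<xi>s \<sigma> \<rho> i a x = lambda_op Hs \<xi>s i (\<sigma> i a) x"
    "\<lbrakk>js \<noteq> []; hd js < i\<rbrakk> \<Longrightarrow> J_gamma Hs \<xi>s \<sigma> \<rho> i a x = lambda_op Hs \<xi>s i (\<sigma> i a) x"
    "\<lbrakk>js \<noteq> []; hd js > i\<rbrakk> \<Longrightarrow> J_alpha Hs \<xi>s \<pi> \<sigma> \<rho> i a x = lambda_op Hs \<xi>s i (\<rho> i a) x"
    "\<lbrakk>js \<noteq> []; hd js > i\<rbrakk> \<Longrightarrow> J_beta Hs \<xi>s \<sigma> \<rho> i a x = lambda_op Hs \<xi>s i (\<rho> i a) x"
    "\<lbrakk>js \<noteq> []; hd js > i\<rbrakk> \<Longrightarrow> J_gamma Hs \<xi>s \<sigma> \<rho> i a x = lambda_op Hs \<xi>s i (\<rho> i a) x"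
    unfolding unfold by (cases js; simp add: seqs_mem)+
qed

text \<open>Moving a factor to the left argument replaces it by its star. The functionals are
  conjugated by this, so centered letters stay centered.\<close>

lemma functional_star:
  assumes "pre_hilbert_space H" "\<xi> \<in> carrier H"
    and \<tau>: "unital_star_hom B (adjointable_operators H) \<tau>" and a: "a \<in> carrier B" and star: "star B a \<in> carrier B"
  shows "ip H \<xi> (\<tau> (star B a) \<xi>) = cnj (ip H \<xi> (\<tau> a \<xi>))"
proof -
  interpret pre_hilbert_space H by fact
  have "\<tau> (star B a) \<xi> \<in> carrier H"
    using representation_closed[OF \<tau> star] assms(2) by (auto intro: linear_maps_closed)
  then have "ip H \<xi> (\<tau> (star B a) \<xi>) = cnj (ip H (\<tau> (star B a) \<xi>) \<xi>)"
    using assms(2) by (intro ip_commute)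
  then show ?thesis using representation_star[OF \<tau> a assms(2) assms(2)] by simp
qed

text \<open>
  Moving the factors of a centered word one by one to the left argument of the inner product
  produces vectors orthogonal to the vacuum: along an ascent of the index sequence they stay in
  summands whose first index is at most the last index read, so that the next factor acts through
  \<open>\<sigma>\<close>; along a descent the first index is at least the last index read and the next factor acts
  through \<open>\<rho>\<close>.  Only a change of direction forces the first index to equal the last index read, and
  there the kernel condition at peaks and bottoms removes the other component.
\<close>

lemma vacuum_state_vanishes:
  fixes A :: "'i::linorder \<Rightarrow> ('a, 'm) star_algebra_scheme"
    and Hs :: "'i \<Rightarrow> ('h, 'n) pre_hilbert_scheme"
  assumes "star_algebra_family A" "pointed_family Hs \<xi>s"
    and \<tau>: "\<And>i. unital_star_hom (A i) (adjointable_operators (Hs i)) (\<tau> i)"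
    and \<sigma>: "\<And>i. unital_star_hom (A i) (adjointable_operators (Hs i)) (\<sigma> i)"
    and \<rho>: "\<And>i. unital_star_hom (A i) (adjointable_operators (Hs i)) (\<rho> i)"
    and \<chi>s: "\<And>i a. a \<in> carrier (A i) \<Longrightarrow> \<chi>s i a = ip (Hs i) (\<xi>s i) (\<tau> i a (\<xi>s i))"
    and \<psi>s: "\<And>i a. a \<in> carrier (A i) \<Longrightarrow> \<psi>s i a = ip (Hs i) (\<xi>s i) (\<sigma> i a (\<xi>s i))"
    and \<theta>s: "\<And>i a. a \<in> carrier (A i) \<Longrightarrow> \<theta>s i a = ip (Hs i) (\<xi>s i) (\<rho> i a (\<xi>s i))"
    and J: "unital_star_hom (free_product A) (adjointable_operators (free_space Hs \<xi>s)) J"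
    and J_Nil: "\<And>i a. a \<in> carrier (A i) \<Longrightarrow>
      J (letter_embed A i a) (word_vector Hs \<xi>s []) = lambda_op Hs \<xi>s i (\<tau> i a) (word_vector Hs \<xi>s [])"
    and J_less: "\<And>i a w. \<lbrakk>a \<in> carrier (A i); w \<in> tensor_words Hs \<xi>s; w \<noteq> []; fst (hd w) < i\<rbrakk> \<Longrightarrow>
      J (letter_embed A i a) (word_vector Hs \<xi>s w) = lambda_op Hs \<xi>s i (\<sigma> i a) (word_vector Hs \<xi>s w)"
    and J_greater: "\<And>i a w. \<lbrakk>a \<in> carrier (A i); w \<in> tensor_words Hs \<xi>s; w \<noteq> []; fst (hd w) > i\<rbrakk> \<Longrightarrow>
      J (letter_embed A i a) (word_vector Hs \<xi>s w) = lambda_op Hs \<xi>s i (\<rho> i a) (word_vector Hs \<xi>s w)"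
  shows "vanishes_on_centered_words A \<chi>s \<psi>s \<theta>s
    (\<lambda>a. ip (free_space Hs \<xi>s) (vacuum Hs \<xi>s) (J a (vacuum Hs \<xi>s)))"
proof -
  interpret A: star_algebra_family A by fact
  interpret pointed_family Hs \<xi>s by fact
  let ?H = "free_space Hs \<xi>s" and ?X = "tensor_words Hs \<xi>s" and ?k = "word_kernel Hs"
  let ?\<Omega> = "vacuum Hs \<xi>s"
  interpret H: pre_hilbert_space ?H by (rule pre_hilbert_free)
  have Jc: "J y \<in> carrier (adjointable_operators ?H)" if "y \<in> carrier (free_product A)" for y
    using H.representation_closed[OF J that] .
  have Jv: "J y x \<in> carrier ?H" if "y \<in> carrier (free_product A)" "x \<in> carrier ?H" for x y
    using Jc[OF that(1)] linear_maps_closed[OF _ that(2), of "J y" "?H"] by simp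
  \<comment> \<open>The adjoint of the operator of a letter. Since \<open>fold\<close> reads the
    word from its beginning, the first letter acts on the vacuum first.\<close>
  define push where "push = (\<lambda>(i, a) x. J (letter_embed A i (star (A i) a)) x)"
  have push_closed: "push l x \<in> carrier ?H" if "l \<in> letters A" "x \<in> carrier ?H" for l x
    using that by (auto simp: push_def letters_def intro!: Jv A.letter_embed_closed A.star_closed)
  have shift: "ip ?H x (J (word_product A w) ?\<Omega>) = ip ?H (fold push w x) ?\<Omega>"
    if "w \<in> lists (letters A)" "x \<in> carrier ?H" for w x
    using that
  proof (induction w arbitrary: x rule: list.induct)
    case Nil
    have "J (word_product A []) ?\<Omega> = ?\<Omega>"
      using J vacuum_closed by (simp add: A.word_product_Nil unital_star_hom_def ring_hom_def)
    then show ?case by simp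
  next
    case (Cons l w)
    obtain i a where l: "l = (i, a)" by fastforce
    with Cons.prems have mem: "a \<in> carrier (A i)" "w \<in> lists (letters A)" "l \<in> letters A"
      by (auto simp: letters_def)
    have e: "letter_embed A i a \<in> carrier (free_product A)" by (rule A.letter_embed_closed[OF mem(1)])
    have wp: "word_product A w \<in> carrier (free_product A)" by (rule A.word_product_closed[OF mem(2)])
    let ?y = "J (word_product A w) ?\<Omega>"
    have y: "?y \<in> carrier ?H" using wp vacuum_closed by (rule Jv)
    have "ip ?H x (J (word_product A (l # w)) ?\<Omega>) = ip ?H x (J (letter_embed A i a) ?y)"
      using J e wp vacuum_closed
      by (simp add: l A.word_product_Cons unital_star_hom_def ring_hom_def compose_eq)
    also have "\<dots> = ip ?H (push l x) ?y"
      using H.representation_star[OF J e y Cons.prems(2)] A.letter_embed_star[OF mem(1)]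
      by (simp add: push_def l)
    also have "\<dots> = ip ?H (fold push w (push l x)) ?\<Omega>"
      by (rule Cons.IH[OF mem(2) push_closed[OF mem(3) Cons.prems(2)]])
    finally show ?case by simp
  qed
  have "ip ?H ?\<Omega> (J (word_product A w) ?\<Omega>) = 0"
    if w: "w \<in> lists (letters A)" "w \<noteq> []" and adj: "distinct_adj (map fst w)"
      and cent: "\<And>k. k < length w \<Longrightarrow> position_functional \<chi>s \<psi>s \<theta>s (map fst w) k (snd (w ! k)) = 0" for w
  proof -
    define js where "js = map fst w"
    define a where "a k = star (A (js ! k)) (snd (w ! k))" for k
    define n where "n = length w"
    have len: "length js = n" by (simp add: js_def n_def)
    have wk: "snd (w ! k) \<in> carrier (A (js ! k))" if "k < n" for k
      using w(1) that nth_mem[of k w] by (fastforce simp: letters_def js_def n_def lists_eq_set)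
    have ac: "a k \<in> carrier (A (js ! k))" if "k < n" for k
      unfolding a_def by (rule A.star_closed[OF wk[OF that]])
    have adj': "js ! k \<noteq> js ! Suc k" if "Suc k < n" for k
      using adj that by (auto simp: js_def n_def distinct_adj_conv_nth)
    have coeff: "ip (Hs i) (\<xi>s i) (\<upsilon> i (a k) (\<xi>s i)) = cnj (ip (Hs i) (\<xi>s i) (\<upsilon> i (snd (w ! k)) (\<xi>s i)))"
      if "k < n" "i = js ! k" "\<And>i. unital_star_hom (A i) (adjointable_operators (Hs i)) (\<upsilon> i)" for k i \<upsilon>
      using functional_star[OF pre_hilbert \<xi>_closed that(3) wk[OF that(1)]] ac[OF that(1)]
      by (simp add: a_def that(2))
    have step: "fold push (take (Suc k) w) x = J (letter_embed A (js ! k) (a k)) (fold push (take k w) x)"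
      if "k < n" for k x
      using that by (simp add: take_Suc_conv_app_nth n_def push_def a_def js_def split: prod.split)
    have opc: "\<upsilon> i b \<in> carrier (adjointable_operators (Hs i))"
      if "b \<in> carrier (A i)" "\<And>i. unital_star_hom (A i) (adjointable_operators (Hs i)) (\<upsilon> i)" for \<upsilon> i b
      using pre_hilbert_space.representation_closed[OF pre_hilbert that(2,1)] .
    have opv: "centering i (\<upsilon> i b (\<xi>s i)) \<in> centered (Hs i) (\<xi>s i)"
      if "b \<in> carrier (A i)" "\<And>i. unital_star_hom (A i) (adjointable_operators (Hs i)) (\<upsilon> i)" for \<upsilon> i b
      using opc[of b i \<upsilon>, OF that] by (intro centering_centered) (auto intro: linear_maps_closed \<xi>_closed)
    \<comment> \<open>The words allowed after \<open>k\<close> letters have been read: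
      \<open>js ! (k - 1)\<close> is the last index read and \<open>js ! k\<close> the next one. The
      inequalities are weak because a freshly prepended letter has exactly the last index read.
      After the whole word, \<open>k = n\<close>, only nonemptiness is left.\<close>
    define G where "G k = {v \<in> ?X. v \<noteq> [] \<and> (k < n \<longrightarrow>
      (js ! (k - 1) < js ! k \<longrightarrow> fst (hd v) \<le> js ! (k - 1)) \<and>
      (js ! (k - 1) > js ! k \<longrightarrow> fst (hd v) \<ge> js ! (k - 1)))}" for k
    have "fold push (take k w) ?\<Omega> \<in> span_of ?X ?k (G k)" if "1 \<le> k" "k \<le> n" for k
      using that
    proof (induction k rule: nat_induct_at_least)
      case base
      let ?i = "js ! 0" and ?h = "\<tau> (js ! 0) (a 0) (\<xi>s (js ! 0))"
      have n: "0 < n" using w(2) by (simp add: n_def)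
      have Nil: "[] \<in> rest_words ?i" by (simp add: Nil_tensor_word seqs_rest_def)
      have "\<chi>s ?i (snd (w ! 0)) = 0"
        using cent[of 0] n by (simp add: position_functional_def js_def n_def)
      then have zero: "ip (Hs ?i) (\<xi>s ?i) ?h = 0"
        using coeff[OF n refl, of \<tau>] \<tau> \<chi>s[OF wk[OF n]] by simp
      have "fold push (take 1 w) ?\<Omega> = lambda_op Hs \<xi>s ?i (\<tau> ?i (a 0)) (word_vector Hs \<xi>s [])"
        using step[OF n, of ?\<Omega>] J_Nil[OF ac[OF n]] by (simp add: vacuum_def)
      also have "\<dots> = word_vector Hs \<xi>s [(?i, centering ?i ?h)]"
        unfolding lambda_op_word[OF opc[OF ac[OF n] \<tau>] Nil] zero by simp
      also have "\<dots> \<in> span_of ?X ?k (G 1)"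
        unfolding word_vector_def using opv[OF ac[OF n] \<tau>] Nil
        by (intro generator_in_span_of) (simp add: G_def Cons_tensor_word)
      finally show ?case .
    next
      case (Suc k)
      have k: "k < n" "1 \<le> k" using Suc.prems Suc.hyps by simp_all
      let ?i = "js ! k"
      have ne: "js ! (k - 1) \<noteq> ?i" using adj'[of "k - 1"] k by simp
      have lin: "J (letter_embed A ?i (a k)) \<in> linear_maps (generated_space ?X ?k) (generated_space ?X ?k)"
        using Jc[OF A.letter_embed_closed[OF ac[OF k(1)]]] by (simp add: free_space_def)
      have GX: "G k \<subseteq> ?X" by (auto simp: G_def)
      \<comment> \<open>The prepended word begins with the last index read and is therefore allowed
        whatever comes next. Only the unchanged word \<open>v\<close> can fail, and then its
        coefficient must be zero.\<close>
      have one: "(\<lambda>u. s * word_vector Hs \<xi>s v u + word_vector Hs \<xi>s ((?i, f) # v) u) \<in> span_of ?X ?k (G (Suc k))"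
        if v: "v \<in> G k" "fst (hd v) \<noteq> ?i" "f \<in> centered (Hs ?i) (\<xi>s ?i)"
          and s: "s = 0 \<or> v \<in> G (Suc k)" for s v f
      proof -
        have "v \<in> rest_words ?i" using v by (cases v) (auto simp: G_def seqs_rest_def)
        then have "(?i, f) # v \<in> G (Suc k)" using v by (simp add: G_def Cons_tensor_word)
        then show ?thesis
          using s unfolding word_vector_def
          by (elim disjE) (simp_all add: add_in_span_of smult_in_span_of generator_in_span_of)
      qed
      have gen: "J (letter_embed A ?i (a k)) (generator ?X ?k v) \<in> span_of ?X ?k (G (Suc k))" if v: "v \<in> G k" for v
      proof (cases "js ! (k - 1) < ?i")
        case True
        have hv: "fst (hd v) \<le> js ! (k - 1)" "v \<noteq> []" "v \<in> ?X" using v True k by (auto simp: G_def)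
        have less: "fst (hd v) < ?i" using hv(1) True by simp
        have vr: "v \<in> rest_words ?i" using hv less by (cases v) (auto simp: seqs_rest_def)
        \<comment> \<open>The first index of \<open>v\<close> is below the current one, which is
          fine if the sequence goes on rising or ends. At a peak the coming descent forbids
          \<open>v\<close>, and there the centering with respect to \<psi> removes its
          coefficient.\<close>
        have "ip (Hs ?i) (\<xi>s ?i) (\<sigma> ?i (a k) (\<xi>s ?i)) = 0 \<or> v \<in> G (Suc k)"
        proof (cases "Suc k < n \<and> ?i > js ! Suc k")
          case peak: True
          then have "k \<in> Peak js" using True k by (simp add: Peak_def len)
          then have "\<psi>s ?i (snd (w ! k)) = 0"
            using cent[of k] k by (simp add: position_functional_def js_def[symmetric] n_def)
          then show ?thesis using coeff[OF k(1) refl, of \<sigma>] \<sigma> \<psi>s[OF wk[OF k(1)]] by simp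
        qed (use hv less in \<open>auto simp: G_def\<close>)
        then have "(\<lambda>u. ip (Hs ?i) (\<xi>s ?i) (\<sigma> ?i (a k) (\<xi>s ?i)) * word_vector Hs \<xi>s v u
            + word_vector Hs \<xi>s ((?i, centering ?i (\<sigma> ?i (a k) (\<xi>s ?i))) # v) u) \<in> span_of ?X ?k (G (Suc k))"
          using v less opv[OF ac[OF k(1)] \<sigma>] by (intro one) auto
        then show ?thesis
          using J_less[OF ac[OF k(1)] hv(3,2) less] lambda_op_word[OF opc[OF ac[OF k(1)] \<sigma>] vr]
          by (simp add: word_vector_def)
      next
        case False
        then have gr: "?i < js ! (k - 1)" using ne by simp
        have hv: "fst (hd v) \<ge> js ! (k - 1)" "v \<noteq> []" "v \<in> ?X" using v gr k by (auto simp: G_def)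
        have greater: "?i < fst (hd v)" using hv(1) gr by simp
        have vr: "v \<in> rest_words ?i" using hv greater by (cases v) (auto simp: seqs_rest_def)
        have "ip (Hs ?i) (\<xi>s ?i) (\<rho> ?i (a k) (\<xi>s ?i)) = 0 \<or> v \<in> G (Suc k)"
        proof (cases "Suc k < n \<and> ?i < js ! Suc k")
          case bot: True
          \<comment> \<open>Excluding \<open>Peak\<close> is part of the argument because
            \<open>position_functional\<close> tests it before \<open>Bot\<close>.\<close>
          then have "k \<in> Bot js" "k \<notin> Peak js" using gr k by (auto simp: Bot_def Peak_def len)
          then have "\<theta>s ?i (snd (w ! k)) = 0"
            using cent[of k] k by (simp add: position_functional_def js_def[symmetric] n_def)
          then show ?thesis using coeff[OF k(1) refl, of \<rho>] \<rho> \<theta>s[OF wk[OF k(1)]] by simp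
        qed (use hv greater in \<open>auto simp: G_def\<close>)
        then have "(\<lambda>u. ip (Hs ?i) (\<xi>s ?i) (\<rho> ?i (a k) (\<xi>s ?i)) * word_vector Hs \<xi>s v u
            + word_vector Hs \<xi>s ((?i, centering ?i (\<rho> ?i (a k) (\<xi>s ?i))) # v) u) \<in> span_of ?X ?k (G (Suc k))"
          using v greater opv[OF ac[OF k(1)] \<rho>] by (intro one) auto
        then show ?thesis
          using J_greater[OF ac[OF k(1)] hv(3,2) greater] lambda_op_word[OF opc[OF ac[OF k(1)] \<rho>] vr]
          by (simp add: word_vector_def)
      qed
      show ?case
        unfolding step[OF k(1)]
        by (rule linear_maps_span_of[OF lin GX gen Suc.IH[OF less_imp_le[OF k(1)]]])
    qed
    from this[of n] have x: "fold push w ?\<Omega> \<in> span_of ?X ?k (G n)"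
      using w(2) by (simp add: n_def Suc_le_eq)
    let ?x = "fold push w ?\<Omega>"
    have xX: "?x \<in> span_of ?X ?k ?X" using x span_of_mono[of "G n" ?X ?X ?k] by (auto simp: G_def)
    \<comment> \<open>The value at the empty word is the inner product with the vacuum.\<close>
    have "?x [] = 0" using x by (rule span_of_vanishes) (auto simp: G_def intro!: word_kernel_eq_0)
    then have "ip ?H ?x ?\<Omega> = 0"
      using W.ip_span_commute[OF generator_in_span_of[OF Nil_tensor_word] xX] W.ip_generator[OF Nil_tensor_word xX]
      by (simp add: vacuum_def word_vector_def free_space_def)
    then show ?thesis using shift[OF w(1) vacuum_closed] by simp
  qed
  then show ?thesis unfolding vanishes_on_centered_words_def by blast
qed

section \<open>The vacuum states are the alpha-free product\<close>

theorem theorem3p1: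
  fixes A :: "'i::linorder \<Rightarrow> 'a star_algebra"
    and \<phi>s \<psi>s \<theta>s :: "'i \<Rightarrow> 'a \<Rightarrow> complex"
    and Hs :: "'i \<Rightarrow> 'h pre_hilbert"
    and \<xi>s :: "'i \<Rightarrow> 'h"
    and \<pi> \<sigma> \<rho> :: "'i \<Rightarrow> 'a \<Rightarrow> 'h \<Rightarrow> 'h"
    and J\<^sub>\<alpha> J\<^sub>\<beta> J\<^sub>\<gamma> :: "(('i \<times> 'a) list \<Rightarrow> complex) set \<Rightarrow> ('i, 'h) fock_vector \<Rightarrow> ('i, 'h) fock_vector"
    and H :: "('i, 'h) fock_vector pre_hilbert"
    and \<xi> :: "('i, 'h) fock_vector"
  assumes two_indices: "\<exists>i j :: 'i. i \<noteq> j"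
    and spaces: "\<And>i. star_probability_space3 (A i) (\<phi>s i) (\<psi>s i) (\<theta>s i)"
    and pointed: "\<And>i. pointed_pre_hilbert_space (Hs i) (\<xi>s i)"
    and rep_\<pi>: "\<And>i. unital_star_hom (A i) (adjointable_operators (Hs i)) (\<pi> i)"
    and rep_\<sigma>: "\<And>i. unital_star_hom (A i) (adjointable_operators (Hs i)) (\<sigma> i)"
    and rep_\<rho>: "\<And>i. unital_star_hom (A i) (adjointable_operators (Hs i)) (\<rho> i)"
    and \<phi>_vec: "\<And>i a. a \<in> carrier (A i) \<Longrightarrow> \<phi>s i a = ip (Hs i) (\<xi>s i) (\<pi> i a (\<xi>s i))"
    and \<psi>_vec: "\<And>i a. a \<in> carrier (A i) \<Longrightarrow> \<psi>s i a = ip (Hs i) (\<xi>s i) (\<sigma> i a (\<xi>s i))"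
    and \<theta>_vec: "\<And>i a. a \<in> carrier (A i) \<Longrightarrow> \<theta>s i a = ip (Hs i) (\<xi>s i) (\<rho> i a (\<xi>s i))"
    and H_eq: "H = free_space Hs \<xi>s"
    and \<xi>_eq: "\<xi> = vacuum Hs \<xi>s"
    and hom_\<alpha>: "unital_star_hom (free_product A) (adjointable_operators H) J\<^sub>\<alpha>"
    and hom_\<beta>: "unital_star_hom (free_product A) (adjointable_operators H) J\<^sub>\<beta>"
    and hom_\<gamma>: "unital_star_hom (free_product A) (adjointable_operators H) J\<^sub>\<gamma>"
    and restrict_\<alpha>: "\<And>i a. a \<in> carrier (A i) \<Longrightarrow> J\<^sub>\<alpha> (letter_embed A i a) = J_alpha Hs \<xi>s \<pi> \<sigma> \<rho> i a"
    and restrict_\<beta>: "\<And>i a. a \<in> carrier (A i) \<Longrightarrow> J\<^sub>\<beta> (letter_embed A i a) = J_beta Hs \<xi>s \<sigma> \<rho> i a"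
    and restrict_\<gamma>: "\<And>i a. a \<in> carrier (A i) \<Longrightarrow> J\<^sub>\<gamma> (letter_embed A i a) = J_gamma Hs \<xi>s \<sigma> \<rho> i a"
  shows "state (free_product A) (\<lambda>a. ip H \<xi> (J\<^sub>\<alpha> a \<xi>)) \<and>
         state (free_product A) (\<lambda>a. ip H \<xi> (J\<^sub>\<beta> a \<xi>)) \<and>
         state (free_product A) (\<lambda>a. ip H \<xi> (J\<^sub>\<gamma> a \<xi>)) \<and>
         is_alpha_free_product A \<phi>s \<psi>s \<theta>s
           (\<lambda>a. ip H \<xi> (J\<^sub>\<alpha> a \<xi>)) (\<lambda>a. ip H \<xi> (J\<^sub>\<beta> a \<xi>)) (\<lambda>a. ip H \<xi> (J\<^sub>\<gamma> a \<xi>))"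
proof -
  have A: "star_algebra_family A"
    using spaces by (intro star_algebra_family.intro) (simp add: star_probability_space3_def)
  have P: "pointed_family Hs \<xi>s" using pointed by (rule pointed_family.intro)
  interpret pointed_family Hs \<xi>s by (fact P)
  have \<phi>: "unital_linear_functional (A i) (\<phi>s i)" and \<psi>: "unital_linear_functional (A i) (\<psi>s i)"
    and \<theta>: "unital_linear_functional (A i) (\<theta>s i)" for i
    using spaces[of i] by (simp_all add: star_probability_space3_def state_def)
  note homs = hom_\<alpha>[unfolded H_eq] hom_\<beta>[unfolded H_eq] hom_\<gamma>[unfolded H_eq]
  have states: "state (free_product A) (\<lambda>a. ip H \<xi> (J\<^sub>\<alpha> a \<xi>))"
    "state (free_product A) (\<lambda>a. ip H \<xi> (J\<^sub>\<beta> a \<xi>))" "state (free_product A) (\<lambda>a. ip H \<xi> (J\<^sub>\<gamma> a \<xi>))"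
    unfolding H_eq \<xi>_eq by (rule vector_state[OF A pre_hilbert_free vacuum_closed vacuum_unit], rule homs)+
  have op: "\<upsilon> i a \<in> carrier (adjointable_operators (Hs i))"
    if "\<And>i. unital_star_hom (A i) (adjointable_operators (Hs i)) (\<upsilon> i)" "a \<in> carrier (A i)" for \<upsilon> i a
    using pre_hilbert_space.representation_closed[OF pre_hilbert that] .
  note values_Nil = J_values(1-3)[where w = "[]", OF P Nil_tensor_word op[OF rep_\<pi>] op[OF rep_\<sigma>] op[OF rep_\<rho>], simplified]
  note values_Cons = J_values(4-9)[OF P _ op[OF rep_\<pi>] op[OF rep_\<sigma>] op[OF rep_\<rho>], simplified]
  \<comment> \<open>The three cases differ only in the representation used at the vacuum, hence in
    the functional for the first letter: \<pi>, \<sigma> and \<rho> take the role of \<tau> in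
    turn.\<close>
  have vanish: "vanishes_on_centered_words A \<phi>s \<psi>s \<theta>s (\<lambda>a. ip H \<xi> (J\<^sub>\<alpha> a \<xi>))"
    "vanishes_on_centered_words A \<psi>s \<psi>s \<theta>s (\<lambda>a. ip H \<xi> (J\<^sub>\<beta> a \<xi>))"
    "vanishes_on_centered_words A \<theta>s \<psi>s \<theta>s (\<lambda>a. ip H \<xi> (J\<^sub>\<gamma> a \<xi>))"
    unfolding H_eq \<xi>_eq
      apply (rule vacuum_state_vanishes[OF A P rep_\<pi> rep_\<sigma> rep_\<rho> \<phi>_vec \<psi>_vec \<theta>_vec homs(1)];
        simp add: restrict_\<alpha> values_Nil values_Cons hd_map)
     apply (rule vacuum_state_vanishes[OF A P rep_\<sigma> rep_\<sigma> rep_\<rho> \<psi>_vec \<psi>_vec \<theta>_vec homs(2)];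
        simp add: restrict_\<beta> values_Nil values_Cons hd_map)
    apply (rule vacuum_state_vanishes[OF A P rep_\<rho> rep_\<sigma> rep_\<rho> \<theta>_vec \<psi>_vec \<theta>_vec homs(3)];
        simp add: restrict_\<gamma> values_Nil values_Cons hd_map)
    done
  have conditions: "alpha_free_conditions A \<phi>s \<psi>s \<theta>s
      (\<lambda>a. ip H \<xi> (J\<^sub>\<alpha> a \<xi>)) (\<lambda>a. ip H \<xi> (J\<^sub>\<beta> a \<xi>)) (\<lambda>a. ip H \<xi> (J\<^sub>\<gamma> a \<xi>))"
    using states vanish unfolding alpha_free_conditions_def state_def by blast
  moreover have "\<phi>' x = \<phi>'' x \<and> \<psi>' x = \<psi>'' x \<and> \<theta>' x = \<theta>'' x"
    if "alpha_free_conditions A \<phi>s \<psi>s \<theta>s \<phi>' \<psi>' \<theta>'" "alpha_free_conditions A \<phi>s \<psi>s \<theta>s \<phi>'' \<psi>'' \<theta>''"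
      "x \<in> carrier (free_product A)" for \<phi>' \<psi>' \<theta>' \<phi>'' \<psi>'' \<theta>'' x
  proof (intro conjI)
    note conds = that(1,2)[unfolded alpha_free_conditions_def]
    note unique = vanishes_on_centered_words_unique[OF A _ \<psi> \<theta> _ _ _ _ that(3)]
    show "\<phi>' x = \<phi>'' x" by (rule unique[OF \<phi>]) (simp_all only: conds)
    show "\<psi>' x = \<psi>'' x" by (rule unique[OF \<psi>]) (simp_all only: conds)
    show "\<theta>' x = \<theta>'' x" by (rule unique[OF \<theta>]) (simp_all only: conds)
  qed
  ultimately show ?thesis
    using states unfolding is_alpha_free_product_def by blast
qed

end
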